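(* Let $5\le n\le 10$, and let $G$ be a graph in $\mathcal{G}_{n,n-4}$ having the minimum $A_\alpha$ spectral radius among all graphs in $\mathcal{G}_{n,n-4}$. For integers $s,t\ge1$ let $F_{s,t}$ be the complement of $K_{s,t}-e$, where $e=uv$ is an edge of the complete bipartite graph $K_{s,t}$ with $u$ in the part of size $s$ and $v$ in the part of size $t$. Then: (i) if $n=5$, then $G\cong K_5$ for $\alpha\in[0,1)$; (ii) if $n=6$, then $G\cong F_{3,3}$ for $\alpha\in[0,\frac{7}{9}]$; (iii) if $n=7$, then $G\cong C_7$ for $\alpha\in[0,1)$; (iv) if $n\in\{8,9\}$, then $G\cong P_n$ for $\alpha\in[0,1)$; (v) if $n=10$, then $G\cong T_{1,1,7}$ for $\alpha\in[0,1)$.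
   Context: All graphs are simple and connected. For a graph $G$ with adjacency matrix $A(G)$ and diagonal degree matrix $D(G)$, and a real $\alpha\in[0,1]$, $A_\alpha(G)=\alpha D(G)+(1-\alpha)A(G)$; the $A_\alpha$ spectral radius $\lambda_\alpha(G)$ is the largest eigenvalue of $A_\alpha(G)$. $\mathcal{G}_{n,i}$ denotes the set of connected graphs of order $n$ with independence number $i$. $P_n$, $C_n$, $K_n$ denote the path, cycle and complete graph on $n$ vertices. A vertex is major if its degree is at least 3; $T_{a,b,c}$ is the tree with exactly one major vertex $w$ such that $T_{a,b,c}-w\cong P_a\cup P_b\cup P_c$. The complement $H^c$ of a graph $H$ has the same vertex set, with two distinct vertices adjacent iff they are non-adjacent in $H$. *)

theory Defs
  imports
    "Graph_Theory.Graph_Theory"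
    "Jordan_Normal_Form.Char_Poly"
begin

text \<open>
  A finite simple graph is a \<open>pair_graph\<close>: a finite, loop-free digraph without parallel arcs whose
  arc relation is symmetric, so that the edge \<open>uv\<close> is the pair of arcs \<open>(u,v)\<close>, \<open>(v,u)\<close>.
\<close>

abbreviation graph_iso :: "'a pair_pre_digraph \<Rightarrow> 'b pair_pre_digraph \<Rightarrow> bool" where
  "graph_iso G H \<equiv> digraph_iso (with_proj G) (with_proj H)"

text \<open>In a \<open>pair_graph\<close> the out-degree of a vertex is its degree.\<close>

abbreviation degree_of :: "'a pair_pre_digraph \<Rightarrow> 'a \<Rightarrow> nat" where
  "degree_of G v \<equiv> out_degree (with_proj G) v"

definition independent_set :: "'a pair_pre_digraph \<Rightarrow> 'a set \<Rightarrow> bool" where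
  "independent_set G S \<longleftrightarrow> S \<subseteq> pverts G \<and> (\<forall>u\<in>S. \<forall>v\<in>S. (u, v) \<notin> parcs G)"

definition independence_number :: "'a pair_pre_digraph \<Rightarrow> nat" where
  "independence_number G = Max {card S | S. independent_set G S}"

text \<open>
  All vertices are taken from one type. If that type admits a graph of order \<open>n\<close> at all, every
  isomorphism class of graphs of order \<open>n\<close> is represented, so minimising over this set is
  minimising over all graphs.
\<close>

definition conn_graphs :: "nat \<Rightarrow> nat \<Rightarrow> 'a pair_pre_digraph set" where
  "conn_graphs n i =
    {G. pair_graph G \<and> connected (with_proj G) \<and> card (pverts G) = n \<and> independence_number G = i}"

section \<open>The matrix and its spectral radius\<close>

text \<open>
  Rows and columns are indexed by a list \<open>vs\<close> enumerating the vertices.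
\<close>

definition adj_matrix :: "'a pair_pre_digraph \<Rightarrow> 'a list \<Rightarrow> real mat" where
  "adj_matrix G vs =
    mat (length vs) (length vs) (\<lambda>(i, j). if (vs ! i, vs ! j) \<in> parcs G then 1 else 0)"

definition degree_matrix :: "'a pair_pre_digraph \<Rightarrow> 'a list \<Rightarrow> real mat" where
  "degree_matrix G vs =
    mat (length vs) (length vs) (\<lambda>(i, j). if i = j then real (degree_of G (vs ! i)) else 0)"

definition A_matrix :: "real \<Rightarrow> 'a pair_pre_digraph \<Rightarrow> 'a list \<Rightarrow> real mat" where
  "A_matrix \<alpha> G vs = \<alpha> \<cdot>\<^sub>m degree_matrix G vs + (1 - \<alpha>) \<cdot>\<^sub>m adj_matrix G vs"

text \<open>
  Different enumerations give permutation-similar matrices, hence the same eigenvalues. The matrix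
  is real symmetric, so all its eigenvalues are real.
\<close>

definition A_eigenvalue :: "real \<Rightarrow> 'a pair_pre_digraph \<Rightarrow> real \<Rightarrow> bool" where
  "A_eigenvalue \<alpha> G k \<longleftrightarrow>
    (\<exists>vs. distinct vs \<and> set vs = pverts G \<and> eigenvalue (A_matrix \<alpha> G vs) k)"

definition A_spectral_radius :: "real \<Rightarrow> 'a pair_pre_digraph \<Rightarrow> real" where
  "A_spectral_radius \<alpha> G = Max {k. A_eigenvalue \<alpha> G k}"

section \<open>The extremal graphs\<close>

definition path_graph :: "nat \<Rightarrow> nat pair_pre_digraph" where
  "path_graph n = \<lparr>pverts = {..<n},
     parcs = {(i, j). i < n \<and> j < n \<and> (j = Suc i \<or> i = Suc j)}\<rparr>"

text \<open>A simple graph only for \<open>n \<ge> 3\<close>.\<close>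

definition cycle_graph :: "nat \<Rightarrow> nat pair_pre_digraph" where
  "cycle_graph n = \<lparr>pverts = {..<n},
     parcs = {(i, j). i < n \<and> j < n \<and> (j = Suc i mod n \<or> i = Suc j mod n)}\<rparr>"

definition complement_graph :: "'a pair_pre_digraph \<Rightarrow> 'a pair_pre_digraph" where
  "complement_graph H = \<lparr>pverts = pverts H,
     parcs = {(u, v). u \<in> pverts H \<and> v \<in> pverts H \<and> u \<noteq> v \<and> (u, v) \<notin> parcs H}\<rparr>"

definition delete_edge :: "'a pair_pre_digraph \<Rightarrow> 'a \<Rightarrow> 'a \<Rightarrow> 'a pair_pre_digraph" where
  "delete_edge H u v = H\<lparr>parcs := parcs H - {(u, v), (v, u)}\<rparr>"

text \<open>
  \<open>G\<close> is isomorphic to the complement of \<open>K\<^bsub>s,t\<^esub> - uv\<close>. All choices of the edge \<open>uv\<close> are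
  equivalent under automorphisms of \<open>K\<^bsub>s,t\<^esub>\<close>.
\<close>

definition iso_F :: "nat \<Rightarrow> nat \<Rightarrow> 'a pair_pre_digraph \<Rightarrow> bool" where
  "iso_F s t G \<longleftrightarrow> (\<exists>(K :: nat pair_pre_digraph) u v.
     complete_bipartite_digraph s t (with_proj K) \<and> (u, v) \<in> parcs K \<and>
     graph_iso G (complement_graph (delete_edge K u v)))"

text \<open>
  The constant \<open>tree\<close> of the library cannot be used: it also forbids cycles of length two, which
  every edge of a symmetric digraph gives rise to. A cycle of an undirected graph is a directed
  cycle of length at least three.
\<close>

definition undirected_tree :: "'a pair_pre_digraph \<Rightarrow> bool" where
  "undirected_tree G \<longleftrightarrow> pair_graph G \<and> connected (with_proj G) \<and>
     \<not> (\<exists>p. pre_digraph.cycle (with_proj G) p \<and> length p \<ge> 3)"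

definition disjoint_union ::
  "'a pair_pre_digraph \<Rightarrow> 'b pair_pre_digraph \<Rightarrow> ('a + 'b) pair_pre_digraph" where
  "disjoint_union G H = \<lparr>pverts = pverts G <+> pverts H,
     parcs = map_prod Inl Inl ` parcs G \<union> map_prod Inr Inr ` parcs H\<rparr>"

definition major_vertex :: "'a pair_pre_digraph \<Rightarrow> 'a \<Rightarrow> bool" where
  "major_vertex G v \<longleftrightarrow> v \<in> pverts G \<and> degree_of G v \<ge> 3"

text \<open>\<open>G\<close> is (a copy of) the tree \<open>T\<^bsub>a,b,c\<^esub>\<close>.\<close>

definition iso_T :: "nat \<Rightarrow> nat \<Rightarrow> nat \<Rightarrow> 'a pair_pre_digraph \<Rightarrow> bool" where
  "iso_T a b c G \<longleftrightarrow> undirected_tree G \<and>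
     (\<exists>w. (\<forall>v. major_vertex G v \<longleftrightarrow> v = w) \<and>
       digraph_iso (pre_digraph.del_vert (with_proj G) w)
         (with_proj (disjoint_union (path_graph a)
           (disjoint_union (path_graph b) (path_graph c)))))"

end

(*
  Normalise an eigenvalue l of A_alpha to s = (l - 2 alpha) / (1 - alpha), and put r = alpha / (1 - alpha).
  Along a pendant path a positive eigenvector obeys the recurrence of the continued fraction
  F_0 = -r, F_(k+1) = 1 / (s - F_k), and a spider with arms of lengths a, b, c satisfies
  F_a + F_b + F_c = s - r.  If the spider is only a subgraph of G and s is taken from an upper bound for
  the spectral radius of G, then "<=" still holds for the Perron vector of G.

  A connected graph is a path, or a cycle, or it has a vertex of degree at least three.  A spider centred
  at such a vertex can be extended until it spans G, unless G contains a path with two pendant leaves at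
  each end (or K_(1,4)).  Let p <= 1 with s = p + 1/p be the limit of F_k.  When s - r - 2 F_1 < p, these
  doubly forked paths are impossible, and so are spiders whose arms are at least (2,2,2), (1,3,3) or
  (1,2,5).  The bound applies with s = 2, because the path has spectral radius below 2, and with the value
  of s belonging to T_(1,1,7), for which s - r - 2 F_1 = F_7 < p.  This leaves T_(1,1,n-3) and T_(1,2,4),
  which are compared with the path by the same recurrence.

  For n = 7 the cycle has spectral radius 2, so the Rayleigh quotient of the constant vector bounds the
  number of edges by 7; with fewer edges G is a tree, and a colour class of a 2-colouring is independent
  of size 4.  For n = 6 the radius of F_(3,3) is at most 8/3 when alpha <= 7/9, which leaves at most seven
  edges, and counting edges around a vertex of degree at most two leaves only two triangles joined by an edge.
*)
theory Submission
  imports Defs "HOL-Analysis.Function_Topology"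
begin

section \<open>The spectral radius as a maximal Rayleigh quotient\<close>

text \<open>The excluded shapes are the affine Dynkin diagrams: doubly forked paths and
  \<open>K_(1,4)\<close> form the D-tilde family, and the spiders with arms (2,2,2), (1,3,3),
  (1,2,5) are E6-, E7- and E8-tilde. For r = 0 and s = 2 one has F_k = k/(k+1), and each of the
  three spiders satisfies the centre equation exactly. The obstacle is that the value s of T_(1,1,7)
  can exceed 2 when \<alpha> is large, so the classical list for spectral radius 2 does not apply
  directly. It survives because the defect p - F_k shrinks at each step at least by the factor
  (k+1)/(k+2), whatever r and s are; this factor is attained at r = 0, s = 2, so the same arm
  lengths appear for every \<alpha>. The constant 8/3 for n = 6 is the average degree of a graph
  with eight edges. Since no degree is 8/3, equality in the Rayleigh bound is impossible, which
  lowers eight edges to seven.\<close>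

abbreviation nbrs :: "'a pair_pre_digraph \<Rightarrow> 'a \<Rightarrow> 'a set" where
  "nbrs G v \<equiv> {u. (v, u) \<in> parcs G}"

text \<open>This is the matrix as an operator on vertex functions, free of an enumeration. Grouping
  the diagonal share with each neighbour makes every summand nonnegative for nonnegative
  \<open>x\<close> and \<open>a\<close> in [0,1], so that adding or dropping arcs has a definite
  sign.\<close>

definition Aop :: "real \<Rightarrow> 'a pair_pre_digraph \<Rightarrow> ('a \<Rightarrow> real) \<Rightarrow> 'a \<Rightarrow> real" where
  "Aop a G x v = (\<Sum>u\<in>nbrs G v. a * x v + (1 - a) * x u)"

context pair_graph begin

lemma arc_sym: "(u, v) \<in> parcs G \<longleftrightarrow> (v, u) \<in> parcs G"
  using pair_sym_arcs by (auto simp: symmetric_def sym_def)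

lemma nbrs_subset: "nbrs G v \<subseteq> pverts G"
  by (auto dest: in_arcsD2)

lemma finite_nbrs [simp, intro]: "finite (nbrs G v)"
  using nbrs_subset pair_finite_verts by (rule finite_subset)

lemma not_self_nbr [simp]: "(v, v) \<notin> parcs G"
  using pair_no_loops[of "(v, v)"] by auto

lemma degree_of_eq: "degree_of G v = card (nbrs G v)"
proof -
  have "out_arcs (with_proj G) v = Pair v ` nbrs G v"
    by (auto simp: out_arcs_def)
  then show ?thesis
    by (simp add: out_degree_def card_image inj_on_def)
qed

lemma Aop_eq: "Aop a G x v = a * real (card (nbrs G v)) * x v + (1 - a) * (\<Sum>u\<in>nbrs G v. x u)"
  by (simp add: Aop_def sum.distrib sum_distrib_left)

lemma A_matrix_mult:
  assumes vs: "distinct vs" "set vs = pverts G" and i: "i < length vs"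
  shows "(A_matrix a G vs *\<^sub>v vec (length vs) (\<lambda>i. x (vs ! i))) $ i = Aop a G x (vs ! i)"
proof -
  have bij: "bij_betw (\<lambda>j. vs ! j) {0..<length vs} (pverts G)"
    using vs bij_betw_nth[OF vs(1)] by (simp add: atLeast0LessThan)
  have "(A_matrix a G vs *\<^sub>v vec (length vs) (\<lambda>i. x (vs ! i))) $ i
      = (\<Sum>j = 0..<length vs. (a * (if i = j then real (card (nbrs G (vs ! i))) else 0)
            + (1 - a) * (if (vs ! i, vs ! j) \<in> parcs G then 1 else 0)) * x (vs ! j))"
    using i unfolding A_matrix_def adj_matrix_def degree_matrix_def degree_of_eq
    by (simp add: scalar_prod_def)
  also have "\<dots> = (\<Sum>j = 0..<length vs. (if i = j then a * real (card (nbrs G (vs ! i))) * x (vs ! j) else 0))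
      + (\<Sum>j = 0..<length vs. (1 - a) * (if (vs ! i, vs ! j) \<in> parcs G then x (vs ! j) else 0))"
    unfolding sum.distrib[symmetric] by (intro sum.cong) (auto simp: algebra_simps)
  also have "(\<Sum>j = 0..<length vs. (1 - a) * (if (vs ! i, vs ! j) \<in> parcs G then x (vs ! j) else 0))
      = (\<Sum>u\<in>pverts G. (1 - a) * (if (vs ! i, u) \<in> parcs G then x u else 0))"
    by (rule sum.reindex_bij_betw[OF bij])
  also have "\<dots> = (1 - a) * (\<Sum>u\<in>nbrs G (vs ! i). x u)"
    using nbrs_subset[of "vs ! i"] pair_finite_verts
    by (auto simp: sum_distrib_left[symmetric] sum.If_cases Int_absorb1 Collect_conj_eq
        intro!: arg_cong2[of _ _ _ _ sum] dest: in_arcsD2)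
  finally show ?thesis
    using i by (simp add: Aop_eq sum.delta)
qed

lemma eigenvalue_A_matrix_iff:
  assumes vs: "distinct vs" "set vs = pverts G"
  shows "eigenvalue (A_matrix a G vs) k \<longleftrightarrow>
    (\<exists>x. (\<exists>v\<in>pverts G. x v \<noteq> 0) \<and> (\<forall>v\<in>pverts G. Aop a G x v = k * x v))"
proof
  have dim: "dim_row (A_matrix a G vs) = length vs"
    by (simp add: A_matrix_def degree_matrix_def adj_matrix_def)
  show "\<exists>x. (\<exists>v\<in>pverts G. x v \<noteq> 0) \<and> (\<forall>v\<in>pverts G. Aop a G x v = k * x v)"
    if "eigenvalue (A_matrix a G vs) k"
  proof -
    from that obtain z where z: "z \<in> carrier_vec (length vs)" "z \<noteq> 0\<^sub>v (length vs)"
      "A_matrix a G vs *\<^sub>v z = k \<cdot>\<^sub>v z"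
      by (auto simp: eigenvalue_def eigenvector_def dim)
    define x where "x v = z $ (THE i. i < length vs \<and> vs ! i = v)" for v
    have x: "x (vs ! i) = z $ i" if "i < length vs" for i
    proof -
      have "(THE j. j < length vs \<and> vs ! j = vs ! i) = i"
        using that vs(1) by (intro the_equality) (auto simp: nth_eq_iff_index_eq)
      then show ?thesis by (simp add: x_def)
    qed
    have zx: "z = vec (length vs) (\<lambda>i. x (vs ! i))"
      using z(1) by (intro eq_vecI) (auto simp: x)
    have "Aop a G x v = k * x v" if "v \<in> pverts G" for v
    proof -
      from that vs obtain i where i: "i < length vs" "v = vs ! i" by (metis in_set_conv_nth)
      have "Aop a G x (vs ! i) = (A_matrix a G vs *\<^sub>v z) $ i"
        using A_matrix_mult[OF vs i(1), of a x] zx by simp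
      also have "\<dots> = k * x (vs ! i)"
        using z i by (simp add: x)
      finally show ?thesis using i by simp
    qed
    moreover have "\<exists>v\<in>pverts G. x v \<noteq> 0"
    proof (rule ccontr)
      assume "\<not> ?thesis"
      then have "z = 0\<^sub>v (length vs)"
        using vs z(1) by (intro eq_vecI) (auto simp flip: x)
      with z show False by simp
    qed
    ultimately show ?thesis by blast
  qed
  show "eigenvalue (A_matrix a G vs) k"
    if ex: "\<exists>x. (\<exists>v\<in>pverts G. x v \<noteq> 0) \<and> (\<forall>v\<in>pverts G. Aop a G x v = k * x v)"
  proof -
    from ex obtain x w where x: "w \<in> pverts G" "x w \<noteq> 0" "\<forall>v\<in>pverts G. Aop a G x v = k * x v"
      by blast
    let ?z = "vec (length vs) (\<lambda>i. x (vs ! i))"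
    obtain i where i: "i < length vs" "w = vs ! i" using x(1) vs by (metis in_set_conv_nth)
    have "?z $ i \<noteq> 0\<^sub>v (length vs) $ i" using i x(2) by simp
    then have "?z \<noteq> 0\<^sub>v (length vs)" by metis
    moreover have "A_matrix a G vs *\<^sub>v ?z = k \<cdot>\<^sub>v ?z"
    proof (rule eq_vecI)
      fix i assume "i < dim_vec (k \<cdot>\<^sub>v ?z)"
      then show "(A_matrix a G vs *\<^sub>v ?z) $ i = (k \<cdot>\<^sub>v ?z) $ i"
        using A_matrix_mult[OF vs, of i a x] x(3) vs nth_mem[of i vs] by (simp del: index_mult_mat_vec nth_mem)
    qed (simp add: dim)
    ultimately have "eigenvector (A_matrix a G vs) ?z k"
      by (simp add: eigenvector_def dim)
    then show ?thesis by (auto simp: eigenvalue_def)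
  qed
qed

lemma A_eigenvalue_iff:
  "A_eigenvalue a G k \<longleftrightarrow>
    (\<exists>x. (\<exists>v\<in>pverts G. x v \<noteq> 0) \<and> (\<forall>v\<in>pverts G. Aop a G x v = k * x v))"
  using eigenvalue_A_matrix_iff finite_distinct_list[OF pair_finite_verts]
  unfolding A_eigenvalue_def by metis

text \<open>\<open>A_spectral_radius\<close> is a \<open>Max\<close>, which has its intended meaning
  only on a finite set; the eigenvalues are the roots of a nonzero characteristic
  polynomial.\<close>

lemma finite_A_eigenvalues: "finite {k. A_eigenvalue a G k}"
proof -
  obtain vs where vs: "set vs = pverts G" "distinct vs"
    using finite_distinct_list[OF pair_finite_verts] by blast
  have carrier: "A_matrix a G vs \<in> carrier_mat (length vs) (length vs)"
    by (simp add: A_matrix_def degree_matrix_def adj_matrix_def carrier_matI)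
  have "{k. A_eigenvalue a G k} = {k. poly (char_poly (A_matrix a G vs)) k = 0}"
    using eigenvalue_root_char_poly[OF carrier]
    by (simp add: A_eigenvalue_iff flip: eigenvalue_A_matrix_iff[OF vs(2,1)])
  moreover have "char_poly (A_matrix a G vs) \<noteq> 0"
    using degree_monic_char_poly[OF carrier] by (metis coeff_0 zero_neq_one)
  ultimately show ?thesis
    by (simp add: poly_roots_finite)
qed

lemma sum_Aop_conv_arcs:
  "(\<Sum>v\<in>pverts G. y v * Aop a G x v)
    = (\<Sum>(v, u)\<in>parcs G. y v * (a * x v + (1 - a) * x u))"
proof -
  have "parcs G = Sigma (pverts G) (nbrs G)"
    by (auto dest: in_arcsD1)
  then show ?thesis
    using pair_finite_verts by (simp add: Aop_def sum_distrib_left sum.Sigma)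
qed

text \<open>Reversing arcs permutes the arc set and exchanges the mixed terms
  \<open>y v * x u\<close>; the diagonal terms are already symmetric in \<open>x\<close> and
  \<open>y\<close>. This self-adjointness turns vertexwise inequalities into bounds on the spectral
  radius.\<close>

lemma sum_Aop_commute:
  "(\<Sum>v\<in>pverts G. y v * Aop a G x v) = (\<Sum>v\<in>pverts G. x v * Aop a G y v)"
proof -
  have swap: "(\<Sum>(v, u)\<in>parcs G. f v u) = (\<Sum>(v, u)\<in>parcs G. f u v)" for f :: "'a \<Rightarrow> 'a \<Rightarrow> real"
    by (rule sum.reindex_bij_witness[of _ prod.swap prod.swap]) (auto simp: arc_sym)
  show ?thesis
    unfolding sum_Aop_conv_arcs
    using swap[of "\<lambda>v u. y v * x u"]
    by (simp add: algebra_simps sum.distrib case_prod_unfold sum_subtractf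
        sum_distrib_left[symmetric] sum_distrib_right[symmetric])
qed

lemma Aop_add: "Aop a G (\<lambda>v. x v + t * z v) v = Aop a G x v + t * Aop a G z v"
  by (simp add: Aop_eq algebra_simps sum.distrib sum_distrib_left)

lemma Aop_scale: "Aop a G (\<lambda>v. c * z v) v = c * Aop a G z v"
  by (simp add: Aop_eq algebra_simps sum_distrib_left)

text \<open>The nonnegative form \<open>m |y|\<^sup>2 - \<langle>y, A y\<rangle>\<close> vanishes at \<open>x\<close>, so its gradient vanishes there too.\<close>

lemma rayleigh_max_eigen:
  assumes bound: "\<And>y. (\<Sum>v\<in>pverts G. y v * Aop a G y v) \<le> m * (\<Sum>v\<in>pverts G. (y v)\<^sup>2)"
    and attained: "(\<Sum>v\<in>pverts G. x v * Aop a G x v) = m * (\<Sum>v\<in>pverts G. (x v)\<^sup>2)"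
    and v: "v \<in> pverts G"
  shows "Aop a G x v = m * x v"
proof -
  define z where "z v = Aop a G x v - m * x v" for v
  define Z where "Z = (\<Sum>v\<in>pverts G. (z v)\<^sup>2)"
  define C where "C = (\<Sum>v\<in>pverts G. z v * Aop a G z v) - m * (\<Sum>v\<in>pverts G. (z v)\<^sup>2)"
  \<comment> \<open>The bound is evaluated at \<open>x + t z\<close>, with \<open>z\<close> the
    residual. The constant term vanishes by \<open>attained\<close>, and self-adjointness makes the
    linear coefficient \<open>2 * Z\<close>.\<close>
  have key: "2 * t * Z + t\<^sup>2 * C \<le> 0" for t
  proof -
    have "(\<Sum>v\<in>pverts G. (x v + t * z v) * Aop a G (\<lambda>v. x v + t * z v) v)
        = (\<Sum>v\<in>pverts G. x v * Aop a G x v) + t * (\<Sum>v\<in>pverts G. z v * Aop a G x v)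
          + t * (\<Sum>v\<in>pverts G. x v * Aop a G z v) + t\<^sup>2 * (\<Sum>v\<in>pverts G. z v * Aop a G z v)"
      by (simp add: Aop_add algebra_simps sum.distrib sum_distrib_left power2_eq_square)
    moreover have "(\<Sum>v\<in>pverts G. (x v + t * z v)\<^sup>2)
        = (\<Sum>v\<in>pverts G. (x v)\<^sup>2) + 2 * t * (\<Sum>v\<in>pverts G. z v * x v) + t\<^sup>2 * (\<Sum>v\<in>pverts G. (z v)\<^sup>2)"
      by (simp add: power2_eq_square algebra_simps sum.distrib sum_distrib_left)
    moreover have "Z = (\<Sum>v\<in>pverts G. z v * Aop a G x v) - m * (\<Sum>v\<in>pverts G. z v * x v)"
      by (simp add: Z_def z_def power2_eq_square algebra_simps sum_subtractf sum_distrib_left sum.distrib)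
    moreover have "t * Z = t * (\<Sum>v\<in>pverts G. z v * Aop a G x v) - t * (m * (\<Sum>v\<in>pverts G. z v * x v))"
      by (simp add: calculation(3) right_diff_distrib)
    ultimately show ?thesis
      using bound[of "\<lambda>v. x v + t * z v"] attained sum_Aop_commute[of x a z]
      by (simp only: C_def) (simp add: algebra_simps)
  qed
  have "Z \<ge> 0" by (simp add: Z_def sum_nonneg)
  moreover have "\<not> Z > 0"
  proof
    assume "Z > 0"
    \<comment> \<open>Small enough that \<open>t * C\<close> cannot cancel the positive term
      \<open>2 * Z\<close>.\<close>
    define t where "t = Z / (\<bar>C\<bar> + 1)"
    have "t > 0" using \<open>Z > 0\<close> by (simp add: t_def)
    have "t * (2 * Z + t * C) \<le> 0"
      using key[of t] by (simp add: power2_eq_square algebra_simps)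
    then have "2 * Z + t * C \<le> 0"
      using \<open>t > 0\<close> by (simp add: mult_le_0_iff)
    moreover have "t * C \<ge> - Z"
    proof -
      have "t * \<bar>C\<bar> \<le> Z" using \<open>Z > 0\<close> by (simp add: t_def field_simps)
      moreover have "t * \<bar>C\<bar> \<ge> - (t * C)" using \<open>t > 0\<close> by (simp add: abs_if)
      ultimately show ?thesis by linarith
    qed
    ultimately show False using \<open>Z > 0\<close> by linarith
  qed
  ultimately have "Z = 0" by linarith
  then have "z v = 0"
    using v pair_finite_verts by (simp add: Z_def sum_nonneg_eq_0_iff)
  then show ?thesis by (simp add: z_def)
qed

text \<open>The form is maximised over the nonnegative part of the unit sphere. The functions live
  on the whole type, so compactness comes from a product of compact sets: the unit interval at
  vertices, a single point elsewhere. Passing to absolute values never lowers the form because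
  \<open>1 - a\<close> is nonnegative, so this restricted maximum is the global one and its
  maximiser is a nonnegative eigenvector.\<close>

lemma rayleigh_attained:
  assumes ne: "pverts G \<noteq> {}" and a: "a \<le> 1"
  obtains m x where "\<And>y. (\<Sum>v\<in>pverts G. y v * Aop a G y v) \<le> m * (\<Sum>v\<in>pverts G. (y v)\<^sup>2)"
    and "\<And>v. x v \<ge> 0" and "\<exists>v\<in>pverts G. x v \<noteq> 0"
    and "\<And>v. v \<in> pverts G \<Longrightarrow> Aop a G x v = m * x v"
proof -
  let ?V = "pverts G"
  define q where "q x = (\<Sum>v\<in>?V. x v * Aop a G x v)" for x
  define N where "N x = (\<Sum>v\<in>?V. (x v)\<^sup>2)" for x :: "'a \<Rightarrow> real"
  define S where "S = (\<lambda>v. if v \<in> ?V then {0..1::real} else {0})"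
  define K where "K = PiE UNIV S \<inter> {x. N x = 1}"
  have cont_N: "continuous_on UNIV N"
    unfolding N_def by (intro continuous_intros continuous_on_product_coordinates)
  have cont_q: "continuous_on UNIV q"
    unfolding q_def Aop_def by (intro continuous_intros continuous_on_product_coordinates)
  have "compact (PiE UNIV S)"
    using compactin_PiE[of "\<lambda>_. euclidean" UNIV S]
    by (auto simp: euclidean_product_topology S_def)
  moreover have "closed {x. N x = 1}"
    using closed_vimage[OF closed_singleton cont_N, of 1] by (simp add: vimage_def)
  ultimately have "compact K" unfolding K_def by (rule compact_Int_closed)
  obtain w where w: "w \<in> ?V" using ne by blast
  have "N (\<lambda>v. if v = w then 1 else 0) = (\<Sum>v\<in>?V. if v = w then 1 else 0)"
    unfolding N_def by (intro sum.cong) auto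
  then have "(\<lambda>v. if v = w then 1 else 0) \<in> K"
    using w pair_finite_verts by (auto simp: K_def S_def)
  then have "K \<noteq> {}" by blast
  obtain x where x: "x \<in> K" "\<And>y. y \<in> K \<Longrightarrow> q y \<le> q x"
    using continuous_attains_sup[OF \<open>compact K\<close> \<open>K \<noteq> {}\<close> continuous_on_subset[OF cont_q]] by auto
  have q_abs: "q y \<le> q (\<lambda>v. \<bar>y v\<bar>)" for y
    unfolding q_def sum_Aop_conv_arcs
  proof (rule sum_mono, clarify)
    fix v u
    have "y v * y u \<le> \<bar>y v\<bar> * \<bar>y u\<bar>"
      by (metis abs_ge_self abs_mult)
    then have "(1 - a) * (y v * y u) \<le> (1 - a) * (\<bar>y v\<bar> * \<bar>y u\<bar>)"
      using a by (intro mult_left_mono) auto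
    moreover have "y v * (a * y v) = \<bar>y v\<bar> * (a * \<bar>y v\<bar>)"
      by (cases "y v \<ge> 0") auto
    ultimately show "y v * (a * y v + (1 - a) * y u) \<le> \<bar>y v\<bar> * (a * \<bar>y v\<bar> + (1 - a) * \<bar>y u\<bar>)"
      by (simp add: algebra_simps)
  qed
  have bound: "q y \<le> q x * N y" for y
  proof (cases "N y = 0")
    case True
    then have "\<forall>v\<in>?V. y v = 0"
      using pair_finite_verts by (simp add: N_def sum_nonneg_eq_0_iff)
    then have "q y = 0" by (simp add: q_def)
    with True show ?thesis by simp
  next
    case False
    have "N y \<ge> 0" by (simp add: N_def sum_nonneg)
    with False have Ny: "N y > 0" by simp
    define c where "c = 1 / sqrt (N y)"
    have c: "c > 0" "c\<^sup>2 = 1 / N y" using Ny by (auto simp: c_def power_divide)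
    define z where "z v = (if v \<in> ?V then c * \<bar>y v\<bar> else 0)" for v
    have "N z = c\<^sup>2 * N y"
      by (simp add: N_def z_def power_mult_distrib sum_distrib_left)
    then have Nz: "N z = 1" using c Ny by simp
    have "z v \<in> S v" for v
    proof (cases "v \<in> ?V")
      case True
      have "(z v)\<^sup>2 \<le> N z" unfolding N_def
        using True pair_finite_verts by (intro member_le_sum) auto
      then have "z v \<le> 1" using Nz power2_le_imp_le[of "z v" 1] by simp
      then show ?thesis using True c by (simp add: S_def z_def)
    qed (simp add: S_def z_def)
    then have "z \<in> K" using Nz by (simp add: K_def PiE_UNIV_domain)
    then have "q z \<le> q x" by (rule x)
    moreover have "Aop a G z v = Aop a G (\<lambda>v. c * \<bar>y v\<bar>) v" if "v \<in> ?V" for v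
      unfolding Aop_def using that by (intro sum.cong) (auto simp: z_def dest: in_arcsD2)
    then have "q z = q (\<lambda>v. c * \<bar>y v\<bar>)"
      unfolding q_def by (intro sum.cong) (auto simp: z_def)
    moreover have "\<dots> = c\<^sup>2 * q (\<lambda>v. \<bar>y v\<bar>)"
      by (simp add: q_def Aop_scale sum_distrib_left power2_eq_square algebra_simps)
    ultimately have "q (\<lambda>v. \<bar>y v\<bar>) \<le> q x * N y"
      using c Ny by (simp add: field_simps)
    then show ?thesis using q_abs[of y] by linarith
  qed
  have "N x = 1" using x(1) by (simp add: K_def)
  moreover have "x v \<ge> 0" for v
  proof -
    have "x v \<in> S v" using x(1) by (auto simp: K_def)
    then show ?thesis by (auto simp: S_def split: if_splits)
  qed
  moreover have "Aop a G x v = q x * x v" if "v \<in> ?V" for v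
  proof (rule rayleigh_max_eigen[OF _ _ that])
    show "(\<Sum>v\<in>?V. y v * Aop a G y v) \<le> q x * (\<Sum>v\<in>?V. (y v)\<^sup>2)" for y
      using bound[of y] by (simp only: q_def N_def)
    show "(\<Sum>v\<in>?V. x v * Aop a G x v) = q x * (\<Sum>v\<in>?V. (x v)\<^sup>2)"
      using \<open>N x = 1\<close> by (simp only: q_def N_def mult_1_right)
  qed
  moreover have "\<exists>v\<in>?V. x v \<noteq> 0"
  proof (rule ccontr)
    assume "\<not> ?thesis"
    then have "N x = 0" by (simp add: N_def)
    with \<open>N x = 1\<close> show False by simp
  qed
  ultimately show thesis
    using that[of "q x" x] bound unfolding q_def N_def by blast
qed

lemma A_spectral_radius_eq:
  assumes bound: "\<And>y. (\<Sum>v\<in>pverts G. y v * Aop a G y v) \<le> m * (\<Sum>v\<in>pverts G. (y v)\<^sup>2)"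
    and x: "\<exists>v\<in>pverts G. x v \<noteq> 0" "\<And>v. v \<in> pverts G \<Longrightarrow> Aop a G x v = m * x v"
  shows "A_spectral_radius a G = m"
  unfolding A_spectral_radius_def
proof (rule Max_eqI[OF finite_A_eigenvalues])
  show "m \<in> {k. A_eigenvalue a G k}" using x by (auto simp: A_eigenvalue_iff)
  fix k assume "k \<in> {k. A_eigenvalue a G k}"
  then obtain y where y: "\<exists>v\<in>pverts G. y v \<noteq> 0" "\<forall>v\<in>pverts G. Aop a G y v = k * y v"
    by (auto simp: A_eigenvalue_iff)
  have "k * (\<Sum>v\<in>pverts G. (y v)\<^sup>2) = (\<Sum>v\<in>pverts G. y v * Aop a G y v)"
    using y(2) by (simp add: sum_distrib_left power2_eq_square algebra_simps)
  also have "\<dots> \<le> m * (\<Sum>v\<in>pverts G. (y v)\<^sup>2)" by (rule bound)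
  finally have "k * (\<Sum>v\<in>pverts G. (y v)\<^sup>2) \<le> m * (\<Sum>v\<in>pverts G. (y v)\<^sup>2)" .
  moreover have "(\<Sum>v\<in>pverts G. (y v)\<^sup>2) > 0"
    using y(1) pair_finite_verts by (auto intro!: sum_pos2)
  ultimately show "k \<le> m" by simp
qed

lemma rayleigh_le:
  assumes "pverts G \<noteq> {}" and "a \<le> 1"
  shows "(\<Sum>v\<in>pverts G. y v * Aop a G y v) \<le> A_spectral_radius a G * (\<Sum>v\<in>pverts G. (y v)\<^sup>2)"
proof -
  obtain m x where *: "\<And>y. (\<Sum>v\<in>pverts G. y v * Aop a G y v) \<le> m * (\<Sum>v\<in>pverts G. (y v)\<^sup>2)"
    "\<exists>v\<in>pverts G. x v \<noteq> 0" "\<And>v. v \<in> pverts G \<Longrightarrow> Aop a G x v = m * x v"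
    by (rule rayleigh_attained[OF assms]) blast
  show ?thesis using *(1) A_spectral_radius_eq[OF *] by simp
qed

end

section \<open>Connected graphs: positivity of the Perron vector and comparison with test
  vectors\<close>

locale conn_graph = pair_graph +
  assumes conn: "Digraph_Component.connected (with_proj G)"
begin

lemma verts_nonempty: "pverts G \<noteq> {}"
  using conn by (auto simp: Digraph_Component.connected_def strongly_connected_def)

text \<open>Otherwise \<open>S\<close> would be closed under arcs and reachability could not leave
  it. In this form connectedness drives the positivity of Perron vectors and the growth of spiders,
  paths and spanning trees.\<close>

lemma crossing_arc:
  assumes "u \<in> S" "S \<subseteq> pverts G" "v \<in> pverts G" "v \<notin> S"
  obtains p q where "p \<in> S" "q \<in> pverts G" "q \<notin> S" "(p, q) \<in> parcs G"
proof -
  have "u \<rightarrow>\<^sup>*\<^bsub>with_proj (mk_symmetric G)\<^esub> v"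
    using conn assms by (auto simp: Digraph_Component.connected_def strongly_connected_def)
  then have "u \<in> S \<longrightarrow> v \<in> S" if "\<forall>p\<in>S. \<forall>q. (p, q) \<in> parcs G \<longrightarrow> q \<in> S"
    unfolding reachable_def
  proof (induction rule: rtrancl_on.induct)
    case (rtrancl_on_into_rtrancl_on b c)
    then show ?case using that arc_sym by (auto simp: parcs_mk_symmetric)
  qed auto
  then show thesis using that assms in_arcsD2 by metis
qed

text \<open>A zero of the nonnegative maximiser forces zeros at all neighbours, as
  \<open>1 - a > 0\<close>; a crossing arc out of the zero set contradicts this.\<close>

theorem perron_vector:
  assumes a: "a < 1"
  obtains x where "\<And>v. v \<in> pverts G \<Longrightarrow> x v > 0"
    and "\<And>v. v \<in> pverts G \<Longrightarrow> Aop a G x v = A_spectral_radius a G * x v"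
proof -
  obtain m x where mx: "\<And>y. (\<Sum>v\<in>pverts G. y v * Aop a G y v) \<le> m * (\<Sum>v\<in>pverts G. (y v)\<^sup>2)"
    "\<And>v. x v \<ge> 0" "\<exists>v\<in>pverts G. x v \<noteq> 0" "\<And>v. v \<in> pverts G \<Longrightarrow> Aop a G x v = m * x v"
    by (rule rayleigh_attained[OF verts_nonempty less_imp_le[OF a]]) blast
  have m: "A_spectral_radius a G = m" by (rule A_spectral_radius_eq[OF mx(1,3,4)])
  have zero: "x q = 0" if "(p, q) \<in> parcs G" "x p = 0" for p q
  proof -
    have "p \<in> pverts G" using that in_arcsD1 by blast
    then have "(1 - a) * (\<Sum>u\<in>nbrs G p. x u) = 0"
      using mx(4)[of p] that by (simp add: Aop_eq)
    then have "(\<Sum>u\<in>nbrs G p. x u) = 0" using a by simp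
    then show ?thesis using that mx(2) by (simp add: sum_nonneg_eq_0_iff)
  qed
  have "x v > 0" if v: "v \<in> pverts G" for v
  proof (rule ccontr)
    assume "\<not> x v > 0"
    then have "x v = 0" using mx(2)[of v] by linarith
    obtain w where w: "w \<in> pverts G" "x w \<noteq> 0" using mx(3) by blast
    obtain p q where "p \<in> {p \<in> pverts G. x p = 0}" "q \<in> pverts G" "q \<notin> {p \<in> pverts G. x p = 0}"
      "(p, q) \<in> parcs G"
      by (rule crossing_arc[of v "{p \<in> pverts G. x p = 0}" w]) (use v w \<open>x v = 0\<close> in auto)
    then show False using zero by auto
  qed
  then show thesis using that[of x] mx(4) m by simp
qed

text \<open>Pair \<open>y\<close> with the Perron vector \<open>x\<close>: symmetry moves the
  operator onto \<open>y\<close>, and the positive inner product is cancelled.\<close>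

lemma spectral_radius_le:
  assumes a: "a < 1" and y: "\<And>v. v \<in> pverts G \<Longrightarrow> y v > 0"
    and le: "\<And>v. v \<in> pverts G \<Longrightarrow> Aop a G y v \<le> r * y v"
  shows "A_spectral_radius a G \<le> r"
proof -
  let ?l = "A_spectral_radius a G"
  obtain x where x: "\<And>v. v \<in> pverts G \<Longrightarrow> x v > 0"
    "\<And>v. v \<in> pverts G \<Longrightarrow> Aop a G x v = ?l * x v"
    using perron_vector[OF a] by blast
  have "?l * (\<Sum>v\<in>pverts G. y v * x v) = (\<Sum>v\<in>pverts G. y v * Aop a G x v)"
    using x(2) by (simp add: sum_distrib_left algebra_simps)
  also have "\<dots> = (\<Sum>v\<in>pverts G. x v * Aop a G y v)" by (rule sum_Aop_commute)
  also have "\<dots> \<le> (\<Sum>v\<in>pverts G. x v * (r * y v))"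
    using x(1) le by (intro sum_mono mult_left_mono) (auto intro: less_imp_le)
  also have "\<dots> = r * (\<Sum>v\<in>pverts G. y v * x v)"
    by (simp add: sum_distrib_left algebra_simps)
  finally have "?l * (\<Sum>v\<in>pverts G. y v * x v) \<le> r * (\<Sum>v\<in>pverts G. y v * x v)" .
  moreover have "(\<Sum>v\<in>pverts G. y v * x v) > 0"
    using verts_nonempty pair_finite_verts x y by (intro sum_pos) auto
  ultimately show ?thesis by simp
qed

text \<open>The same pairing as for the upper bound; strictness at the single vertex
  \<open>w\<close> survives because the Perron vector is positive there.\<close>

lemma spectral_radius_greater:
  assumes a: "a < 1" and y: "\<And>v. v \<in> pverts G \<Longrightarrow> y v > 0"
    and ge: "\<And>v. v \<in> pverts G \<Longrightarrow> Aop a G y v \<ge> r * y v"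
    and w: "w \<in> pverts G" "Aop a G y w > r * y w"
  shows "A_spectral_radius a G > r"
proof -
  let ?l = "A_spectral_radius a G"
  obtain x where x: "\<And>v. v \<in> pverts G \<Longrightarrow> x v > 0"
    "\<And>v. v \<in> pverts G \<Longrightarrow> Aop a G x v = ?l * x v"
    using perron_vector[OF a] by blast
  have "r * (\<Sum>v\<in>pverts G. y v * x v) = (\<Sum>v\<in>pverts G. x v * (r * y v))"
    by (simp add: sum_distrib_left algebra_simps)
  also have "\<dots> < (\<Sum>v\<in>pverts G. x v * Aop a G y v)"
    using x(1) ge w pair_finite_verts
    by (intro sum_strict_mono_ex1) (auto intro: less_imp_le mult_left_mono)
  also have "\<dots> = (\<Sum>v\<in>pverts G. y v * Aop a G x v)" by (rule sum_Aop_commute)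
  also have "\<dots> = ?l * (\<Sum>v\<in>pverts G. y v * x v)"
    using x(2) by (simp add: sum_distrib_left algebra_simps)
  finally have "r * (\<Sum>v\<in>pverts G. y v * x v) < ?l * (\<Sum>v\<in>pverts G. y v * x v)" .
  moreover have "(\<Sum>v\<in>pverts G. y v * x v) > 0"
    using verts_nonempty pair_finite_verts x y by (intro sum_pos) auto
  ultimately show ?thesis by simp
qed

end

section \<open>Paths, cycles, spiders and doubly forked paths\<close>

abbreviation chain :: "'a pair_pre_digraph \<Rightarrow> 'a list \<Rightarrow> bool" where
  "chain G \<equiv> successively (\<lambda>u v. (u, v) \<in> parcs G)"

text \<open>Arms are listed outwards from \<open>w\<close>. Further arcs among these vertices are
  allowed: the spider is a subgraph, not an induced one.\<close>

definition spider :: "'a pair_pre_digraph \<Rightarrow> 'a \<Rightarrow> 'a list \<Rightarrow> 'a list \<Rightarrow> 'a list \<Rightarrow> bool" where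
  "spider G w as bs cs \<longleftrightarrow> distinct (w # as @ bs @ cs) \<and> set (w # as @ bs @ cs) \<subseteq> pverts G
    \<and> chain G (w # as) \<and> chain G (w # bs) \<and> chain G (w # cs) \<and> as \<noteq> [] \<and> bs \<noteq> [] \<and> cs \<noteq> []"

text \<open>A one-element \<open>zs\<close> is allowed; both forks then sit at the same vertex,
  which covers \<open>K_(1,4)\<close>.\<close>

definition forked_path :: "'a pair_pre_digraph \<Rightarrow> 'a \<Rightarrow> 'a \<Rightarrow> 'a list \<Rightarrow> 'a \<Rightarrow> 'a \<Rightarrow> bool" where
  "forked_path G p q zs p' q' \<longleftrightarrow> zs \<noteq> [] \<and> distinct (p # q # p' # q' # zs) \<and> chain G zs
    \<and> {(hd zs, p), (hd zs, q), (last zs, p'), (last zs, q')} \<subseteq> parcs G"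

text \<open>Candidate graphs are placed on a list of vertices of the ambient type, so that they can
  compete with \<open>G\<close> on its own vertex set, while their structure is a relation on
  indices that can be computed with.\<close>

definition list_graph :: "'a list \<Rightarrow> (nat \<Rightarrow> nat \<Rightarrow> bool) \<Rightarrow> 'a pair_pre_digraph" where
  "list_graph vs R = \<lparr>pverts = set vs,
     parcs = {(vs ! i, vs ! j) | i j. i < length vs \<and> j < length vs \<and> R i j}\<rparr>"

abbreviation path_rel :: "nat \<Rightarrow> nat \<Rightarrow> bool" where
  "path_rel i j \<equiv> j = Suc i \<or> i = Suc j"

abbreviation cycle_rel :: "nat \<Rightarrow> nat \<Rightarrow> nat \<Rightarrow> bool" where
  "cycle_rel n i j \<equiv> j = Suc i mod n \<or> i = Suc j mod n"

lemma spider_commute: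
  "spider G w as bs cs \<Longrightarrow> spider G w bs as cs"
  "spider G w as bs cs \<Longrightarrow> spider G w cs bs as"
  by (auto simp: spider_def)

context conn_graph begin

text \<open>If \<open>p\<close> is the tip, the arm grows by \<open>q\<close>. Otherwise
  \<open>p\<close> has both its successor on the arm and \<open>q\<close>, which makes a fork at
  \<open>p\<close>; the first vertices of the other two arms make a fork at
  \<open>w\<close>.\<close>

lemma spider_extend:
  assumes sp: "spider G w as bs cs" and p: "p \<in> set as"
    and q: "q \<in> pverts G" "q \<notin> set (w # as @ bs @ cs)" "(p, q) \<in> parcs G"
  shows "(\<exists>p q zs p' q'. forked_path G p q zs p' q') \<or> spider G w (as @ [q]) bs cs"
proof -
  obtain as1 as2 where as: "as = as1 @ p # as2"
    using p by (meson split_list)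
  obtain b bs' c cs' where bc: "bs = b # bs'" "cs = c # cs'"
    using sp by (auto simp: spider_def neq_Nil_conv)
  show ?thesis
  proof (cases as2)
    case Nil
    then show ?thesis
      using sp q as by (auto simp: spider_def successively_append_iff successively_Cons hd_append)
  next
    case (Cons r as3)
    have ch: "chain G (w # as1 @ p # r # as3)"
      using sp as Cons by (simp add: spider_def)
    have "chain G ((w # as1 @ [p]) @ r # as3)" using ch by simp
    then have "chain G (w # as1 @ [p])" "(p, r) \<in> parcs G"
      by (simp_all add: successively_append_iff del: append_Cons)
    moreover have "(w, b) \<in> parcs G" "(w, c) \<in> parcs G"
      using sp bc by (simp_all add: spider_def)
    moreover have "distinct (b # c # r # q # w # as1 @ [p])"
      using sp q(2) as bc Cons by (simp add: spider_def) blast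
    ultimately have "forked_path G b c (w # as1 @ [p]) r q"
      using q(3) by (simp add: forked_path_def)
    then show ?thesis by blast
  qed
qed

lemma forked_path_or_spanning_spider:
  assumes "spider G w as bs cs"
  shows "(\<exists>p q zs p' q'. forked_path G p q zs p' q') \<or>
    (\<exists>as bs cs. spider G w as bs cs \<and> set (w # as @ bs @ cs) = pverts G)"
  using assms
proof (induction "card (pverts G) - length (as @ bs @ cs)" arbitrary: as bs cs rule: less_induct)
  case less
  let ?S = "set (w # as @ bs @ cs)"
  show ?case
  proof (cases "?S = pverts G")
    case False
    have sub: "?S \<subseteq> pverts G" using less.prems by (simp add: spider_def)
    with False obtain v where v: "v \<in> pverts G" "v \<notin> ?S" by blast
    obtain p q where pq: "p \<in> ?S" "q \<in> pverts G" "q \<notin> ?S" "(p, q) \<in> parcs G"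
      by (rule crossing_arc[of w ?S v]) (use v sub in auto)
    have "card (insert q ?S) \<le> card (pverts G)"
      using sub pq pair_finite_verts by (intro card_mono) auto
    moreover have "card ?S = Suc (length (as @ bs @ cs))"
      using less.prems by (subst distinct_card) (auto simp: spider_def)
    ultimately have len: "length (as @ bs @ cs) < card (pverts G)"
      using pq by (simp del: set_append)
    consider "p = w" | "p \<in> set as" | "p \<in> set bs" | "p \<in> set cs"
      using pq by auto
    then show ?thesis
    proof cases
      \<comment> \<open>A fourth neighbour of the centre: two forks at the same vertex.\<close>
      case 1
      obtain a' as' b bs' c cs' where "as = a' # as'" "bs = b # bs'" "cs = c # cs'"
        using less.prems by (auto simp: spider_def neq_Nil_conv)
      then have "forked_path G a' b [w] c q"
        using less.prems pq 1 by (auto simp: forked_path_def spider_def successively_Cons)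
      then show ?thesis by blast
    next
      case 2
      then show ?thesis
        using spider_extend[OF less.prems, of p q] pq less.hyps[of "as @ [q]" bs cs] len by fastforce
    next
      case 3
      then show ?thesis
        using spider_extend[OF spider_commute(1)[OF less.prems], of p q] pq len
          less.hyps[of as "bs @ [q]" cs] spider_commute(1)[of G w "bs @ [q]" as cs] by fastforce
    next
      case 4
      then show ?thesis
        using spider_extend[OF spider_commute(2)[OF less.prems], of p q] pq len
          less.hyps[of as bs "cs @ [q]"] spider_commute(2)[of G w "cs @ [q]" bs as] by fastforce
    qed
  qed (use less.prems in blast)
qed

lemma spider_of_degree_3:
  assumes "card (nbrs G w) \<ge> 3"
  obtains a b c where "spider G w [a] [b] [c]"
proof -
  obtain T where T: "T \<subseteq> nbrs G w" "card T = 3"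
    using assms obtain_subset_with_card_n by metis
  obtain a b c where abc: "T = {a, b, c}" "a \<noteq> b" "b \<noteq> c" "a \<noteq> c"
    using T(2) by (auto simp: card_3_iff)
  have "spider G w [a] [b] [c]"
    using T(1) abc not_self_nbr in_arcsD1 in_arcsD2 by (auto simp: spider_def)
  then show thesis by (rule that)
qed

section \<open>Graphs of maximum degree at most two\<close>

lemma three_nbrs:
  assumes "card (nbrs G p) \<le> 2" "(p, x) \<in> parcs G" "(p, y) \<in> parcs G" "(p, z) \<in> parcs G"
  shows "x = y \<or> y = z \<or> x = z"
proof (rule ccontr)
  assume "\<not> ?thesis"
  then have "card {x, y, z} = 3" by simp
  moreover have "card {x, y, z} \<le> card (nbrs G p)"
    using assms by (intro card_mono) auto
  ultimately show False using assms(1) by simp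
qed

text \<open>A path grows at its ends only: an inner vertex already has two neighbours on the path,
  so a crossing arc there would lead to a third.\<close>

lemma hamiltonian_path:
  assumes deg: "\<And>v. card (nbrs G v) \<le> 2"
  obtains vs where "distinct vs" "set vs = pverts G" "chain G vs"
proof -
  have "\<exists>vs. distinct vs \<and> set vs = pverts G \<and> chain G vs"
    if "distinct xs" "set xs \<subseteq> pverts G" "chain G xs" "xs \<noteq> []" for xs
    using that
  proof (induction "card (pverts G) - length xs" arbitrary: xs rule: less_induct)
    case less
    show ?case
    proof (cases "set xs = pverts G")
      case False
      then obtain v where v: "v \<in> pverts G" "v \<notin> set xs" using less.prems by blast
      obtain p q where pq: "p \<in> set xs" "q \<in> pverts G" "q \<notin> set xs" "(p, q) \<in> parcs G"
        by (rule crossing_arc[of "hd xs" "set xs" v]) (use v less.prems in auto)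
      have "card (insert q (set xs)) \<le> card (pverts G)"
        using less.prems pq pair_finite_verts by (intro card_mono) auto
      then have len: "length xs < card (pverts G)"
        using pq less.prems by (simp add: distinct_card)
      obtain l r where lr: "xs = l @ p # r" using pq by (meson split_list)
      consider "l = []" | "r = []" | l' x y r' where "l = l' @ [x]" "r = y # r'"
        by (metis neq_Nil_conv rev_exhaust)
      then show ?thesis
      proof cases
        case 1
        show ?thesis
          by (rule less.hyps[of "q # xs"])
            (use less.prems pq lr 1 len arc_sym in \<open>auto simp: successively_Cons\<close>)
      next
        case 2
        show ?thesis
          by (rule less.hyps[of "xs @ [q]"])
            (use less.prems pq lr 2 len in \<open>auto simp: successively_append_iff\<close>)
      next
        case 3
        then have "(p, x) \<in> parcs G" "(p, y) \<in> parcs G" "x \<noteq> y" "x \<noteq> q" "y \<noteq> q"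
          using less.prems lr pq arc_sym by (auto simp: successively_append_iff successively_Cons)
        then show ?thesis using three_nbrs[OF deg] pq(4) by blast
      qed
    qed (use less.prems in blast)
  qed
  moreover obtain v where "v \<in> pverts G" using verts_nonempty by blast
  ultimately show thesis
    using that by (metis distinct_singleton empty_set empty_subsetI insert_subset list.discI
        list.simps(15) successively.simps(2))
qed

lemma path_or_cycle:
  assumes deg: "\<And>v. card (nbrs G v) \<le> 2" and n: "card (pverts G) \<ge> 3"
  obtains vs where "distinct vs" "set vs = pverts G"
    "G = list_graph vs path_rel \<or> G = list_graph vs (cycle_rel (length vs))"
proof -
  obtain vs where vs: "distinct vs" "set vs = pverts G" "chain G vs"
    using hamiltonian_path[OF deg] .
  let ?n = "length vs"
  have n3: "?n \<ge> 3" using n vs by (metis distinct_card)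
  have step: "(vs ! i, vs ! Suc i) \<in> parcs G" if "Suc i < ?n" for i
    using vs(3) that by (auto simp: successively_conv_nth)
  have eq: "vs ! i = vs ! j \<longleftrightarrow> i = j" if "i < ?n" "j < ?n" for i j
    using that vs(1) by (simp add: nth_eq_iff_index_eq)
  \<comment> \<open>A chord with an inner endpoint would give that endpoint three neighbours, so the
    only possible chord closes the path to a cycle.\<close>
  have far: "i = 0 \<and> j = ?n - 1"
    if ij: "i < j" "j < ?n" "j \<noteq> Suc i" "(vs ! i, vs ! j) \<in> parcs G" for i j
  proof
    show "i = 0"
    proof (rule ccontr)
      assume "i \<noteq> 0"
      then obtain k where k: "i = Suc k" by (cases i) auto
      have "(vs ! i, vs ! k) \<in> parcs G" using step[of k] arc_sym k ij by simp
      then show False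
        using three_nbrs[OF deg _ step[of i] ij(4), of "vs ! k"] k ij by (simp add: eq)
    qed
    show "j = ?n - 1"
    proof (rule ccontr)
      assume "j \<noteq> ?n - 1"
      then have "Suc j < ?n" using ij by simp
      obtain k where k: "j = Suc k" using ij by (cases j) auto
      have "(vs ! j, vs ! k) \<in> parcs G" "(vs ! j, vs ! i) \<in> parcs G"
        using step[of k] arc_sym k ij by simp_all
      then show False
        using three_nbrs[OF deg _ step[of j], of "vs ! k" "vs ! i"] k ij \<open>Suc j < ?n\<close>
        by (simp add: eq)
    qed
  qed
  have arcs: "parcs G = {(vs ! i, vs ! j) | i j. i < ?n \<and> j < ?n \<and> (vs ! i, vs ! j) \<in> parcs G}"
  proof -
    have "\<exists>i j. u = vs ! i \<and> v = vs ! j \<and> i < ?n \<and> j < ?n" if "(u, v) \<in> parcs G" for u v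
      using that vs(2) in_arcsD1 in_arcsD2 by (metis in_set_conv_nth)
    then show ?thesis by fast
  qed
  have G_eq: "G = list_graph vs R"
    if "\<And>i j. i < ?n \<Longrightarrow> j < ?n \<Longrightarrow> (vs ! i, vs ! j) \<in> parcs G \<longleftrightarrow> R i j" for R
  proof -
    have "parcs G = {(vs ! i, vs ! j) | i j. i < ?n \<and> j < ?n \<and> R i j}"
      using that by (subst arcs) blast
    then show ?thesis using vs by (simp add: list_graph_def)
  qed
  show thesis
  proof (cases "(vs ! 0, vs ! (?n - 1)) \<in> parcs G")
    case True
    have "(vs ! i, vs ! j) \<in> parcs G \<longleftrightarrow> cycle_rel ?n i j" if ij: "i < ?n" "j < ?n" for i j
    proof -
      have lt: "(vs ! i, vs ! j) \<in> parcs G \<longleftrightarrow> j = Suc i \<or> i = 0 \<and> j = ?n - 1" if "i < j" "j < ?n" for i j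
        using far[of i j] that True step[of i] by auto
      have md: "Suc k mod ?n = (if k = ?n - 1 then 0 else Suc k)" if "k < ?n" for k
      proof (cases "k = ?n - 1")
        case True
        then have "Suc k = ?n" using n3 by linarith
        then show ?thesis using True by simp
      qed (use that in auto)
      show ?thesis
        unfolding md[OF ij(1)] md[OF ij(2)]
      proof (cases i j rule: linorder_cases)
        case less
        show "(vs ! i, vs ! j) \<in> parcs G \<longleftrightarrow>
            j = (if i = ?n - 1 then 0 else Suc i) \<or> i = (if j = ?n - 1 then 0 else Suc j)"
          unfolding lt[OF less ij(2)] using less ij n3 by auto
      next
        case equal
        then show "(vs ! i, vs ! j) \<in> parcs G \<longleftrightarrow>
            j = (if i = ?n - 1 then 0 else Suc i) \<or> i = (if j = ?n - 1 then 0 else Suc j)"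
          using n3 by auto
      next
        case greater
        show "(vs ! i, vs ! j) \<in> parcs G \<longleftrightarrow>
            j = (if i = ?n - 1 then 0 else Suc i) \<or> i = (if j = ?n - 1 then 0 else Suc j)"
          unfolding arc_sym[of "vs ! i"] lt[OF greater ij(1)] using greater ij n3 by auto
      qed
    qed
    then have "G = list_graph vs (cycle_rel ?n)" by (rule G_eq)
    then show ?thesis using that vs by blast
  next
    case False
    have "(vs ! i, vs ! j) \<in> parcs G \<longleftrightarrow> path_rel i j" if ij: "i < ?n" "j < ?n" for i j
    proof -
      have lt: "(vs ! i, vs ! j) \<in> parcs G \<longleftrightarrow> j = Suc i" if "i < j" "j < ?n" for i j
        using far[of i j] that False step[of i] by auto
      show ?thesis
      proof (cases i j rule: linorder_cases)
        case less
        show ?thesis unfolding lt[OF less ij(2)] using less by auto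
      next
        case greater
        show ?thesis unfolding arc_sym[of "vs ! i"] lt[OF greater ij(1)] using greater by auto
      qed simp
    qed
    then have "G = list_graph vs path_rel" by (rule G_eq)
    then show ?thesis using that vs by blast
  qed
qed

text \<open>Arcs come in opposite pairs, so a proper symmetric subset misses at least two of
  them.\<close>

lemma arcs_eqI:
  assumes "E \<subseteq> parcs G" "sym E" "card (parcs G) < card E + 2"
  shows "E = parcs G"
proof (rule ccontr)
  assume "E \<noteq> parcs G"
  then obtain u v where uv: "(u, v) \<in> parcs G" "(u, v) \<notin> E" using assms(1) by auto
  have vu: "(v, u) \<in> parcs G" using uv(1) arc_sym by metis
  have vu': "(v, u) \<notin> E" using uv(2) symD[OF assms(2)] by metis
  have "u \<noteq> v" using uv not_self_nbr by metis
  moreover have "finite E" using assms(1) pair_finite_arcs finite_subset by blast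
  ultimately have "card (insert (u, v) (insert (v, u) E)) = card E + 2"
    using uv vu' by simp
  moreover have "card (insert (u, v) (insert (v, u) E)) \<le> card (parcs G)"
    using uv vu assms(1) pair_finite_arcs by (intro card_mono) auto
  ultimately show False using assms(3) by simp
qed

text \<open>Grow a spanning tree; if there are no further arcs, the colouring alternating along it is proper.\<close>

lemma two_colouring_of_few_arcs:
  assumes few: "card (parcs G) < 2 * card (pverts G)"
  obtains c :: "'a \<Rightarrow> bool" where "\<And>u v. (u, v) \<in> parcs G \<Longrightarrow> c u \<noteq> c v"
proof -
  have grow: "\<exists>c :: 'a \<Rightarrow> bool. \<forall>(u, v)\<in>parcs G. c u \<noteq> c v"
    if "S \<noteq> {}" "S \<subseteq> pverts G" "E \<subseteq> parcs G" "E \<subseteq> S \<times> S" "sym E" "card E = 2 * (card S - 1)"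
      "\<forall>(u, v)\<in>E. c u \<noteq> c v" for S E and c :: "'a \<Rightarrow> bool"
    using that
  proof (induction "card (pverts G) - card S" arbitrary: S E c rule: less_induct)
    case less
    have fin: "finite S" using less.prems pair_finite_verts finite_subset by blast
    have finE: "finite E" using less.prems pair_finite_arcs finite_subset by blast
    show ?case
    proof (cases "S = pverts G")
      case True
      have "card S > 0" using fin less.prems by (simp add: card_gt_0_iff)
      \<comment> \<open>On n vertices the tree has 2n - 2 arcs and the graph fewer than 2n, which
        leaves no room for another pair.\<close>
      then have "E = parcs G"
        using arcs_eqI[OF less.prems(3,5)] few less.prems(6) True by simp
      then show ?thesis using less.prems by blast
    next
      case False
      then obtain u v where v: "u \<in> S" "v \<in> pverts G" "v \<notin> S" using less.prems by blast
      obtain p q where pq: "p \<in> S" "q \<in> pverts G" "q \<notin> S" "(p, q) \<in> parcs G"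
        by (rule crossing_arc[of u S v]) (use v less.prems in auto)
      have "card (insert q S) \<le> card (pverts G)"
        using less.prems pq pair_finite_verts by (intro card_mono) auto
      then have lt: "card S < card (pverts G)" using pq fin by simp
      have new: "(p, q) \<notin> E" "(q, p) \<notin> E" "p \<noteq> q" using pq less.prems by auto
      have qp: "(q, p) \<in> parcs G" using pq arc_sym by metis
      have "card S > 0" using fin less.prems by (simp add: card_gt_0_iff)
      show ?thesis
      proof (rule less.hyps[of "insert q S" "insert (p, q) (insert (q, p) E)" "c(q := \<not> c p)"])
        show "card (insert (p, q) (insert (q, p) E)) = 2 * (card (insert q S) - 1)"
          using new fin finE less.prems pq \<open>card S > 0\<close> by simp
        show "sym (insert (p, q) (insert (q, p) E))"
          using less.prems by (auto simp: sym_def)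
        show "\<forall>(u, v)\<in>insert (p, q) (insert (q, p) E). (c(q := \<not> c p)) u \<noteq> (c(q := \<not> c p)) v"
          using new less.prems pq by auto
      qed (use lt pq qp fin less.prems in auto)
    qed
  qed
  obtain v where "v \<in> pverts G" using verts_nonempty by blast
  then have "\<exists>c :: 'a \<Rightarrow> bool. \<forall>(u, v)\<in>parcs G. c u \<noteq> c v"
    by (intro grow[of "{v}" "{}" "\<lambda>_. True"]) (auto simp: sym_def)
  then show thesis using that by blast
qed

end

section \<open>Growth of a Perron vector along pendant paths\<close>

text \<open>
  With \<open>s = (\<lambda> - 2\<alpha>) / (1 - \<alpha>)\<close> and \<open>r = \<alpha> / (1 - \<alpha>)\<close> the eigenvalue equation at a vertex \<open>v\<close> of
  degree \<open>d\<close> reads \<open>\<Sum>\<^bsub>u\<sim>v\<^esub> x\<^sub>u = (s - r (d - 2)) x\<^sub>v\<close>. Hence, if a pendant path with \<open>k\<close> vertices is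
  attached to \<open>w\<close>, its vertex next to \<open>w\<close> carries \<open>arm_ratio r s k\<close> times the value at \<open>w\<close>.
  The value \<open>-r\<close> for \<open>k = 0\<close> makes up for counting an empty arm in the degree.
\<close>

primrec arm_ratio :: "real \<Rightarrow> real \<Rightarrow> nat \<Rightarrow> real" where
  "arm_ratio r s 0 = - r"
| "arm_ratio r s (Suc k) = 1 / (s - arm_ratio r s k)"

declare arm_ratio.simps(2) [simp del]

text \<open>\<open>k / (k + 1)\<close> is the exact ratio at r = 0, s = 2; larger r or s only lowers
  it.\<close>

lemma arm_ratio_le:
  assumes "r \<ge> 0" "s \<ge> 2"
  shows "arm_ratio r s k \<le> real k / (real k + 1)" and "arm_ratio r s (Suc k) > 0"
proof -
  show *: "arm_ratio r s k \<le> real k / (real k + 1)" for k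
  proof (induction k)
    case (Suc k)
    have "s - arm_ratio r s k \<ge> 2 - real k / (real k + 1)" using Suc assms by linarith
    moreover have "2 - real k / (real k + 1) = (real k + 2) / (real k + 1)" by (simp add: field_simps)
    ultimately have "1 / (s - arm_ratio r s k) \<le> 1 / ((real k + 2) / (real k + 1))"
      by (intro frac_le) auto
    then show ?case by (simp add: arm_ratio.simps(2) add.commute)
  qed (use assms in simp)
  have "real k / (real k + 1) < 1" by simp
  then have "s - arm_ratio r s k > 0" using *[of k] assms by linarith
  then show "arm_ratio r s (Suc k) > 0" by (simp add: arm_ratio.simps(2))
qed

lemma arm_ratio_less:
  assumes "r \<ge> 0" "s \<ge> 2"
  shows "arm_ratio r s k < 1"
proof -
  have "real k / (real k + 1) < 1" by simp
  then show ?thesis using arm_ratio_le(1)[OF assms, of k] by linarith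
qed

lemma two_le_add_inverse:
  assumes "0 < (p::real)" shows "2 \<le> p + 1 / p"
proof -
  have "0 \<le> (p - 1)\<^sup>2 / p" using assms by simp
  also have "(p - 1)\<^sup>2 / p = p + 1 / p - 2"
    using assms by (simp add: power2_eq_square field_simps)
  finally show ?thesis by simp
qed

text \<open>Since \<open>s - p = 1 / p\<close>, the number \<open>p\<close> is a fixed point of t ->
  1/(s - t), which gives the first identity. The contraction factor
  \<open>p * arm_ratio r s (Suc k)\<close> is at most (k+1)/(k+2) for all admissible r and s; this
  is the form used against concrete arm lengths.\<close>

lemma arm_ratio_defect:
  assumes r: "r \<ge> 0" and p: "0 < p" "p \<le> 1" and s: "s = p + 1 / p"
  shows "p - arm_ratio r s (Suc k) = p * arm_ratio r s (Suc k) * (p - arm_ratio r s k)"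
    and "p - arm_ratio r s k > 0"
    and "(real k + 2) * (p - arm_ratio r s (Suc k)) \<le> (real k + 1) * (p - arm_ratio r s k)"
proof -
  have s2: "s \<ge> 2" using two_le_add_inverse[OF p(1)] s by simp
  show *: "p - arm_ratio r s (Suc k) = p * arm_ratio r s (Suc k) * (p - arm_ratio r s k)" for k
  proof -
    have ne: "s - arm_ratio r s k \<noteq> 0" using arm_ratio_less[OF r s2, of k] s2 by linarith
    have ps: "p * s = p * p + 1" using p s by (simp add: field_simps)
    have "(p - arm_ratio r s (Suc k)) * (s - arm_ratio r s k) = p * s - p * arm_ratio r s k - 1"
      using ne by (simp add: arm_ratio.simps(2) field_simps)
    also have "\<dots> = p * (p - arm_ratio r s k)" using ps by (simp add: algebra_simps)
    also have "\<dots> = p * arm_ratio r s (Suc k) * (p - arm_ratio r s k) * (s - arm_ratio r s k)"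
      using ne by (simp add: arm_ratio.simps(2))
    finally show ?thesis using mult_right_cancel[OF ne] by blast
  qed
  show pos: "p - arm_ratio r s k > 0"
  proof (induction k)
    case (Suc k)
    then show ?case
      using *[of k] arm_ratio_le(2)[OF r s2, of k] p by (metis mult_pos_pos)
  qed (use r p in simp)
  have "p * arm_ratio r s (Suc k) \<le> 1 * (real (Suc k) / (real (Suc k) + 1))"
    using arm_ratio_le[OF r s2] p by (intro mult_mono) (auto simp: less_imp_le simp del: of_nat_Suc)
  then have "p - arm_ratio r s (Suc k) \<le> real (Suc k) / (real (Suc k) + 1) * (p - arm_ratio r s k)"
    unfolding *[of k] using pos by (intro mult_right_mono) auto
  then show "(real k + 2) * (p - arm_ratio r s (Suc k)) \<le> (real k + 1) * (p - arm_ratio r s k)"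
    by (simp add: field_simps)
qed

lemma arm_ratio_mono:
  assumes "r \<ge> 0" "0 < p" "p \<le> 1" "s = p + 1 / p" "k \<le> m"
  shows "arm_ratio r s k \<le> arm_ratio r s m"
proof (rule lift_Suc_mono_le[OF _ assms(5)])
  fix k
  have "s \<ge> 2" using two_le_add_inverse assms by simp
  have "p * arm_ratio r s (Suc k) \<le> 1"
    using arm_ratio_less[OF assms(1) \<open>s \<ge> 2\<close>, of "Suc k"] arm_ratio_le(2)[OF assms(1) \<open>s \<ge> 2\<close>, of k] assms
    by (intro mult_le_one) (auto simp: less_imp_le)
  then have "p - arm_ratio r s (Suc k) \<le> 1 * (p - arm_ratio r s k)"
    unfolding arm_ratio_defect(1)[OF assms(1-4), of k]
    using arm_ratio_defect(2)[OF assms(1-4), of k] by (intro mult_right_mono) auto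
  then show "arm_ratio r s k \<le> arm_ratio r s (Suc k)" by simp
qed

section \<open>Inequalities for the Perron vector on subgraphs\<close>

locale perron = conn_graph +
  fixes a l :: real and x :: "'a \<Rightarrow> real"
  assumes a: "0 \<le> a" "a < 1"
    and x_pos: "v \<in> pverts G \<Longrightarrow> x v > 0"
    and eigen: "v \<in> pverts G \<Longrightarrow> Aop a G x v = l * x v"
begin

definition r :: real where "r = a / (1 - a)"
definition \<sigma> :: real where "\<sigma> = (l - 2 * a) / (1 - a)"

lemma r_nonneg: "r \<ge> 0" using a by (simp add: r_def)

lemma normalised_coefficient: "(l - a * d) / (1 - a) = \<sigma> - r * (d - 2)"
proof -
  have "\<sigma> - r * (d - 2) = ((l - 2 * a) - a * (d - 2)) / (1 - a)"
    by (simp add: \<sigma>_def r_def diff_divide_distrib)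
  then show ?thesis by (simp add: algebra_simps)
qed

lemma sum_nbrs_eq:
  assumes "v \<in> pverts G"
  shows "(\<Sum>u\<in>nbrs G v. x u) = (\<sigma> - r * (real (card (nbrs G v)) - 2)) * x v"
proof -
  have "(1 - a) * (\<Sum>u\<in>nbrs G v. x u) = (l - a * real (card (nbrs G v))) * x v"
    using eigen[OF assms] by (simp add: Aop_eq algebra_simps)
  then have "(\<Sum>u\<in>nbrs G v. x u) = (l - a * real (card (nbrs G v))) / (1 - a) * x v"
    using a by (simp add: eq_divide_eq mult.commute)
  then show ?thesis by (simp add: normalised_coefficient)
qed

text \<open>Each omitted neighbour contributes a nonnegative term, its share \<open>a * x v\<close>
  of the degree included; hence the coefficient carries \<open>card N\<close> instead of the degree.
  This is what allows subgraphs in place of full neighbourhoods.\<close>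

lemma sum_nbrs_le:
  assumes v: "v \<in> pverts G" and N: "N \<subseteq> nbrs G v"
  shows "(\<Sum>u\<in>N. x u) \<le> (\<sigma> - r * (real (card N) - 2)) * x v"
proof -
  have "(\<Sum>u\<in>N. a * x v + (1 - a) * x u) \<le> Aop a G x v"
    unfolding Aop_def
  proof (rule sum_mono2[OF finite_nbrs N])
    fix u assume "u \<in> nbrs G v - N"
    then have "u \<in> pverts G" using in_arcsD2 by auto
    then show "0 \<le> a * x v + (1 - a) * x u"
      using x_pos[of u] x_pos[OF v] a by (intro add_nonneg_nonneg mult_nonneg_nonneg) auto
  qed
  moreover have "(\<Sum>u\<in>N. a * x v + (1 - a) * x u) = a * real (card N) * x v + (1 - a) * (\<Sum>u\<in>N. x u)"
    by (simp add: sum.distrib sum_distrib_left)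
  ultimately have "a * real (card N) * x v + (1 - a) * (\<Sum>u\<in>N. x u) \<le> l * x v"
    using eigen[OF v] by simp
  then have "(1 - a) * (\<Sum>u\<in>N. x u) \<le> (l - a * real (card N)) * x v"
    by (simp add: algebra_simps)
  then have "(\<Sum>u\<in>N. x u) \<le> (l - a * real (card N)) / (1 - a) * x v"
    using a by (simp add: pos_le_divide_eq mult.commute)
  then show ?thesis by (simp add: normalised_coefficient)
qed

text \<open>Only the arc back to \<open>w\<close> is kept at \<open>u\<close>, so any neighbour is
  worth at least a pendant leaf.\<close>

lemma leaf_ge:
  assumes "(u, w) \<in> parcs G" "\<sigma> \<le> s" "s + r > 0"
  shows "arm_ratio r s 1 * x w \<le> x u"
proof -
  have u: "u \<in> pverts G" using assms in_arcsD1 by blast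
  have "x w \<le> (\<sigma> + r) * x u" using sum_nbrs_le[OF u, of "{w}"] assms by simp
  also have "\<dots> \<le> (s + r) * x u"
    using assms x_pos[OF u] by (intro mult_right_mono) auto
  finally show ?thesis using assms by (simp add: arm_ratio.simps(2) field_simps)
qed

text \<open>Induction along the arm, the tail being an arm attached to \<open>y\<close>. Positivity
  of the denominators is a hypothesis rather than a consequence of \<open>s \<ge> 2\<close>, because
  the comparison with the path takes place at s < 2.\<close>

lemma arm_ge:
  assumes "chain G (w # ys)" "distinct (w # ys)" "set (w # ys) \<subseteq> pverts G" "ys \<noteq> []"
    and s: "\<sigma> \<le> s" "\<And>k. k < length ys \<Longrightarrow> arm_ratio r s k < s"
  shows "arm_ratio r s (length ys) * x w \<le> x (hd ys)"
  using assms
proof (induction ys arbitrary: w)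
  case (Cons y ys)
  have y: "y \<in> pverts G" "(y, w) \<in> parcs G" using Cons.prems arc_sym by auto
  show ?case
  proof (cases ys)
    case Nil
    then show ?thesis using leaf_ge[OF y(2), of s] Cons.prems by simp
  next
    case (Cons z zs)
    have "arm_ratio r s (length ys) * x y \<le> x (hd ys)"
      by (rule Cons.IH) (use Cons.prems Cons in auto)
    moreover have "x w + x z \<le> \<sigma> * x y"
      using sum_nbrs_le[OF y(1), of "{w, z}"] Cons.prems y Cons by auto
    moreover have "\<sigma> * x y \<le> s * x y" using s x_pos[OF y(1)] by simp
    ultimately have "x w \<le> (s - arm_ratio r s (length ys)) * x y"
      using Cons by (simp add: left_diff_distrib)
    moreover have "arm_ratio r s (length ys) < s" using Cons.prems(6)[of "length ys"] by simp
    ultimately show ?thesis by (simp add: arm_ratio.simps(2) field_simps)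
  qed
qed simp

lemma spider_arm_ratios_le:
  assumes sp: "spider G w as bs cs" and s: "\<sigma> \<le> s"
    and F: "\<And>k. k < max (length as) (max (length bs) (length cs)) \<Longrightarrow> arm_ratio r s k < s"
  shows "arm_ratio r s (length as) + arm_ratio r s (length bs) + arm_ratio r s (length cs) \<le> \<sigma> - r"
proof -
  let ?N = "{hd as, hd bs, hd cs}"
  obtain a' as' b bs' c cs' where eq: "as = a' # as'" "bs = b # bs'" "cs = c # cs'"
    using sp by (auto simp: spider_def neq_Nil_conv)
  have w: "w \<in> pverts G" using sp by (simp add: spider_def)
  have N: "?N \<subseteq> nbrs G w" "card ?N = 3" using sp eq by (auto simp: spider_def)
  have "arm_ratio r s (length as) * x w \<le> x (hd as)" "arm_ratio r s (length bs) * x w \<le> x (hd bs)"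
    "arm_ratio r s (length cs) * x w \<le> x (hd cs)"
    using sp s F by (auto intro!: arm_ge simp: spider_def)
  moreover have "x (hd as) + x (hd bs) + x (hd cs) = (\<Sum>u\<in>?N. x u)"
    using sp eq by (auto simp: spider_def)
  moreover have "\<dots> \<le> (\<sigma> - r) * x w" using sum_nbrs_le[OF w N(1)] N(2) by simp
  ultimately have "(arm_ratio r s (length as) + arm_ratio r s (length bs) + arm_ratio r s (length cs)) * x w
      \<le> (\<sigma> - r) * x w"
    by (simp add: algebra_simps)
  then show ?thesis using x_pos[OF w] by simp
qed

text \<open>
  In the next two lemmas \<open>p\<close> is the limit of \<open>arm_ratio r s k\<close> for \<open>k \<rightarrow> \<infinity>\<close>; the strict inequality
  says that the eigenvalue equation at a vertex with two pendant leaves and one infinite pendant path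
  fails.
\<close>

lemma no_forked_path:
  assumes p: "0 < p" "p \<le> 1" and s: "s = p + 1 / p" "\<sigma> \<le> s"
    and less: "\<sigma> - r - 2 * arm_ratio r s 1 < p"
  shows "\<not> forked_path G b c zs d e"
proof
  assume fp: "forked_path G b c zs d e"
  have s2: "s \<ge> 2" using two_le_add_inverse[OF p(1)] s by simp
  let ?f = "arm_ratio r s 1"
  have leaf: "?f * x w \<le> x u" if "(w, u) \<in> parcs G" for u w
    using leaf_ge[of u w s] that s s2 r_nonneg arc_sym[of w u] by simp
  have zs: "zs \<noteq> []" "distinct zs" "set zs \<inter> {b, c, d, e} = {}" "distinct [b, c, d, e]"
    "\<And>i. Suc i < length zs \<Longrightarrow> (zs ! i, zs ! Suc i) \<in> parcs G"
    "(hd zs, b) \<in> parcs G" "(hd zs, c) \<in> parcs G" "(last zs, d) \<in> parcs G" "(last zs, e) \<in> parcs G"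
    using fp by (auto simp: forked_path_def successively_conv_nth)
  \<comment> \<open>With two neighbours counted as leaves, the assumption \<open>less\<close> caps
    the third below \<open>p\<close> times the value at \<open>w\<close>.\<close>
  have fork: "x z < p * x w"
    if "(w, u) \<in> parcs G" "(w, v) \<in> parcs G" "(w, z) \<in> parcs G" "distinct [u, v, z]" for u v w z
  proof -
    have w: "w \<in> pverts G" using that in_arcsD1 by blast
    have "x u + x v + x z \<le> (\<sigma> - r) * x w"
      using sum_nbrs_le[OF w, of "{u, v, z}"] that by simp
    then have "x z \<le> (\<sigma> - r - 2 * ?f) * x w"
      using leaf[OF that(1)] leaf[OF that(2)] by (simp add: algebra_simps)
    also have "\<dots> < p * x w" using less x_pos[OF w] by simp
    finally show ?thesis .
  qed
  show False
  proof (cases "length zs = 1")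
    case True
    then obtain z where z: "zs = [z]" by (auto simp: length_Suc_conv)
    have zV: "z \<in> pverts G" using zs z in_arcsD1 by auto
    have "x b + x c + x d + x e \<le> (\<sigma> - 2 * r) * x z"
      using sum_nbrs_le[OF zV, of "{b, c, d, e}"] zs z by (simp add: algebra_simps)
    then have "4 * ?f * x z \<le> (\<sigma> - 2 * r) * x z"
      using leaf[of z b] leaf[of z c] leaf[of z d] leaf[of z e] zs z by simp
    then have "4 * ?f \<le> \<sigma> - 2 * r" using x_pos[OF zV] by simp
    then have "2 * ?f + r < p" using less by linarith
    \<comment> \<open>This is the defect identity at k = 0, p - F_1 = p F_1 (p + r), with p and F_1
      at most 1.\<close>
    moreover have "p - ?f \<le> ?f + r"
    proof -
      have f: "0 < ?f" "?f < 1" using arm_ratio_le(2)[OF r_nonneg s2, of 0] arm_ratio_less[OF r_nonneg s2, of 1] by auto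
      have "p - ?f = (p * p) * ?f + (p * ?f) * r"
        using arm_ratio_defect(1)[OF r_nonneg p s(1), of 0] by (simp add: algebra_simps)
      moreover have "(p * p) * ?f \<le> 1 * ?f"
        using p f by (intro mult_right_mono mult_le_one) auto
      moreover have "(p * ?f) * r \<le> 1 * r"
        using p f r_nonneg by (intro mult_right_mono mult_le_one) auto
      ultimately show ?thesis by linarith
    qed
    ultimately show False by linarith
  next
    case False
    then have len: "length zs \<ge> 2" using zs(1) by (cases zs rule: list.exhaust) (auto simp: Suc_le_eq)
    have inV: "zs ! i \<in> pverts G" if "i < length zs" for i
    proof (cases "Suc i < length zs")
      case True
      then show ?thesis using zs(5) in_arcsD1 by blast
    next
      case False
      then have "zs ! i = last zs" using that zs(1) by (metis Suc_lessI diff_Suc_1 last_conv_nth)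
      then show ?thesis using zs in_arcsD1 by metis
    qed
    \<comment> \<open>As \<open>s = p + 1 / p\<close>, a drop by more than the factor
      \<open>p\<close> before a vertex forces another one after it.\<close>
    have decay: "x (zs ! Suc i) < p * x (zs ! i)" if "Suc i < length zs" for i
      using that
    proof (induction i)
      case 0
      have "zs ! Suc 0 \<in> set zs" using 0 by simp
      then show ?case
        using zs 0 by (intro fork[of _ b c]) (auto simp: hd_conv_nth)
    next
      case (Suc i)
      let ?u = "zs ! i" and ?v = "zs ! Suc i" and ?w = "zs ! Suc (Suc i)"
      have "?u \<noteq> ?w" using zs(2) Suc.prems by (simp add: nth_eq_iff_index_eq)
      moreover have "(?v, ?u) \<in> parcs G" "(?v, ?w) \<in> parcs G"
        using zs(5)[of i] zs(5)[of "Suc i"] Suc.prems arc_sym by auto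
      ultimately have "x ?u + x ?w \<le> \<sigma> * x ?v"
        using sum_nbrs_le[OF inV[of "Suc i"], of "{?u, ?w}"] Suc.prems by simp
      also have "\<dots> \<le> s * x ?v" using s x_pos[OF inV[of "Suc i"]] Suc.prems by simp
      also have "\<dots> = p * x ?v + x ?v / p" by (simp add: s(1) algebra_simps)
      finally have "x ?u + x ?w \<le> p * x ?v + x ?v / p" .
      moreover have "x ?v / p < x ?u" using Suc p by (simp add: field_simps)
      ultimately show ?case by linarith
    qed
    obtain m where m: "length zs = Suc (Suc m)" using len by (metis add_2_eq_Suc le_Suc_ex)
    have last: "last zs = zs ! Suc m" using m zs(1) by (simp add: last_conv_nth)
    have "zs ! m \<in> set zs" using m by simp
    \<comment> \<open>The fork at the far end demands a drop in the opposite direction; with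
      \<open>p \<le> 1\<close> the two are incompatible.\<close>
    then have "x (zs ! m) < p * x (zs ! Suc m)"
      using zs m last arc_sym[of "zs ! m"] by (intro fork[of _ d e]) auto
    also have "\<dots> \<le> 1 * x (zs ! Suc m)" using p x_pos[OF inV[of "Suc m"]] m by (intro mult_right_mono) auto
    also have "\<dots> < p * x (zs ! m)" using decay[of m] m by simp
    also have "\<dots> \<le> 1 * x (zs ! m)" using p x_pos[OF inV[of m]] m by (intro mult_right_mono) auto
    finally show False by simp
  qed
qed

lemma spider_small:
  assumes p: "0 < p" "p \<le> 1" and s: "s = p + 1 / p" "\<sigma> \<le> s"
    and less: "\<sigma> - r - 2 * arm_ratio r s 1 < p"
    and sp: "spider G w as bs cs"
  shows "\<not> (2 \<le> length as \<and> 2 \<le> length bs \<and> 2 \<le> length cs)"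
    and "\<not> (3 \<le> length bs \<and> 3 \<le> length cs)"
    and "\<not> (2 \<le> length bs \<and> 5 \<le> length cs)"
proof -
  let ?F = "arm_ratio r s"
  have s2: "s \<ge> 2" using two_le_add_inverse[OF p(1)] s by simp
  have "?F k < s" for k using arm_ratio_less[OF r_nonneg s2, of k] s2 by linarith
  then have "?F (length as) + ?F (length bs) + ?F (length cs) \<le> \<sigma> - r"
    using spider_arm_ratios_le[OF sp s(2)] by simp
  \<comment> \<open>In terms of the defects d_k = p - F_k: the three defects add up to more than 2
    d_1.\<close>
  then have sum: "?F (length as) + ?F (length bs) + ?F (length cs) < p + 2 * ?F 1"
    using less by linarith
  have mono: "?F k \<le> ?F m" if "k \<le> m" for k m
    using arm_ratio_mono[OF r_nonneg p s(1) that] .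
  have as: "?F 1 \<le> ?F (length as)"
    using sp by (intro mono) (auto simp: spider_def Suc_le_eq)
  have d: "(real k + 2) * (p - ?F (Suc k)) \<le> (real k + 1) * (p - ?F k)" for k
    by (rule arm_ratio_defect(3)[OF r_nonneg p s(1)])
  \<comment> \<open>These chain to d_2 \<le> 2/3 d_1, d_3 \<le> 1/2 d_1 and d_5 \<le> 1/3 d_1. For
    each of the three shapes the defects then total at most 2 d_1: as 2/3 + 2/3 + 2/3, 1 + 1/2 + 1/2
    and 1 + 2/3 + 1/3.\<close>
  have d2: "3 * (p - ?F 2) \<le> 2 * (p - ?F 1)" and d3: "4 * (p - ?F 3) \<le> 3 * (p - ?F 2)"
    and d4: "5 * (p - ?F 4) \<le> 4 * (p - ?F 3)" and d5: "6 * (p - ?F 5) \<le> 5 * (p - ?F 4)"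
    using d[of 1] d[of 2] d[of 3] d[of 4] by (simp_all add: eval_nat_numeral)
  show "\<not> (2 \<le> length as \<and> 2 \<le> length bs \<and> 2 \<le> length cs)"
  proof
    assume "2 \<le> length as \<and> 2 \<le> length bs \<and> 2 \<le> length cs"
    then have "?F 2 \<le> ?F (length as)" "?F 2 \<le> ?F (length bs)" "?F 2 \<le> ?F (length cs)"
      by (simp_all only: mono)
    then show False using d2 sum by argo
  qed
  show "\<not> (3 \<le> length bs \<and> 3 \<le> length cs)"
  proof
    assume "3 \<le> length bs \<and> 3 \<le> length cs"
    then have "?F 3 \<le> ?F (length bs)" "?F 3 \<le> ?F (length cs)"
      by (simp_all only: mono)
    then show False using as d2 d3 sum by argo
  qed
  show "\<not> (2 \<le> length bs \<and> 5 \<le> length cs)"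
  proof
    assume "2 \<le> length bs \<and> 5 \<le> length cs"
    then have "?F 2 \<le> ?F (length bs)" "?F 5 \<le> ?F (length cs)"
      by (simp_all only: mono)
    then show False using as d2 d3 d4 d5 sum by argo
  qed
qed

end

section \<open>Graphs given by a relation on the indices of a list\<close>

text \<open>The last conjunct, that every index but \<open>0\<close> has a smaller neighbour, gives connectedness.\<close>

definition graph_rel :: "nat \<Rightarrow> (nat \<Rightarrow> nat \<Rightarrow> bool) \<Rightarrow> bool" where
  "graph_rel n R \<longleftrightarrow> (\<forall>i<n. \<not> R i i \<and> (\<forall>j<n. R i j \<longrightarrow> R j i)) \<and> (\<forall>i<n. 0 < i \<longrightarrow> (\<exists>j<i. R j i))"

lemma verts_list_graph [simp]: "pverts (list_graph vs R) = set vs"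
  by (simp add: list_graph_def)

lemma arcs_list_graph:
  "parcs (list_graph vs R) = {(vs ! i, vs ! j) | i j. i < length vs \<and> j < length vs \<and> R i j}"
  by (simp add: list_graph_def)

lemma list_graph_arc_iff:
  assumes "distinct vs" "i < length vs" "j < length vs"
  shows "(vs ! i, vs ! j) \<in> parcs (list_graph vs R) \<longleftrightarrow> R i j"
  using assms by (auto simp: arcs_list_graph nth_eq_iff_index_eq)

lemma conn_graph_list_graph:
  assumes vs: "distinct vs" "vs \<noteq> []" and R: "graph_rel (length vs) R"
  shows "conn_graph (list_graph vs R)"
proof -
  let ?G = "list_graph vs R"
  interpret G: pair_graph ?G
  proof
    have "parcs ?G \<subseteq> set vs \<times> set vs" by (auto simp: arcs_list_graph)
    then show "finite (parcs ?G)" by (rule finite_subset) auto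
    show "symmetric (with_proj ?G)"
      using R by (auto simp: symmetric_def sym_def graph_rel_def arcs_list_graph)
    show "fst e \<noteq> snd e" if "e \<in> parcs ?G" for e
      using that vs R by (auto simp: arcs_list_graph nth_eq_iff_index_eq graph_rel_def)
  qed (auto simp: arcs_list_graph)
  have reach: "vs ! 0 \<rightarrow>\<^sup>*\<^bsub>with_proj ?G\<^esub> vs ! i" if "i < length vs" for i
    using that
  proof (induction i rule: less_induct)
    case (less i)
    show ?case
    proof (cases "i = 0")
      case True
      then show ?thesis using vs by (auto intro: G.reachable_refl)
    next
      case False
      then obtain j where j: "j < i" "R j i" using R less.prems unfolding graph_rel_def by blast
      then have "(vs ! j, vs ! i) \<in> parcs ?G" using less.prems list_graph_arc_iff[OF vs(1), of j i R] by simp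
      then have "vs ! j \<rightarrow>\<^sup>*\<^bsub>with_proj ?G\<^esub> vs ! i" by (intro G.reachable_adjI) simp
      moreover have "vs ! 0 \<rightarrow>\<^sup>*\<^bsub>with_proj ?G\<^esub> vs ! j" using less j by simp
      ultimately show ?thesis by (rule G.reachable_trans[rotated])
    qed
  qed
  have "u \<rightarrow>\<^sup>*\<^bsub>with_proj (mk_symmetric ?G)\<^esub> v" if uv: "u \<in> set vs" "v \<in> set vs" for u v
  proof -
    obtain i j where "i < length vs" "u = vs ! i" "j < length vs" "v = vs ! j"
      using uv by (metis in_set_conv_nth)
    then have "u \<rightarrow>\<^sup>*\<^bsub>with_proj ?G\<^esub> v"
      using reach G.symmetric_reachable' G.reachable_trans by metis
    then show ?thesis by (rule G.reachable_mk_symmetricI)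
  qed
  then have "Digraph_Component.connected (with_proj ?G)"
    using vs by (auto simp: Digraph_Component.connected_def strongly_connected_def)
  then show ?thesis
    by (intro conn_graph.intro conn_graph_axioms.intro G.pair_graph_axioms)
qed

text \<open>Neighbourhoods as filtered index lists can be evaluated by rewriting for a concrete
  relation and length.\<close>

lemma nbrs_list_graph:
  assumes "distinct vs" "i < length vs"
  shows "nbrs (list_graph vs R) (vs ! i) = (!) vs ` set (filter (R i) [0..<length vs])"
  using assms by (auto simp: arcs_list_graph nth_eq_iff_index_eq)

lemma card_nbrs_list_graph:
  assumes "distinct vs" "i < length vs"
  shows "card (nbrs (list_graph vs R) (vs ! i)) = length (filter (R i) [0..<length vs])"
proof -
  have "inj_on ((!) vs) (set (filter (R i) [0..<length vs]))"
    using assms(1) by (auto simp: inj_on_def nth_eq_iff_index_eq)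
  then show ?thesis
    unfolding nbrs_list_graph[OF assms] by (simp add: card_image distinct_card del: set_filter)
qed

lemma sum_nbrs_list_graph:
  assumes "distinct vs" "i < length vs"
  shows "(\<Sum>u\<in>nbrs (list_graph vs R) (vs ! i). f u)
    = sum_list (map (\<lambda>j. f (vs ! j)) (filter (R i) [0..<length vs]))"
proof -
  have "inj_on ((!) vs) (set (filter (R i) [0..<length vs]))"
    using assms(1) by (auto simp: inj_on_def nth_eq_iff_index_eq)
  then have "(\<Sum>u\<in>nbrs (list_graph vs R) (vs ! i). f u)
      = (\<Sum>j\<in>set (filter (R i) [0..<length vs]). f (vs ! j))"
    unfolding nbrs_list_graph[OF assms] by (simp add: sum.reindex del: set_filter)
  then show ?thesis
    by (simp add: sum_list_distinct_conv_sum_set del: set_filter)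
qed

text \<open>The eigenvalue equations of a candidate, normalised and transported to indices. They are
  equalities, in contrast to the inequalities for subgraphs of \<open>G\<close>.\<close>

lemma list_graph_perron:
  assumes vs: "distinct vs" "length vs = n" "n > 0" and R: "graph_rel n R" and a: "0 \<le> a" "a < 1"
    and s: "s = (A_spectral_radius a (list_graph vs R) - 2 * a) / (1 - a)" and r: "r = a / (1 - a)"
  obtains y :: "nat \<Rightarrow> real" where "\<And>i. i < n \<Longrightarrow> y i > 0"
    "\<And>i. i < n \<Longrightarrow> sum_list (map y (filter (R i) [0..<n]))
      = (s - r * (real (length (filter (R i) [0..<n])) - 2)) * y i"
proof -
  let ?G = "list_graph vs R"
  interpret G: conn_graph ?G
    using conn_graph_list_graph[of vs R] vs R by auto
  obtain x where x: "\<And>v. v \<in> pverts ?G \<Longrightarrow> x v > 0"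
    "\<And>v. v \<in> pverts ?G \<Longrightarrow> Aop a ?G x v = A_spectral_radius a ?G * x v"
    using G.perron_vector[OF a(2)] by blast
  interpret P: perron ?G a "A_spectral_radius a ?G" x
    by unfold_locales (use a x in auto)
  show thesis
  proof (rule that[of "\<lambda>i. x (vs ! i)"])
    fix i assume i: "i < n"
    then show "x (vs ! i) > 0" using x vs by simp
    have "vs ! i \<in> pverts ?G" using i vs by simp
    then show "sum_list (map (\<lambda>i. x (vs ! i)) (filter (R i) [0..<n]))
      = (s - r * (real (length (filter (R i) [0..<n])) - 2)) * x (vs ! i)"
      using P.sum_nbrs_eq[of "vs ! i"] card_nbrs_list_graph[OF vs(1), of i R]
        sum_nbrs_list_graph[OF vs(1), of i x R] i vs(2)
      by (simp only: s r P.r_def P.\<sigma>_def)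
  qed
qed

lemma list_graph_spectral_radius_le:
  assumes vs: "distinct vs" "length vs = n" "n > 0" and R: "graph_rel n R" and a: "a < 1"
    and y: "\<And>i. i < n \<Longrightarrow> y i > 0"
    and le: "\<And>i. i < n \<Longrightarrow> a * real (length (filter (R i) [0..<n])) * y i
      + (1 - a) * sum_list (map y (filter (R i) [0..<n])) \<le> t * y i"
  shows "A_spectral_radius a (list_graph vs R) \<le> t"
proof -
  let ?G = "list_graph vs R"
  interpret G: conn_graph ?G
    using conn_graph_list_graph[of vs R] vs R by auto
  define x where "x v = y (inv_into {..<n} ((!) vs) v)" for v
  have inj: "inj_on ((!) vs) {..<n}"
    using vs by (auto simp: inj_on_def nth_eq_iff_index_eq)
  have x: "x (vs ! i) = y i" if "i < n" for i
    using inv_into_f_f[OF inj, of i] that by (simp add: x_def)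
  show ?thesis
  proof (rule G.spectral_radius_le[OF a, of x])
    fix v assume "v \<in> pverts ?G"
    then obtain i where i: "i < n" "v = vs ! i" using vs by (auto simp: in_set_conv_nth)
    show "x v > 0" using x y i by simp
    have "sum_list (map (\<lambda>j. x (vs ! j)) (filter (R i) [0..<n])) = sum_list (map y (filter (R i) [0..<n]))"
      using x by (intro arg_cong[of _ _ sum_list] map_cong) auto
    then show "Aop a ?G x v \<le> t * x v"
      using le[OF i(1)] card_nbrs_list_graph[OF vs(1), of i R] sum_nbrs_list_graph[OF vs(1), of i x R] i vs(2) x
      by (simp add: G.Aop_eq)
  qed
qed

lemma graph_isoI:
  fixes G :: "'a pair_pre_digraph" and H :: "'b pair_pre_digraph"
  assumes "pair_wf_digraph G" "inj_on f (pverts G)" "pverts H = f ` pverts G"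
    "parcs H = map_prod f f ` parcs G"
  shows "graph_iso G H"
proof -
  interpret pair_wf_digraph G by fact
  define h where "h = \<lparr>iso_verts = f, iso_arcs = map_prod f f, iso_head = snd, iso_tail = fst\<rparr>"
  have "inj_on (map_prod f f) (parcs G)"
    by (rule inj_on_subset[OF map_prod_inj_on[OF assms(2,2)]]) (auto dest: in_arcsD1 in_arcsD2)
  then have "pre_digraph.digraph_isomorphism (with_proj G) h"
    using assms(2) wf_digraph_axioms by (auto simp: pre_digraph.digraph_isomorphism_def h_def)
  moreover have "with_proj H = app_iso h (with_proj G)"
    using assms by (simp add: app_iso_def h_def with_proj_def)
  ultimately show ?thesis by (auto simp: digraph_iso_def)
qed

lemma list_graph_iso:
  assumes vs: "distinct vs" "length vs = n"
    and H: "pverts H = {..<n}" "parcs H = {(i, j). i < n \<and> j < n \<and> R i j}"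
  shows "graph_iso (list_graph vs R) H"
proof (rule graph_isoI[of _ "inv_into {..<n} ((!) vs)"])
  let ?f = "inv_into {..<n} ((!) vs)"
  have inj: "inj_on ((!) vs) {..<n}"
    using vs by (auto simp: inj_on_def nth_eq_iff_index_eq)
  have img: "set vs = (!) vs ` {..<n}"
    using vs by (auto simp: set_conv_nth)
  have f: "?f (vs ! i) = i" if "i < n" for i
    using inv_into_f_f[OF inj, of i] that by simp
  show "pair_wf_digraph (list_graph vs R)" by unfold_locales (auto simp: arcs_list_graph)
  show "inj_on ?f (pverts (list_graph vs R))"
    by (simp add: img inj_on_inv_into)
  show "pverts H = ?f ` pverts (list_graph vs R)"
    using inj H by (simp add: img)
  show "parcs H = map_prod ?f ?f ` parcs (list_graph vs R)"
  proof (intro equalityI subsetI)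
    fix e assume "e \<in> parcs H"
    then obtain i j where e: "e = (i, j)" "i < n" "j < n" "R i j" using H by auto
    then have "e = map_prod ?f ?f (vs ! i, vs ! j)" using f by simp
    moreover have "(vs ! i, vs ! j) \<in> parcs (list_graph vs R)" using e vs by (auto simp: arcs_list_graph)
    ultimately show "e \<in> map_prod ?f ?f ` parcs (list_graph vs R)" by blast
  qed (use f H vs in \<open>auto simp: arcs_list_graph\<close>)
qed

section \<open>Independence numbers\<close>

context pair_graph begin

lemma finite_independent_cards: "finite {card S | S. independent_set G S}"
proof -
  have "{card S | S. independent_set G S} \<subseteq> card ` Pow (pverts G)"
    by (auto simp: independent_set_def)
  then show ?thesis using pair_finite_verts finite_subset by blast
qed

lemma card_le_independence_number: "independent_set G S \<Longrightarrow> card S \<le> independence_number G"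
  unfolding independence_number_def by (intro Max_ge finite_independent_cards) auto

lemma independence_number_attained:
  obtains S where "independent_set G S" "card S = independence_number G"
proof -
  have "independent_set G {}" by (simp add: independent_set_def)
  then have "independence_number G \<in> {card S | S. independent_set G S}"
    unfolding independence_number_def by (intro Max_in finite_independent_cards) auto
  then show thesis using that by auto
qed

lemma independent_card_eq_sum:
  assumes "distinct vs" "set vs = pverts G" "independent_set G S"
  shows "card S = (\<Sum>i<length vs. of_bool (vs ! i \<in> S))"
proof -
  have "S \<subseteq> set vs" using assms by (simp add: independent_set_def)
  then have "S = (!) vs ` {i\<in>{..<length vs}. vs ! i \<in> S}"
    by (auto simp: in_set_conv_nth subset_iff image_iff)
  moreover have "inj_on ((!) vs) {i\<in>{..<length vs}. vs ! i \<in> S}"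
    using assms(1) by (auto simp: inj_on_def nth_eq_iff_index_eq)
  ultimately have "card S = card {i\<in>{..<length vs}. vs ! i \<in> S}"
    by (metis card_image)
  also have "\<dots> = (\<Sum>i<length vs. of_bool (vs ! i \<in> S))"
    by (simp add: of_bool_def sum.If_cases Int_def)
  finally show ?thesis .
qed

text \<open>Consecutive vertices contribute at most one, so the vertices are counted in pairs, with
  one left over when the length is odd.\<close>

lemma independent_set_chain:
  assumes "chain G vs" "distinct vs" "set vs = pverts G" "independent_set G S"
  shows "2 * card S \<le> Suc (length vs)"
proof -
  let ?b = "\<lambda>i. of_bool (vs ! i \<in> S) :: nat"
  have adj: "?b i + ?b (Suc i) \<le> 1" if "Suc i < length vs" for i
    using that assms(1,4) by (auto simp: successively_conv_nth independent_set_def)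
  have "2 * sum ?b {..<m} \<le> Suc m" if "m \<le> length vs" for m
    using that
  proof (induction m rule: less_induct)
    case (less m)
    consider "m = 0" | "m = 1" | k where "m = Suc (Suc k)"
      by (metis One_nat_def not0_implies_Suc)
    then show ?case
    proof cases
      case 3
      then show ?thesis using less.IH[of k] less.prems adj[of k] by simp
    qed auto
  qed
  then show ?thesis
    using independent_card_eq_sum[OF assms(2-4)] by simp
qed

end

text \<open>An independent set enters only through its indicator \<open>b\<close>, so
  \<open>upper\<close> becomes an integer linear problem with one constraint per edge, settled by
  adding suitable constraints.\<close>

lemma list_graph_in_conn_graphs:
  assumes vs: "distinct vs" "length vs = n" "n > 0" and R: "graph_rel n R"
    and lower: "I \<subseteq> {..<n}" "card I = k" "\<And>i j. i \<in> I \<Longrightarrow> j \<in> I \<Longrightarrow> \<not> R i j"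
    and upper: "\<And>b :: nat \<Rightarrow> nat. (\<And>i j. i < n \<Longrightarrow> j < n \<Longrightarrow> R i j \<Longrightarrow> b i + b j \<le> 1) \<Longrightarrow> sum b {..<n} \<le> k"
  shows "list_graph vs R \<in> conn_graphs n k"
proof -
  let ?G = "list_graph vs R"
  interpret G: conn_graph ?G
    using conn_graph_list_graph[of vs R] vs R by auto
  have "independent_set ?G ((!) vs ` I)"
    using lower vs unfolding independent_set_def
    by (auto simp: arcs_list_graph nth_eq_iff_index_eq subset_iff)
  moreover have "card ((!) vs ` I) = k"
    using lower vs by (subst card_image) (auto simp: inj_on_def nth_eq_iff_index_eq subset_iff)
  ultimately have "k \<le> independence_number ?G"
    using G.card_le_independence_number by metis
  moreover have "independence_number ?G \<le> k"
  proof -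
    obtain S where S: "independent_set ?G S" "card S = independence_number ?G"
      using G.independence_number_attained .
    have "(\<Sum>i<n. of_bool (vs ! i \<in> S)) \<le> k"
    proof (rule upper)
      fix i j assume "i < n" "j < n" "R i j"
      then have "(vs ! i, vs ! j) \<in> parcs ?G" using vs by (auto simp: arcs_list_graph)
      then show "of_bool (vs ! i \<in> S) + of_bool (vs ! j \<in> S) \<le> (1 :: nat)"
        using S(1) by (auto simp: independent_set_def)
    qed
    then show ?thesis
      using G.independent_card_eq_sum[OF vs(1) _ S(1)] S(2) vs(2) by simp
  qed
  ultimately show ?thesis
    using G.conn G.pair_graph_axioms vs by (simp add: conn_graphs_def distinct_card)
qed

section \<open>The path\<close>

lemma graph_rel_path: "graph_rel n path_rel"
  by (auto simp: graph_rel_def dest: gr0_implies_Suc)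

lemma graph_rel_cycle:
  assumes "n \<ge> 3" shows "graph_rel n (cycle_rel n)"
proof -
  have "\<not> cycle_rel n i i" if "i < n" for i
    using that assms by (cases "Suc i = n") auto
  moreover have "\<exists>j<i. cycle_rel n j i" if "0 < i" "i < n" for i
    using that by (intro exI[of _ "i - 1"]) auto
  ultimately show ?thesis by (auto simp: graph_rel_def)
qed

lemma filter_upt_conv_set:
  assumes "{j. j < n \<and> P j} = A"
  shows "length (filter P [0..<n]) = card A" "sum_list (map y (filter P [0..<n])) = sum y A"
proof -
  have "set (filter P [0..<n]) = A" using assms by auto
  then show "length (filter P [0..<n]) = card A" "sum_list (map y (filter P [0..<n])) = sum y A"
    by (metis distinct_card distinct_filter distinct_upt,
        metis distinct_filter distinct_upt sum_list_distinct_conv_sum_set)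
qed

text \<open>The normalised eigenvalue equations of a path. End vertices have degree one, hence the
  coefficient \<open>s + r\<close>; inner ones have degree two, where r cancels.\<close>

locale path_vector =
  fixes n :: nat and r s :: real and y :: "nat \<Rightarrow> real"
  assumes n: "n \<ge> 5" and r: "r \<ge> 0"
    and y_pos: "i < n \<Longrightarrow> y i > 0"
    and y_1: "y 1 = (s + r) * y 0"
    and y_rec: "Suc (Suc i) < n \<Longrightarrow> y (Suc (Suc i)) = s * y (Suc i) - y i"
    and y_end: "y (n - 2) = (s + r) * y (n - 1)"
begin

text \<open>For \<open>s \<ge> 2\<close> the values would increase all along the path, against the
  equation at the far end.\<close>

lemma s_less_2: "s < 2"
proof (rule ccontr)
  assume "\<not> s < 2"
  have "y i < y (Suc i)" if "Suc i < n" for i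
    using that
  proof (induction i)
    case 0
    have "(s + r) * y 0 \<ge> 2 * y 0" using y_pos[of 0] \<open>\<not> s < 2\<close> r n by (intro mult_right_mono) auto
    then show ?case using y_1 y_pos[of 0] n by simp
  next
    case (Suc i)
    have "s * y (Suc i) \<ge> 2 * y (Suc i)"
      using y_pos[of "Suc i"] Suc.prems \<open>\<not> s < 2\<close> by (intro mult_right_mono) auto
    then show ?case using Suc y_rec[of i] by simp
  qed
  from this[of "n - 2"] have "y (n - 2) < y (n - 1)"
    using n by (simp add: numeral_2_eq_2 Suc_diff_Suc)
  moreover have "(s + r) * y (n - 1) \<ge> 2 * y (n - 1)"
    using y_pos[of "n - 1"] \<open>\<not> s < 2\<close> r n by (intro mult_right_mono) auto
  ultimately show False using y_end y_pos[of "n - 1"] n by simp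
qed

lemma s_pos: "s > 0"
proof -
  have "s * y 1 = y 0 + y 2" using y_rec[of 0] n by (simp add: numeral_2_eq_2)
  then have "s * y 1 > 0" using y_pos[of 0] y_pos[of 2] n by simp
  then show ?thesis using y_pos[of 1] n by (simp add: zero_less_mult_iff)
qed

lemma skip_two:
  assumes "Suc (Suc (Suc (Suc i))) < n"
  shows "y (Suc (Suc (Suc (Suc i)))) + y i = (s * s - 2) * y (Suc (Suc i))"
proof -
  have "y (Suc (Suc (Suc (Suc i)))) = s * y (Suc (Suc (Suc i))) - y (Suc (Suc i))"
    "y (Suc (Suc (Suc i))) = s * y (Suc (Suc i)) - y (Suc i)"
    "s * y (Suc i) = y (Suc (Suc i)) + y i"
    using assms y_rec[of "Suc (Suc i)"] y_rec[of "Suc i"] y_rec[of i] by auto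
  then show ?thesis by (simp add: algebra_simps)
qed

lemma s_square_gt_2: "s * s > 2"
proof -
  have "(s * s - 2) * y 2 = y 4 + y 0"
    using skip_two[of 0] n by (simp add: eval_nat_numeral)
  then have "(s * s - 2) * y 2 > 0" using y_pos[of 0] y_pos[of 4] n by simp
  then show ?thesis using y_pos[of 2] n by (simp add: zero_less_mult_iff)
qed

text \<open>Adding the step-two recurrences centred at 2 and 4 would otherwise make
  \<open>y 6 + y 0\<close> negative. The bound serves the comparison with the arms 1, 2, n -
  4.\<close>

lemma s_square_ge_3: "n \<ge> 8 \<Longrightarrow> s * s \<ge> 3"
proof (rule ccontr)
  assume n8: "n \<ge> 8" and "\<not> s * s \<ge> 3"
  then have "(s * s - 2) * y k < 1 * y k" if "k < n" for k
    using that y_pos by (intro mult_strict_right_mono) auto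
  then have "y 4 + y 0 < y 2" "y 6 + y 2 < y 4"
    using skip_two[of 0] skip_two[of 2] n8 by (simp_all add: eval_nat_numeral)
  then show False using y_pos[of 6] y_pos[of 0] n8 by linarith
qed

lemma arm_ratio_eq: "Suc k < n \<Longrightarrow> arm_ratio r s (Suc k) = y k / y (Suc k)"
proof (induction k)
  case 0
  have "y (Suc 0) = (s + r) * y 0" using y_1 by simp
  then show ?case using y_pos[of 0] n by (simp add: arm_ratio.simps(2))
next
  case (Suc k)
  have "s - y k / y (Suc k) = y (Suc (Suc k)) / y (Suc k)"
    using y_rec[of k] y_pos[of "Suc k"] Suc.prems by (simp add: field_simps)
  then show ?case using Suc by (simp add: arm_ratio.simps(2)[of r s "Suc k"])
qed

lemma arm_ratio_less_s: "Suc k < n \<Longrightarrow> arm_ratio r s k < s"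
proof (cases k)
  case (Suc i)
  assume "Suc k < n"
  then have "s * y (Suc i) > y i" using y_rec[of i] y_pos[of "Suc (Suc i)"] Suc by simp
  then have "y i / y (Suc i) < s"
    using y_pos[of "Suc i"] Suc \<open>Suc k < n\<close> by (simp add: pos_divide_less_eq)
  then show ?thesis
    using arm_ratio_eq[of i] Suc \<open>Suc k < n\<close> by simp
qed (use r s_pos in simp)

text \<open>A vertex of the path has arms of lengths \<open>k\<close> and \<open>n - 1 - k\<close>,
  and the eigenvalue equation there says that the two ratios add up to \<open>s\<close>. This
  expresses the long arm of a spider through a short one.\<close>

lemma reflect:
  assumes "k < n - 1"
  shows "arm_ratio r s (n - 1 - k) = s - arm_ratio r s k"
  using assms
proof (induction k)
  case 0
  have "n = Suc (Suc (n - 2))" using n by linarith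
  then obtain m where m: "n = Suc (Suc m)" by blast
  then show ?case using arm_ratio_eq[of m] y_end y_pos[of "n - 1"] by simp
next
  case (Suc k)
  define j where "j = n - 1 - Suc k"
  have j: "n - 1 - k = Suc j" "n - 1 - Suc k = j"
    using Suc.prems by (simp_all add: j_def)
  have "arm_ratio r s j < s" using arm_ratio_less_s[of j] j Suc.prems by linarith
  then have "s - arm_ratio r s j \<noteq> 0" by simp
  then have "s - arm_ratio r s j = 1 / arm_ratio r s (Suc j)" by (simp add: arm_ratio.simps(2))
  also have "\<dots> = arm_ratio r s (Suc k)"
    using Suc j by (simp add: arm_ratio.simps(2)[of r s k])
  finally show ?case using j by simp
qed

text \<open>By \<open>reflect\<close> the long arm has ratio s - F_2, so the claim is F_2 - F_1 <
  F_1 + r. With \<open>q = s + r\<close> the two sides are (q r + 1) / (q (s q - 1)) and (q r + 1) /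
  q, and \<open>s * q > 2\<close>.\<close>

lemma spider_1_1_greater: "2 * arm_ratio r s 1 + arm_ratio r s (n - 3) > s - r"
proof -
  define q where "q = s + r"
  have q: "q > 0" "s * q > 2"
  proof -
    have "s * q = s * s + s * r" by (simp add: q_def algebra_simps)
    moreover have "s * r \<ge> 0" using s_pos r by simp
    ultimately show "s * q > 2" using s_square_gt_2 by linarith
  qed (use s_pos r q_def in simp)
  have F1: "arm_ratio r s 1 = 1 / q" by (simp add: arm_ratio.simps(2) q_def)
  have F2: "arm_ratio r s 2 = q / (s * q - 1)"
  proof -
    have "arm_ratio r s 2 = 1 / (s - 1 / q)" by (simp add: numeral_2_eq_2 arm_ratio.simps(2) q_def)
    moreover have "s - 1 / q = (s * q - 1) / q" using q by (simp add: field_simps)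
    ultimately show ?thesis by simp
  qed
  have "q / (s * q - 1) - 1 / q = (q * r + 1) / (q * (s * q - 1))"
    using q by (simp add: q_def field_simps)
  also have "\<dots> < (q * r + 1) / (q * 1)"
    using q r by (intro divide_strict_left_mono mult_strict_left_mono mult_pos_pos add_nonneg_pos) auto
  also have "\<dots> = r + 1 / q" using q by (simp add: field_simps)
  finally have "q / (s * q - 1) < 2 / q + r" by simp
  moreover have "arm_ratio r s (n - 3) = s - arm_ratio r s 2"
    using reflect[of 2] n by (simp add: numeral_3_eq_3 numeral_2_eq_2)
  ultimately show ?thesis using F1 F2 by simp
qed

text \<open>By \<open>reflect\<close> the claim is F_3 - F_2 < F_1 + r. The numbers
  \<open>q\<close>, \<open>A\<close>, \<open>B\<close> are the path vector at 1, 2, 3 scaled to 1 at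
  vertex 0, so the ratios are 1/q, q/A, A/B.\<close>

lemma spider_1_2_greater:
  assumes n8: "n \<ge> 8"
  shows "arm_ratio r s 1 + arm_ratio r s 2 + arm_ratio r s (n - 4) > s - r"
proof -
  define q where "q = s + r"
  define A where "A = s * q - 1"
  define B where "B = s * A - q"
  have q: "q > 0" "q \<ge> s" using s_pos r by (simp_all add: q_def)
  have A: "A > 1"
  proof -
    have "s * q = s * s + s * r" by (simp add: q_def algebra_simps)
    moreover have "s * r \<ge> 0" using s_pos r by simp
    ultimately have "s * q > 2" using s_square_gt_2 by linarith
    then show ?thesis by (simp add: A_def)
  qed
  have B: "B \<ge> q"
  proof -
    have "(s * s - 2) * q \<ge> 1 * q" using s_square_ge_3[OF n8] q by (intro mult_right_mono) auto
    then have "(s * s - 2) * q \<ge> s" using q by linarith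
    then show ?thesis by (simp add: B_def A_def algebra_simps)
  qed
  have AB: "A * B > q"
  proof -
    have "q < A * q" using A q by simp
    also have "\<dots> \<le> A * B" using A B by (intro mult_left_mono) auto
    finally show ?thesis .
  qed
  have F1: "arm_ratio r s 1 = 1 / q" by (simp add: arm_ratio.simps(2) q_def)
  have F2: "arm_ratio r s 2 = q / A"
  proof -
    have "arm_ratio r s 2 = 1 / (s - 1 / q)" by (simp add: numeral_2_eq_2 arm_ratio.simps(2) q_def)
    moreover have "s - 1 / q = A / q" using q by (simp add: A_def field_simps)
    ultimately show ?thesis by simp
  qed
  have "s - q / A = B / A" using A by (simp add: B_def field_simps)
  then have F3: "arm_ratio r s 3 = A / B"
    using F2 by (simp add: numeral_3_eq_3 numeral_2_eq_2 arm_ratio.simps(2)[of r s "Suc (Suc 0)"])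
  have "A / B - q / A = (A * A - q * B) / (A * B)"
    using A B q by (simp add: field_simps)
  \<comment> \<open>For the three-term recurrence y_k^2 - y_(k-1) y_(k+1) does not depend on k, so
    the left side equals q^2 - A.\<close>
  also have "A * A - q * B = q * r + 1"
  proof -
    have "q * B = (A + 1) * A - q * q" by (simp add: B_def A_def algebra_simps)
    then have "A * A - q * B = q * q - A" by (simp add: algebra_simps)
    also have "\<dots> = q * r + 1" by (simp add: A_def q_def algebra_simps)
    finally show ?thesis .
  qed
  also have "(q * r + 1) / (A * B) < (q * r + 1) / q"
    using q r A B AB by (intro divide_strict_left_mono mult_pos_pos add_nonneg_pos) auto
  also have "\<dots> = r + 1 / q" using q by (simp add: field_simps)
  finally have "A / B < 1 / q + q / A + r" by simp
  moreover have "arm_ratio r s (n - 4) = s - arm_ratio r s 3"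
    using reflect[of 3] n8 by (simp add: eval_nat_numeral)
  ultimately show ?thesis using F1 F2 F3 by simp
qed

end

lemma path_perron:
  assumes vs: "distinct vs" "length vs = n" "n \<ge> 5" and a: "0 \<le> a" "a < 1"
    and s: "s = (A_spectral_radius a (list_graph vs path_rel) - 2 * a) / (1 - a)" and r: "r = a / (1 - a)"
  obtains y where "path_vector n r s y"
proof -
  have "n > 0" using vs by simp
  obtain y :: "nat \<Rightarrow> real" where y: "\<And>i. i < n \<Longrightarrow> y i > 0"
    "\<And>i. i < n \<Longrightarrow> sum_list (map y (filter (path_rel i) [0..<n]))
      = (s - r * (real (length (filter (path_rel i) [0..<n])) - 2)) * y i"
    using list_graph_perron[OF vs(1,2) \<open>n > 0\<close> graph_rel_path a s r] by blast
  have y': "sum y A = (s - r * (real (card A) - 2)) * y i"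
    if "i < n" "{j. j < n \<and> path_rel i j} = A" for i A
    using y(2)[OF that(1)] unfolding filter_upt_conv_set[OF that(2)] .
  have "path_vector n r s y"
  proof
    show "y 1 = (s + r) * y 0"
    proof -
      have "{j. j < n \<and> path_rel 0 j} = {1}" using vs(3) by auto
      from y'[OF _ this] show ?thesis using vs(3) by simp
    qed
    show "y (Suc (Suc i)) = s * y (Suc i) - y i" if "Suc (Suc i) < n" for i
    proof -
      have "{j. j < n \<and> path_rel (Suc i) j} = {i, Suc (Suc i)}" using that by auto
      from y'[OF _ this] show ?thesis using that by simp
    qed
    have "n = Suc (Suc (n - 2))" using vs(3) by linarith
    then obtain m where m: "n = Suc (Suc m)" by blast
    have "{j. j < n \<and> path_rel (Suc m) j} = {m}" using m by auto
    from y'[OF _ this] show "y (n - 2) = (s + r) * y (n - 1)" using m by simp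
  qed (use vs a r y in auto)
  then show thesis by (rule that)
qed

section \<open>Extremal graphs of order at least seven\<close>

text \<open>\<open>T\<^bsub>1,1,n-3\<^esub>\<close> on \<open>0, \<dots>, n - 1\<close>, with major vertex \<open>0\<close>, leaves \<open>1\<close>, \<open>2\<close> next to it and third arm \<open>3, \<dots>, n - 1\<close>.\<close>

definition fork_rel :: "nat \<Rightarrow> nat \<Rightarrow> bool" where
  "fork_rel i j \<longleftrightarrow> i = 0 \<and> 1 \<le> j \<and> j \<le> 3 \<or> j = 0 \<and> 1 \<le> i \<and> i \<le> 3
    \<or> 3 \<le> i \<and> j = Suc i \<or> 3 \<le> j \<and> i = Suc j"

lemma graph_rel_fork: "graph_rel n fork_rel"
proof -
  have "\<exists>j<i. fork_rel j i" if "0 < i" for i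
  proof (cases "i \<le> 3")
    case True
    then show ?thesis using that by (intro exI[of _ 0]) (auto simp: fork_rel_def)
  next
    case False
    then show ?thesis by (intro exI[of _ "i - 1"]) (auto simp: fork_rel_def)
  qed
  then show ?thesis by (auto simp: graph_rel_def fork_rel_def)
qed

lemma spider_sorted:
  assumes "spider G w as bs cs"
  obtains as' bs' cs' where "spider G w as' bs' cs'"
    "set (w # as' @ bs' @ cs') = set (w # as @ bs @ cs)"
    "length as' \<le> length bs'" "length bs' \<le> length cs'"
proof -
  note c = assms spider_commute(1)[OF assms] spider_commute(2)[OF assms]
    spider_commute(2)[OF spider_commute(1)[OF assms]] spider_commute(1)[OF spider_commute(2)[OF assms]]
    spider_commute(1)[OF spider_commute(2)[OF spider_commute(1)[OF assms]]]
  consider "length as \<le> length bs" "length bs \<le> length cs" | "length as \<le> length cs" "length cs \<le> length bs"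
    | "length bs \<le> length as" "length as \<le> length cs" | "length bs \<le> length cs" "length cs \<le> length as"
    | "length cs \<le> length as" "length as \<le> length bs" | "length cs \<le> length bs" "length bs \<le> length as"
    by linarith
  then show thesis
  proof cases
    case 1 then show ?thesis using c by (intro that[of as bs cs]) auto
  next
    case 2 then show ?thesis using c by (intro that[of as cs bs]) auto
  next
    case 3 then show ?thesis using c by (intro that[of bs as cs]) auto
  next
    case 4 then show ?thesis using c by (intro that[of bs cs as]) auto
  next
    case 5 then show ?thesis using c by (intro that[of cs as bs]) auto
  next
    case 6 then show ?thesis using c by (intro that[of cs bs as]) auto
  qed
qed

text \<open>At s = 2 and p = 1 this bounds the quantity that has to stay below p; \<sigma> < 2
  supplies the strictness.\<close>

lemma two_minus_arm_ratio_le: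
  fixes r :: real
  assumes "r \<ge> 0"
  shows "2 - r - 2 * arm_ratio r 2 1 \<le> 1"
proof -
  have "(1 - r) * (2 + r) \<le> 2" using assms by (simp add: algebra_simps)
  then have "1 - r \<le> 2 / (2 + r)" using assms by (simp add: pos_le_divide_eq)
  then show ?thesis by (simp add: arm_ratio.simps(2))
qed

context conn_graph begin

lemma perron_locale:
  assumes "0 \<le> a" "a < 1"
  obtains x where "perron G a (A_spectral_radius a G) x"
proof -
  obtain x where "\<And>v. v \<in> pverts G \<Longrightarrow> x v > 0"
    "\<And>v. v \<in> pverts G \<Longrightarrow> Aop a G x v = A_spectral_radius a G * x v"
    using perron_vector[OF assms(2)] by blast
  then have "perron G a (A_spectral_radius a G) x"
    using assms by unfold_locales auto
  then show thesis by (rule that)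
qed

lemma spanning_sorted_spider:
  assumes a: "0 \<le> a" "a < 1" and p: "0 < p" "p \<le> 1" "s = p + 1 / p"
    and r: "r = a / (1 - a)" and \<sigma>: "\<sigma> = (A_spectral_radius a G - 2 * a) / (1 - a)" "\<sigma> \<le> s"
    and less: "\<sigma> - r - 2 * arm_ratio r s 1 < p"
    and deg: "card (nbrs G v) \<ge> 3"
  obtains w as bs cs where "spider G w as bs cs" "set (w # as @ bs @ cs) = pverts G"
    "length as = 1" "1 \<le> length bs" "length bs \<le> length cs"
    "\<not> (3 \<le> length bs \<and> 3 \<le> length cs)" "\<not> (2 \<le> length bs \<and> 5 \<le> length cs)"
proof -
  obtain x where "perron G a (A_spectral_radius a G) x"
    using perron_locale[OF a] .
  then interpret P: perron G a "A_spectral_radius a G" x .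
  have rs: "P.r = r" "P.\<sigma> = \<sigma>" by (simp_all add: P.r_def P.\<sigma>_def r \<sigma>)
  note no_forked = P.no_forked_path[unfolded rs, OF p \<sigma>(2) less]
  note small = P.spider_small[unfolded rs, OF p \<sigma>(2) less]
  obtain b c d where "spider G v [b] [c] [d]" using spider_of_degree_3[OF deg] .
  then obtain as bs cs where "spider G v as bs cs" "set (v # as @ bs @ cs) = pverts G"
    using forked_path_or_spanning_spider no_forked by blast
  then obtain as bs cs where sp: "spider G v as bs cs" "set (v # as @ bs @ cs) = pverts G"
    "length as \<le> length bs" "length bs \<le> length cs"
    using spider_sorted by metis
  have "length as \<ge> 1" using sp(1) by (cases as) (auto simp: spider_def)
  moreover have "\<not> 2 \<le> length as" using small(1)[OF sp(1)] sp(3,4) by linarith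
  ultimately have "length as = 1" by linarith
  then show thesis
    using that[OF sp(1,2)] sp(3,4) small(2,3)[OF sp(1)] by simp
qed

text \<open>The Perron vector of \<open>H\<close> is a test vector for \<open>G\<close>: extra arcs
  only add positive terms, and an arc missing from \<open>H\<close> makes the inequality strict at
  its tail.\<close>

lemma spectral_radius_subgraph_less:
  assumes a: "0 \<le> a" "a < 1" and H: "conn_graph H" "pverts H = pverts G" "parcs H \<subset> parcs G"
  shows "A_spectral_radius a H < A_spectral_radius a G"
proof -
  interpret H: conn_graph H by fact
  obtain y where y: "\<And>v. v \<in> pverts G \<Longrightarrow> y v > 0"
    "\<And>v. v \<in> pverts G \<Longrightarrow> Aop a H y v = A_spectral_radius a H * y v"
    using H.perron_vector[OF a(2)] H(2) by metis
  have term_pos: "a * y v + (1 - a) * y u > 0" if "v \<in> pverts G" "u \<in> pverts G" for u v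
    using y(1)[OF that(1)] y(1)[OF that(2)] a by (intro add_nonneg_pos) auto
  obtain p q where pq: "(p, q) \<in> parcs G" "(p, q) \<notin> parcs H" using H(3) by auto
  show ?thesis
  proof (rule spectral_radius_greater[OF a(2), of y])
    fix v assume v: "v \<in> pverts G"
    have "Aop a H y v \<le> Aop a G y v"
      unfolding Aop_def
    proof (rule sum_mono2)
      fix u assume "u \<in> nbrs G v - nbrs H v"
      then show "0 \<le> a * y v + (1 - a) * y u"
        using term_pos[OF v, of u] in_arcsD2 by (auto intro: less_imp_le)
    qed (use H(3) in auto)
    then show "A_spectral_radius a H * y v \<le> Aop a G y v" using y(2)[OF v] by simp
  next
    show p: "p \<in> pverts G" using pq in_arcsD1 by blast
    have "Aop a H y p < Aop a G y p"
      unfolding Aop_def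
    proof (rule sum_strict_mono2[of _ _ q])
      fix u assume "u \<in> nbrs G p"
      then show "0 \<le> a * y p + (1 - a) * y u"
        using term_pos[OF p, of u] in_arcsD2 by (auto intro: less_imp_le)
    qed (use H(3) pq p term_pos[OF p, of q] in_arcsD2 in auto)
    then show "A_spectral_radius a H * y p < Aop a G y p" using y(2)[OF p] by simp
  qed (use y in auto)
qed

lemma extremal_path:
  assumes N: "card (pverts G) = n" "n \<in> {8, 9}" and a: "0 \<le> a" "a < 1"
    and min: "\<And>vs. distinct vs \<Longrightarrow> set vs = pverts G \<Longrightarrow>
      A_spectral_radius a G \<le> A_spectral_radius a (list_graph vs path_rel)"
  obtains vs where "distinct vs" "set vs = pverts G" "G = list_graph vs path_rel"
proof -
  obtain us where us: "set us = pverts G" "distinct us"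
    using finite_distinct_list[OF pair_finite_verts] by blast
  have len: "length us = n" using us N distinct_card by metis
  define r where "r = a / (1 - a)"
  define s where "s = (A_spectral_radius a (list_graph us path_rel) - 2 * a) / (1 - a)"
  define \<sigma> where "\<sigma> = (A_spectral_radius a G - 2 * a) / (1 - a)"
  have "\<sigma> \<le> s"
    using min[OF us(2,1)] a by (simp add: \<sigma>_def s_def divide_right_mono)
  have "n \<ge> 5" using N by auto
  then obtain y where "path_vector n r s y"
    using path_perron[OF us(2) len _ a s_def r_def] by blast
  then interpret path_vector n r s y .
  have small_degree: "card (nbrs G v) \<le> 2" for v
  proof (rule ccontr)
    assume "\<not> ?thesis"
    then have deg: "card (nbrs G v) \<ge> 3" by simp
    have p: "(0::real) < 1" "(1::real) \<le> 1" "(2::real) = 1 + 1 / 1" by simp_all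
    have two: "\<sigma> \<le> 2" "\<sigma> - r - 2 * arm_ratio r 2 1 < 1"
      using \<open>\<sigma> \<le> s\<close> s_less_2 two_minus_arm_ratio_le[OF r] by linarith+
    from spanning_sorted_spider[OF a p r_def \<sigma>_def two deg]
    obtain w as bs cs where sp: "spider G w as bs cs" "set (w # as @ bs @ cs) = pverts G"
      "length as = 1" "1 \<le> length bs" "length bs \<le> length cs"
      "\<not> (3 \<le> length bs \<and> 3 \<le> length cs)" "\<not> (2 \<le> length bs \<and> 5 \<le> length cs)" .
    have "distinct (w # as @ bs @ cs)" using sp(1) by (simp add: spider_def)
    then have total: "length bs + length cs + 2 = n"
      using sp(2,3) N(1) distinct_card[of "w # as @ bs @ cs"] by simp
    obtain x where "perron G a (A_spectral_radius a G) x"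
      using perron_locale[OF a] .
    then interpret P: perron G a "A_spectral_radius a G" x .
    have rs: "P.r = r" "P.\<sigma> = \<sigma>" by (simp_all add: P.r_def P.\<sigma>_def r_def \<sigma>_def)
    \<comment> \<open>The comparison itself is run at the value \<open>s\<close> of the path, below
      2; every arm has at most n - 3 vertices, so \<open>arm_ratio_less_s\<close> controls the
      denominators.\<close>
    have le: "arm_ratio r s (length as) + arm_ratio r s (length bs) + arm_ratio r s (length cs) \<le> \<sigma> - r"
    proof (rule P.spider_arm_ratios_le[unfolded rs, OF sp(1) \<open>\<sigma> \<le> s\<close>])
      show "arm_ratio r s k < s" if "k < max (length as) (max (length bs) (length cs))" for k
        using that total sp(3-5) by (intro arm_ratio_less_s) auto
    qed
    \<comment> \<open>The two lengths add up to n - 2. For n = 8 this leaves (1,5) and (2,4), for n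
      = 9 only (1,6).\<close>
    consider "length bs = 1" "length cs = n - 3" | "length bs = 2" "length cs = n - 4" "n \<ge> 8"
      using sp(4-7) total N(2) by (cases "length bs = 1"; cases "length bs = 2") auto
    then show False
    proof cases
      case 1
      then show ?thesis using le sp(3) spider_1_1_greater \<open>\<sigma> \<le> s\<close> by simp
    next
      case 2
      then show ?thesis using le sp(3) spider_1_2_greater[OF 2(3)] \<open>\<sigma> \<le> s\<close> by simp
    qed
  qed
  have ge3: "card (pverts G) \<ge> 3" using N by auto
  obtain vs where vs: "distinct vs" "set vs = pverts G"
    "G = list_graph vs path_rel \<or> G = list_graph vs (cycle_rel (length vs))"
    by (rule path_or_cycle[OF small_degree ge3])
  have lenvs: "length vs = n" using vs N distinct_card by metis
  \<comment> \<open>A cycle properly contains a spanning path, whose radius is smaller and bounds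
    that of \<open>G\<close> from above.\<close>
  have "G \<noteq> list_graph vs (cycle_rel (length vs))"
  proof
    assume G: "G = list_graph vs (cycle_rel (length vs))"
    let ?H = "list_graph vs path_rel"
    have "vs \<noteq> []" using lenvs N by auto
    have "parcs ?H \<subseteq> parcs G"
    proof
      fix e assume "e \<in> parcs ?H"
      then obtain i j where "e = (vs ! i, vs ! j)" "i < n" "j < n" "path_rel i j"
        using lenvs by (auto simp: arcs_list_graph)
      moreover from this have "cycle_rel n i j" by auto
      ultimately show "e \<in> parcs G" using lenvs unfolding G arcs_list_graph by blast
    qed
    moreover have "(vs ! 0, vs ! (n - 1)) \<in> parcs G" "(vs ! 0, vs ! (n - 1)) \<notin> parcs ?H"
    proof -
      have idx: "0 < length vs" "n - 1 < length vs" using lenvs N by auto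
      have "cycle_rel (length vs) 0 (n - 1)" "\<not> path_rel 0 (n - 1)" using lenvs N by auto
      then have "(vs ! 0, vs ! (n - 1)) \<in> parcs (list_graph vs (cycle_rel (length vs)))"
        "(vs ! 0, vs ! (n - 1)) \<notin> parcs ?H"
        by (simp_all only: list_graph_arc_iff[OF vs(1) idx] simp_thms)
      then show "(vs ! 0, vs ! (n - 1)) \<in> parcs G" "(vs ! 0, vs ! (n - 1)) \<notin> parcs ?H"
        by (simp_all only: G[symmetric] not_False_eq_True)
    qed
    ultimately have "parcs ?H \<subset> parcs G" by blast
    then have "A_spectral_radius a ?H < A_spectral_radius a G"
      using vs(2) conn_graph_list_graph[OF vs(1) \<open>vs \<noteq> []\<close> graph_rel_path]
      by (intro spectral_radius_subgraph_less[OF a]) auto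
    then show False using min[OF vs(1,2)] by simp
  qed
  with vs(3) have "G = list_graph vs path_rel" by blast
  then show thesis using that[OF vs(1,2)] by blast
qed

end

section \<open>Order ten: the spider with arms 1, 1, 7\<close>

lemma arm_ratio_step:
  assumes "s - arm_ratio r s k \<noteq> 0" "u = arm_ratio r s k * v" "t + u = s * v"
  shows "v = arm_ratio r s (Suc k) * t"
proof -
  have "t = (s - arm_ratio r s k) * v" using assms(2,3) by (simp add: algebra_simps)
  then show ?thesis using assms(1) by (simp add: arm_ratio.simps(2))
qed

lemma fork_perron:
  assumes vs: "distinct vs" "length vs = 10" and a: "0 \<le> a" "a < 1"
    and s: "s = (A_spectral_radius a (list_graph vs fork_rel) - 2 * a) / (1 - a)" "s \<ge> 2"
    and r: "r = a / (1 - a)"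
  shows "s - r - 2 * arm_ratio r s 1 = arm_ratio r s 7"
proof -
  obtain y :: "nat \<Rightarrow> real" where y: "\<And>i. i < 10 \<Longrightarrow> y i > 0"
    "\<And>i. i < 10 \<Longrightarrow> sum_list (map y (filter (fork_rel i) [0..<10]))
      = (s - r * (real (length (filter (fork_rel i) [0..<10])) - 2)) * y i"
    using list_graph_perron[OF vs _ graph_rel_fork a s(1) r] by auto
  have r0: "r \<ge> 0" using a r by simp
  have upt: "[0..<10] = [0, 1, 2, 3, 4, 5, 6, 7, 8, 9 :: nat]"
    by (simp add: upt_rec)
  have eqs: "y 1 + y 2 + y 3 = (s - r) * y 0" "y 0 = (s + r) * y 1" "y 0 = (s + r) * y 2"
    "y 0 + y 4 = s * y 3" "y 3 + y 5 = s * y 4" "y 4 + y 6 = s * y 5" "y 5 + y 7 = s * y 6"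
    "y 6 + y 8 = s * y 7" "y 7 + y 9 = s * y 8" "y 8 = (s + r) * y 9"
    using y(2)[of 0] y(2)[of 1] y(2)[of 2] y(2)[of 3] y(2)[of 4] y(2)[of 5] y(2)[of 6] y(2)[of 7]
      y(2)[of 8] y(2)[of 9]
    unfolding upt by (simp_all add: fork_rel_def)
  have ne: "s - arm_ratio r s k \<noteq> 0" for k
    using arm_ratio_less[OF r0 s(2), of k] s(2) by linarith
  have leaf: "v = arm_ratio r s (Suc 0) * t" if "t = (s + r) * v" for t v
    using that r0 s(2) by (simp add: arm_ratio.simps(2))
  note step = arm_ratio_step[OF ne]
  \<comment> \<open>The ratio climbs the long arm from its leaf 9 up to vertex 3, giving F_7
    relative to the centre.\<close>
  have "y 3 = arm_ratio r s (Suc (Suc (Suc (Suc (Suc (Suc (Suc 0))))))) * y 0"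
    by (rule step[OF step[OF step[OF step[OF step[OF step[OF leaf[OF eqs(10)] eqs(9)] eqs(8)] eqs(7)] eqs(6)] eqs(5)] eqs(4)])
  then have "(s - r) * y 0 = (2 * arm_ratio r s (Suc 0) + arm_ratio r s 7) * y 0"
    using leaf[OF eqs(2)] leaf[OF eqs(3)] eqs(1) by (simp add: eval_nat_numeral algebra_simps)
  then show ?thesis using y(1)[of 0] by simp
qed

text \<open>The smaller root of p^2 - s p + 1 = 0.\<close>

lemma exists_add_inverse_eq:
  fixes s :: real
  assumes "s \<ge> 2"
  obtains p where "0 < p" "p \<le> 1" "s = p + 1 / p"
proof -
  define q where "q = sqrt (s\<^sup>2 - 4)"
  have "s\<^sup>2 \<ge> 2\<^sup>2" using assms by (intro power_mono) auto
  then have q: "q \<ge> 0" "q\<^sup>2 = s\<^sup>2 - 4" by (simp_all add: q_def)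
  have "q < s" using q assms power2_less_imp_less[of q s] by simp
  define p where "p = (s - q) / 2"
  have p: "p > 0" "p * (s - p) = 1" 
  proof -
    have "p * (s - p) = (s\<^sup>2 - q\<^sup>2) / 4"
      by (simp add: p_def power2_eq_square algebra_simps diff_divide_distrib add_divide_distrib)
    then show "p * (s - p) = 1" using q(2) by simp
  qed (use \<open>q < s\<close> in \<open>simp add: p_def\<close>)
  then have "s = p + 1 / p" by (simp add: field_simps)
  moreover have "p \<le> 1"
  proof -
    have "(s - 2)\<^sup>2 \<le> q\<^sup>2" using q(2) assms by (simp add: power2_eq_square algebra_simps)
    then have "s - 2 \<le> q" using q(1) by (rule power2_le_imp_le)
    then show ?thesis by (simp add: p_def)
  qed
  ultimately show thesis using that p(1) by blast
qed

context conn_graph begin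

lemma extremal_fork:
  assumes n: "card (pverts G) = 10" and a: "0 \<le> a" "a < 1" and deg: "card (nbrs G v) \<ge> 3"
    and min: "\<And>vs. distinct vs \<Longrightarrow> set vs = pverts G \<Longrightarrow>
      A_spectral_radius a G \<le> A_spectral_radius a (list_graph vs fork_rel)"
  obtains vs where "distinct vs" "set vs = pverts G" "G = list_graph vs fork_rel"
proof -
  obtain us where us: "set us = pverts G" "distinct us"
    using finite_distinct_list[OF pair_finite_verts] by blast
  have len: "length us = 10" using us n distinct_card by metis
  define r where "r = a / (1 - a)"
  define s where "s = (A_spectral_radius a (list_graph us fork_rel) - 2 * a) / (1 - a)"
  define \<sigma> where "\<sigma> = (A_spectral_radius a G - 2 * a) / (1 - a)"
  have "\<sigma> \<le> s"
    using min[OF us(2,1)] a by (simp add: \<sigma>_def s_def divide_right_mono)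
  have r: "r \<ge> 0" using a by (simp add: r_def)
  \<comment> \<open>Below 2 the threshold p = 1 serves as for the path. Otherwise t is the exact
    value s of the fork, where \<sigma> - r - 2 F_1 is at most F_7, and F_7 stays below the limit
    p.\<close>
  obtain p t where pt: "0 < p" "p \<le> 1" "t = p + 1 / p" "\<sigma> \<le> t" "\<sigma> - r - 2 * arm_ratio r t 1 < p"
  proof (cases "s < 2")
    case True
    then show ?thesis
      using that[of 1 2] \<open>\<sigma> \<le> s\<close> two_minus_arm_ratio_le[OF r] by simp
  next
    case False
    then have "s \<ge> 2" by simp
    obtain p where p: "0 < p" "p \<le> 1" "s = p + 1 / p"
      using exists_add_inverse_eq[OF \<open>s \<ge> 2\<close>] .
    have "arm_ratio r s 7 < p" using arm_ratio_defect(2)[OF r p, of 7] by simp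
    then show ?thesis
      using that[of p s] p \<open>\<sigma> \<le> s\<close> fork_perron[OF us(2) len a s_def \<open>s \<ge> 2\<close> r_def] by simp
  qed
  from spanning_sorted_spider[OF a pt(1-3) r_def \<sigma>_def pt(4,5) deg]
  obtain w as bs cs where sp: "spider G w as bs cs" "set (w # as @ bs @ cs) = pverts G"
    "length as = 1" "1 \<le> length bs" "length bs \<le> length cs"
    "\<not> (3 \<le> length bs \<and> 3 \<le> length cs)" "\<not> (2 \<le> length bs \<and> 5 \<le> length cs)" .
  define vs where "vs = w # as @ bs @ cs"
  have vs: "distinct vs" "set vs = pverts G"
    using sp(1,2) by (simp_all add: spider_def vs_def)
  have lenvs: "length vs = 10" using vs n distinct_card by metis
  then have "length bs + length cs = 8" using sp(3) by (simp add: vs_def)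
  \<comment> \<open>The lengths add up to 8 and the exclusions rule out (2,6), (3,5) and
    (4,4).\<close>
  then have "length bs = 1" using sp(4-7) by linarith
  then obtain b c where bc: "as = [b]" "bs = [c]" using sp(3) by (auto simp: length_Suc_conv)
  let ?H = "list_graph vs fork_rel"
  have "vs \<noteq> []" by (simp add: vs_def)
  have vs_eq: "vs = w # b # c # cs" by (simp add: vs_def bc)
  have down: "(vs ! i, vs ! j) \<in> parcs G" if "i = 0 \<and> 1 \<le> j \<and> j \<le> 3 \<or> 3 \<le> i \<and> j = Suc i" "j < 10" for i j
  proof -
    have ch: "successively (\<lambda>u v. (u, v) \<in> parcs G) (w # cs)" "(w, b) \<in> parcs G" "(w, c) \<in> parcs G"
      using sp(1) by (simp_all add: spider_def bc)
    have lencs: "length cs = 7" using lenvs by (simp add: vs_eq)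
    consider "i = 0" "j = 1" | "i = 0" "j = 2" | "i = 0" "j = 3" | k where "i = k + 3" "j = k + 4"
    proof -
      have "\<exists>k. i = k + 3 \<and> j = k + 4" if "3 \<le> i" "j = Suc i"
        using that by (intro exI[of _ "i - 3"]) simp
      moreover have "j = 1 \<or> j = 2 \<or> j = 3" if "1 \<le> j" "j \<le> 3" using that by linarith
      ultimately show ?thesis using that(1) \<open>i = 0 \<and> 1 \<le> j \<and> j \<le> 3 \<or> 3 \<le> i \<and> j = Suc i\<close> that by blast
    qed
    then show ?thesis
    proof cases
      case 3
      have "((w # cs) ! 0, (w # cs) ! Suc 0) \<in> parcs G"
        using ch(1)[unfolded successively_conv_nth, rule_format, of 0] lencs by simp
      then show ?thesis using 3 by (simp add: vs_eq eval_nat_numeral)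
    next
      case 4
      have "((w # cs) ! Suc k, (w # cs) ! Suc (Suc k)) \<in> parcs G"
        using ch(1)[unfolded successively_conv_nth, rule_format, of "Suc k"] lencs 4 that(2)
        by (simp del: nth_Cons_Suc)
      then show ?thesis using 4 by (simp add: vs_eq eval_nat_numeral)
    qed (use ch in \<open>simp_all add: vs_eq\<close>)
  qed
  have "parcs ?H \<subseteq> parcs G"
  proof
    fix e assume "e \<in> parcs ?H"
    then obtain i j where e: "e = (vs ! i, vs ! j)" "i < 10" "j < 10" "fork_rel i j"
      using lenvs by (auto simp: arcs_list_graph)
    from e(4) have "(i = 0 \<and> 1 \<le> j \<and> j \<le> 3 \<or> 3 \<le> i \<and> j = Suc i) \<or> (j = 0 \<and> 1 \<le> i \<and> i \<le> 3 \<or> 3 \<le> j \<and> i = Suc j)"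
      unfolding fork_rel_def by blast
    then show "e \<in> parcs G"
      using down[of i j] down[of j i] e(1-3) arc_sym[of "vs ! i" "vs ! j"] by blast
  qed
  \<comment> \<open>So far the fork is only a spanning subgraph; an additional arc would push the
    radius of \<open>G\<close> above that of the fork.\<close>
  moreover have "\<not> parcs ?H \<subset> parcs G"
  proof
    assume "parcs ?H \<subset> parcs G"
    then have "A_spectral_radius a ?H < A_spectral_radius a G"
      using vs(2) conn_graph_list_graph[OF vs(1) \<open>vs \<noteq> []\<close> graph_rel_fork]
      by (intro spectral_radius_subgraph_less[OF a]) auto
    then show False using min[OF vs] by simp
  qed
  ultimately have "parcs ?H = parcs G" by blast
  then have "G = ?H" using vs(2) by simp
  then show thesis using that vs by blast
qed

section \<open>Order seven: the constant test vector\<close>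

lemma sum_Aop_one: "(\<Sum>v\<in>pverts G. 1 * Aop a G (\<lambda>_. 1) v) = real (card (parcs G))"
proof -
  have "(\<Sum>v\<in>pverts G. 1 * Aop a G (\<lambda>_. 1) v) = (\<Sum>e\<in>parcs G. 1)"
    unfolding sum_Aop_conv_arcs by (intro sum.cong) auto
  then show ?thesis by simp
qed

text \<open>The constant function in the Rayleigh bound: each arc contributes
  \<open>a + (1 - a) = 1\<close>, so \<alpha> drops out and the average degree is a lower bound for
  the radius.\<close>

lemma card_arcs_le:
  assumes "a \<le> 1"
  shows "real (card (parcs G)) \<le> A_spectral_radius a G * real (card (pverts G))"
proof -
  have "real (card (parcs G)) \<le> A_spectral_radius a G * (\<Sum>v\<in>pverts G. 1\<^sup>2)"
    unfolding sum_Aop_one[of a, symmetric] by (rule rayleigh_le[OF verts_nonempty assms])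
  then show ?thesis by simp
qed

text \<open>Equality means that the constant function attains the Rayleigh maximum; it is then an
  eigenvector, and the graph is regular.\<close>

lemma card_nbrs_of_card_arcs:
  assumes "a \<le> 1" "v \<in> pverts G"
    and "real (card (parcs G)) = A_spectral_radius a G * real (card (pverts G))"
  shows "real (card (nbrs G v)) = A_spectral_radius a G"
proof -
  have "Aop a G (\<lambda>_. 1) v = A_spectral_radius a G * 1"
    by (rule rayleigh_max_eigen[OF rayleigh_le[OF verts_nonempty assms(1)] _ assms(2)])
      (use sum_Aop_one[of a] assms(3) in simp)
  then show ?thesis by (simp add: Aop_def)
qed

lemma extremal_cycle:
  assumes n: "card (pverts G) = 7" and ind: "independence_number G = 3" and a: "a \<le> 1"
    and le: "A_spectral_radius a G \<le> 2"
  obtains vs where "distinct vs" "set vs = pverts G" "G = list_graph vs (cycle_rel 7)"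
proof -
  have le14: "card (parcs G) \<le> 14"
    using card_arcs_le[OF a] le n by simp
  have small_degree: "card (nbrs G v) \<le> 2" for v
  proof (cases "card (parcs G) = 14")
    case True
    \<comment> \<open>Seven edges give equality in the average degree bound, so the graph is
      2-regular.\<close>
    then have "14 \<le> A_spectral_radius a G * 7" using card_arcs_le[OF a] n by simp
    then have l: "A_spectral_radius a G = 2" using le by simp
    show ?thesis
    proof (cases "v \<in> pverts G")
      case True
      then show ?thesis using card_nbrs_of_card_arcs[OF a True] l n \<open>card (parcs G) = 14\<close> by simp
    next
      case False
      then have "nbrs G v = {}" using in_arcsD1 by blast
      then show ?thesis by simp
    qed
  next
    case False
    then have few: "card (parcs G) < 2 * card (pverts G)" using le14 n by simp
    have "\<exists>c :: 'a \<Rightarrow> bool. \<forall>u v. (u, v) \<in> parcs G \<longrightarrow> c u \<noteq> c v"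
      by (rule two_colouring_of_few_arcs[OF few]) blast
    then obtain c :: "'a \<Rightarrow> bool" where c: "\<And>u v. (u, v) \<in> parcs G \<Longrightarrow> c u \<noteq> c v"
      by blast
    have "independent_set G {v \<in> pverts G. c v}" "independent_set G {v \<in> pverts G. \<not> c v}"
      using c by (auto simp: independent_set_def)
    then have "card {v \<in> pverts G. c v} \<le> 3" "card {v \<in> pverts G. \<not> c v} \<le> 3"
      using card_le_independence_number ind by metis+
    moreover have "card {v \<in> pverts G. c v} + card {v \<in> pverts G. \<not> c v} = card (pverts G)"
      using pair_finite_verts by (subst card_Un_disjoint[symmetric]) (auto intro!: arg_cong[of _ _ card])
    ultimately show ?thesis using n by simp
  qed
  obtain vs where vs: "distinct vs" "set vs = pverts G"
    "G = list_graph vs path_rel \<or> G = list_graph vs (cycle_rel (length vs))"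
    by (rule path_or_cycle[OF small_degree]) (use n in simp)
  have len: "length vs = 7" using vs n distinct_card by metis
  have "G \<noteq> list_graph vs path_rel"
  proof
    assume G: "G = list_graph vs path_rel"
    \<comment> \<open>The path has four alternate vertices, while the independence number is
      3.\<close>
    have "independent_set G ((!) vs ` {0, 2, 4, 6})"
      using len vs(1,2) unfolding independent_set_def
      by (auto simp: G arcs_list_graph nth_eq_iff_index_eq)
    moreover have "card ((!) vs ` {0, 2, 4, 6}) = 4"
      using len vs(1) by (subst card_image) (auto simp: inj_on_def nth_eq_iff_index_eq)
    ultimately show False using card_le_independence_number ind by fastforce
  qed
  with vs(3) have "G = list_graph vs (cycle_rel 7)" unfolding len by blast
  then show thesis using that[OF vs(1,2)] by blast
qed

end

section \<open>Two triangles joined by an edge\<close>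

text \<open>For lists of length six this is the complement of K_(3,3) minus an edge: the parts
  become the triangles 0, 1, 2 and 3, 4, 5, and the deleted edge becomes the bridge between 2 and
  3.\<close>

definition bitriangle_rel :: "nat \<Rightarrow> nat \<Rightarrow> bool" where
  "bitriangle_rel i j \<longleftrightarrow> i \<noteq> j \<and>
    (i < 3 \<and> j < 3 \<or> 3 \<le> i \<and> 3 \<le> j \<or> i = 2 \<and> j = 3 \<or> i = 3 \<and> j = 2)"

lemma upt_6: "[0..<6] = [0, 1, 2, 3, 4, 5 :: nat]"
  by (simp add: upt_rec)

lemma less_6_cases: "i < 6 \<Longrightarrow> i = 0 \<or> i = 1 \<or> i = 2 \<or> i = 3 \<or> i = 4 \<or> i = (5 :: nat)"
  by auto

lemma graph_rel_bitriangle: "graph_rel 6 bitriangle_rel"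
proof -
  have "\<exists>j<i. bitriangle_rel j i" if "0 < i" "i < 6" for i
  proof (cases "i < 4")
    case True
    then show ?thesis
      using that by (intro exI[of _ "if i = 3 then 2 else 0"]) (auto simp: bitriangle_rel_def)
  next
    case False
    then show ?thesis
      using that by (intro exI[of _ 3]) (auto simp: bitriangle_rel_def)
  qed
  then show ?thesis by (auto simp: graph_rel_def bitriangle_rel_def)
qed

text \<open>
  The test vector is \<open>1\<close> on the four vertices of degree two and \<open>h\<close> on the other two; \<open>h\<close> is chosen
  to give equality at the former, and the inequality at the latter amounts to \<open>\<alpha> \<le> 7 / 9\<close>.
\<close>

lemma bitriangle_spectral_radius_le:
  assumes vs: "distinct vs" "length vs = 6" and a: "0 \<le> a" "a \<le> 7 / 9"
  shows "A_spectral_radius a (list_graph vs bitriangle_rel) \<le> 8 / 3"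
proof -
  define h where "h = (5 / 3 - a) / (1 - a)"
  have h: "(1 - a) * h = 5 / 3 - a" using a by (simp add: h_def)
  have "h > 0" using a by (simp add: h_def)
  have hub: "3 * a * h + (1 - a) * (2 + h) \<le> 8 / 3 * h"
  proof -
    \<comment> \<open>Multiplying by \<open>1 - a\<close> eliminates \<open>h\<close>, and (5/3 -
      a)(5/3 - 2a) - 2(1 - a)^2 = 7/9 - a.\<close>
    have "(1 - a) * (2 * (1 - a)) \<le> (1 - a) * (h * (5 / 3 - 2 * a))"
    proof -
      have "(1 - a) * (h * (5 / 3 - 2 * a)) = (5 / 3 - a) * (5 / 3 - 2 * a)"
        unfolding h[symmetric] by (simp only: mult.assoc)
      then show ?thesis using a by (simp add: algebra_simps)
    qed
    then have "2 * (1 - a) \<le> h * (5 / 3 - 2 * a)"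
      using a by (simp add: mult_le_cancel_left)
    then show ?thesis by (simp add: algebra_simps)
  qed
  show ?thesis
  proof (rule list_graph_spectral_radius_le[OF vs, of _ _ "\<lambda>i. if i = 2 \<or> i = 3 then h else 1"])
    show "graph_rel 6 bitriangle_rel" by (rule graph_rel_bitriangle)
    fix i :: nat assume "i < 6"
    then show "a * real (length (filter (bitriangle_rel i) [0..<6])) * (if i = 2 \<or> i = 3 then h else 1)
        + (1 - a) * sum_list (map (\<lambda>i. if i = 2 \<or> i = 3 then h else 1) (filter (bitriangle_rel i) [0..<6]))
        \<le> 8 / 3 * (if i = 2 \<or> i = 3 then h else 1)"
      unfolding upt_6 using hub h
      by (elim less_6_cases[elim_format] disjE) (simp_all add: bitriangle_rel_def algebra_simps)
  qed (use \<open>h > 0\<close> a in auto)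
qed

context conn_graph begin

lemma card_arcs_eq_sum: "card (parcs G) = (\<Sum>v\<in>pverts G. card (nbrs G v))"
proof -
  have "parcs G = Sigma (pverts G) (nbrs G)" by (auto dest: in_arcsD1)
  then have "card (parcs G) = card (Sigma (pverts G) (nbrs G))" by (rule arg_cong)
  also have "\<dots> = (\<Sum>v\<in>pverts G. card (nbrs G v))"
    using pair_finite_verts by (intro card_SigmaI) auto
  finally show ?thesis .
qed

text \<open>Arcs count every edge twice, so at most 15 of them means at most seven edges.
  Independence number 2 makes the non-neighbours \<open>W\<close> of a vertex \<open>v\<close> a
  clique; for \<open>v\<close> of degree at most two, this clique and the arcs around
  \<open>v\<close> nearly exhaust the supply.\<close>

lemma bitriangle_of_few_arcs:
  assumes n: "card (pverts G) = 6" and ind: "independence_number G = 2" and few: "card (parcs G) \<le> 15"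
  obtains vs where "distinct vs" "set vs = pverts G" "G = list_graph vs bitriangle_rel"
proof -
  have no_indep: "(u, v) \<in> parcs G \<or> (v, w) \<in> parcs G \<or> (u, w) \<in> parcs G"
    if "u \<in> pverts G" "v \<in> pverts G" "w \<in> pverts G" "u \<noteq> v" "v \<noteq> w" "u \<noteq> w" for u v w
  proof (rule ccontr)
    assume "\<not> ?thesis"
    then have "independent_set G {u, v, w}"
      using that(1-3) arc_sym[of v u] arc_sym[of w v] arc_sym[of w u]
      unfolding independent_set_def by simp
    then show False using card_le_independence_number[of "{u, v, w}"] ind that by simp
  qed
  have "\<exists>v\<in>pverts G. card (nbrs G v) \<le> 2"
  proof (rule ccontr)
    assume "\<not> ?thesis"
    then have "(\<Sum>v\<in>pverts G. 3) \<le> (\<Sum>v\<in>pverts G. card (nbrs G v))"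
      by (intro sum_mono) auto
    then show False using few n card_arcs_eq_sum by simp
  qed
  then obtain v where v: "v \<in> pverts G" "card (nbrs G v) \<le> 2" by blast
  define W where "W = pverts G - {v} - nbrs G v"
  have fin: "finite W" using pair_finite_verts by (simp add: W_def)
  have W: "W \<subseteq> pverts G" "v \<notin> W" "W \<inter> nbrs G v = {}" by (auto simp: W_def)
  have cardW: "card W = 5 - card (nbrs G v)"
    using v n nbrs_subset not_self_nbr pair_finite_verts by (simp add: W_def card_Diff_subset subset_Diff_insert)
  define X where "X = {(a, b). a \<in> W \<and> b \<in> W \<and> a \<noteq> b}"
  have X: "X \<subseteq> parcs G"
  proof
    fix e assume "e \<in> X"
    then obtain c d where e: "e = (c, d)" "c \<in> W" "d \<in> W" "c \<noteq> d" by (auto simp: X_def)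
    then have "(v, c) \<notin> parcs G" "(v, d) \<notin> parcs G" using W(3) by blast+
    then have "(c, d) \<in> parcs G" using no_indep[of v c d] e W v(1) by blast
    then show "e \<in> parcs G" using e(1) by simp
  qed
  have finX: "finite X" using X pair_finite_arcs finite_subset by blast
  have cardX: "card X = card W * card W - card W"
  proof -
    have "X = W \<times> W - (\<lambda>a. (a, a)) ` W" by (auto simp: X_def)
    then show ?thesis
      using fin by (simp add: card_Diff_subset card_image inj_on_def image_subset_iff card_cartesian_product)
  qed
  \<comment> \<open>\<open>X\<close> holds the arcs inside the clique, \<open>A\<close> further
    ones; sixteen in total exceed the bound.\<close>
  have too_many: False if "A \<subseteq> parcs G" "A \<inter> X = {}" "card X + card A \<ge> 16" for A
  proof -
    have "finite A" using that(1) pair_finite_arcs finite_subset by blast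
    then have "card (X \<union> A) = card X + card A" using that(2) finX by (intro card_Un_disjoint) auto
    moreover have "card (X \<union> A) \<le> card (parcs G)"
      using X that(1) pair_finite_arcs by (intro card_mono) auto
    ultimately show False using few that(3) by simp
  qed
  have outside: "insert v (nbrs G v) \<subseteq> pverts G" using v nbrs_subset by auto
  have card3: "card (insert v (nbrs G v)) \<le> 3" using v(2) by (simp add: card_insert_if)
  have "insert v (nbrs G v) \<noteq> pverts G"
  proof
    assume "insert v (nbrs G v) = pverts G"
    from card3[unfolded this] n show False by simp
  qed
  then obtain z where "z \<in> pverts G" "z \<notin> insert v (nbrs G v)" using outside by blast
  then obtain x w where xw: "x \<in> insert v (nbrs G v)" "w \<in> pverts G" "w \<notin> insert v (nbrs G v)" "(x, w) \<in> parcs G"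
    using crossing_arc[of v "insert v (nbrs G v)" z] outside by blast
  have x: "(v, x) \<in> parcs G" "(x, v) \<in> parcs G" "(w, x) \<in> parcs G" "w \<in> W" "x \<notin> W" "x \<noteq> v" "x \<noteq> w" "w \<noteq> v"
  proof -
    show xv: "x \<noteq> v" using xw(3,4) by auto
    show vx: "(v, x) \<in> parcs G" using xw(1) xv by simp
    show "(x, v) \<in> parcs G" "(w, x) \<in> parcs G" using vx xw(4) arc_sym by metis+
    show "w \<in> W" using xw(2,3) by (simp add: W_def)
    then show "w \<noteq> v" using W(2) by blast
    show "x \<notin> W" using vx W(3) by blast
    show "x \<noteq> w" using xw(4) not_self_nbr by metis
  qed
  have "card (nbrs G v) \<noteq> 0" using x(1) by auto
  then consider "card (nbrs G v) = 1" | "card (nbrs G v) = 2" using v(2) by linarith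
  then show thesis
  proof cases
    case 1
    \<comment> \<open>The clique on four vertices has twelve arcs; these four bring the total to
      sixteen.\<close>
    have "card {(v, x), (x, v), (x, w), (w, x)} = 4" using x by simp
    then show ?thesis
      using too_many[of "{(v, x), (x, v), (x, w), (w, x)}"] x xw(4) W cardX cardW 1 by (simp add: X_def)
  next
    case 2
    have xN: "x \<in> nbrs G v" using x(1) by simp
    then have "card (nbrs G v - {x}) = 1" using 2 by (simp only: card_Diff_singleton diff_Suc_1 numeral_2_eq_2)
    then obtain y where "nbrs G v - {x} = {y}" by (rule card_1_singletonE)
    then have y: "nbrs G v = {x, y}" "x \<noteq> y" using xN by blast+
    have "y \<in> nbrs G v" unfolding y(1) by simp
    then have vy: "(v, y) \<in> parcs G" by simp
    have y': "(v, y) \<in> parcs G" "(y, v) \<in> parcs G" "y \<notin> W" "y \<noteq> v" "x \<in> pverts G" "y \<in> pverts G"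
      using vy arc_sym[of v y] W(3) not_self_nbr[of v] in_arcsD2[OF vy] in_arcsD2[OF x(1)] by blast+
    have "card W = 3" using cardW 2 by simp
    have xy: "(x, y) \<in> parcs G"
    proof (rule ccontr)
      \<comment> \<open>Then every vertex of \<open>W\<close> is adjacent to \<open>x\<close> or
        \<open>y\<close>: 6 arcs inside \<open>W\<close>, 4 at \<open>v\<close> and 6 between give
        sixteen.\<close>
      assume no: "(x, y) \<notin> parcs G"
      have "\<exists>g. g \<in> {x, y} \<and> (u, g) \<in> parcs G \<and> (g, u) \<in> parcs G" if u: "u \<in> W" for u
      proof -
        have "u \<in> pverts G" "x \<noteq> u" "y \<noteq> u" using u W(1) x(5) y'(3) by blast+
        then have "(y, u) \<in> parcs G \<or> (x, u) \<in> parcs G"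
          using no_indep[of x y u] no y(2) y'(5,6) by blast
        then show ?thesis using arc_sym[of y u] arc_sym[of x u] by blast
      qed
      then obtain g where g: "\<And>u. u \<in> W \<Longrightarrow> g u \<in> {x, y} \<and> (u, g u) \<in> parcs G \<and> (g u, u) \<in> parcs G"
        by metis
      let ?A = "{(v, x), (x, v), (v, y), (y, v)}" and ?B = "(\<lambda>u. (u, g u)) ` W" and ?C = "(\<lambda>u. (g u, u)) ` W"
      have "card ?A = 4" using x y y' by simp
      moreover have "card ?B = 3" "card ?C = 3"
        using \<open>card W = 3\<close> by (auto simp: card_image inj_on_def)
      moreover have gW: "g u \<notin> W" "g u \<noteq> v" if "u \<in> W" for u
        using g[OF that] x(5,6) y'(3,4) by auto
      moreover have "?A \<inter> ?B = {}" "(?A \<union> ?B) \<inter> ?C = {}"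
        using gW W(2) x(5) y'(3) by auto
      moreover have "finite ?A" "finite ?B" "finite ?C" using fin by simp_all
      ultimately have "card (?A \<union> ?B \<union> ?C) = 10"
        using card_Un_disjoint[of ?A ?B] card_Un_disjoint[of "?A \<union> ?B" ?C] finite_UnI[of ?A ?B] by linarith
      moreover have "?A \<union> ?B \<union> ?C \<subseteq> parcs G"
        using g x(1,2) y'(1,2) by auto
      moreover have "(?A \<union> ?B \<union> ?C) \<inter> X = {}"
        using gW W(2) by (auto simp: X_def)
      ultimately show False
        using too_many[of "?A \<union> ?B \<union> ?C"] cardX \<open>card W = 3\<close> by simp
    qed
    have "card (W - {w}) = 2" using \<open>card W = 3\<close> x fin by simp
    then obtain w' w'' where w': "W - {w} = {w', w''}" "w' \<noteq> w''" by (auto simp: card_2_iff)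
    have Weq: "W = {w, w', w''}" "w \<noteq> w'" "w \<noteq> w''" using w' x(4) by auto
    define vs where "vs = [v, y, x, w, w', w'']"
    have vs: "distinct vs" "length vs = 6"
      using x y y' Weq w' W by (auto simp: vs_def)
    have set_vs: "set vs = pverts G"
      using y Weq v W y' by (auto simp: vs_def W_def)
    let ?H = "list_graph vs bitriangle_rel"
    have "vs \<noteq> []" by (simp add: vs_def)
    then interpret H: conn_graph ?H
      using conn_graph_list_graph[OF vs(1)] vs(2) graph_rel_bitriangle by simp
    have sub: "parcs ?H \<subseteq> parcs G"
    proof
      fix e assume "e \<in> parcs ?H"
      then obtain i j where e: "e = (vs ! i, vs ! j)" "i < 6" "j < 6" "bitriangle_rel i j"
        using vs by (auto simp: arcs_list_graph)
      have clique: "(c, d) \<in> parcs G" if "c \<in> W" "d \<in> W" "c \<noteq> d" for c d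
        using X that by (auto simp: X_def)
      have arcs: "(v, y) \<in> parcs G" "(y, v) \<in> parcs G" "(v, x) \<in> parcs G" "(x, v) \<in> parcs G"
        "(x, y) \<in> parcs G" "(y, x) \<in> parcs G" "(x, w) \<in> parcs G" "(w, x) \<in> parcs G"
        "(w, w') \<in> parcs G" "(w', w) \<in> parcs G" "(w, w'') \<in> parcs G" "(w'', w) \<in> parcs G"
        "(w', w'') \<in> parcs G" "(w'', w') \<in> parcs G"
        using x y' xy xw arc_sym[of x y] clique Weq w'(2) by auto
      show "e \<in> parcs G"
        using e(4) less_6_cases[OF e(2)] less_6_cases[OF e(3)] arcs
        unfolding e(1) by (elim disjE) (simp_all add: vs_def bitriangle_rel_def)
    qed
    \<comment> \<open>With at most 15 arcs in \<open>G\<close> this leaves no room for another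
      opposite pair.\<close>
    have "card (parcs ?H) = 14"
    proof -
      have c: "card (nbrs ?H (vs ! i)) = length (filter (bitriangle_rel i) [0..<6])" if "i < 6" for i
        using card_nbrs_list_graph[OF vs(1), of i bitriangle_rel] vs(2) that by simp
      have "card (parcs ?H) = sum_list (map (\<lambda>v. card (nbrs ?H v)) vs)"
        using H.card_arcs_eq_sum vs(1) by (simp add: sum_list_distinct_conv_sum_set)
      also have "map (\<lambda>v. card (nbrs ?H v)) vs = map (\<lambda>i. card (nbrs ?H (vs ! i))) [0..<6]"
        by (simp add: upt_6 vs_def)
      also have "\<dots> = map (\<lambda>i. length (filter (bitriangle_rel i) [0..<6])) [0..<6]"
        using c by (intro map_cong) auto
      also have "sum_list \<dots> = 14"
        unfolding upt_6 by (simp add: bitriangle_rel_def)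
      finally show ?thesis .
    qed
    have "sym (parcs ?H)" using H.arc_sym by (metis symI)
    then have "parcs ?H = parcs G"
      using arcs_eqI[OF sub] \<open>card (parcs ?H) = 14\<close> few by simp
    then have "G = ?H" using set_vs by simp
    then show ?thesis using that vs set_vs by blast
  qed
qed

lemma extremal_bitriangle:
  assumes n: "card (pverts G) = 6" and ind: "independence_number G = 2"
    and a: "a \<le> 1" and le: "A_spectral_radius a G \<le> 8 / 3"
  obtains vs where "distinct vs" "set vs = pverts G" "G = list_graph vs bitriangle_rel"
proof (rule bitriangle_of_few_arcs[OF n ind])
  show "card (parcs G) \<le> 15"
  proof (rule ccontr)
    assume "\<not> ?thesis"
    moreover have "card (parcs G) \<le> 16" using card_arcs_le[OF a] le n by simp
    ultimately have c: "card (parcs G) = 16" by linarith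
    then have "A_spectral_radius a G = 8 / 3" using card_arcs_le[OF a] le n by simp
    moreover obtain v where "v \<in> pverts G" using verts_nonempty by blast
    ultimately have "real (card (nbrs G v)) = 8 / 3"
      using card_nbrs_of_card_arcs[OF a, of v] c n by simp
    then have "real (3 * card (nbrs G v)) = real 8" by simp
    then have "3 * card (nbrs G v) = 8" unfolding of_nat_eq_iff .
    then show False by presburger
  qed
qed (use that in blast)

end

section \<open>Identification of the extremal graphs\<close>

lemma pcas_consecutive:
  "pcas u p v \<Longrightarrow> Suc k < length p \<Longrightarrow> fst (p ! Suc k) = snd (p ! k)"
proof (induction p arbitrary: u k)
  case (Cons e p)
  then show ?case by (cases k; cases p) auto
qed simp

lemma pcas_ends:
  "pcas u p v \<Longrightarrow> p \<noteq> [] \<Longrightarrow> fst (p ! 0) = u \<and> snd (last p) = v"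
proof (induction p arbitrary: u)
  case (Cons e p)
  then show ?case by (cases p) auto
qed simp

lemma pawalk_verts_conv: "pcas u p v \<Longrightarrow> pawalk_verts u p = u # map snd p"
  by (induction p arbitrary: u) auto

text \<open>On a cycle the two neighbours of the vertex with the largest label would both be smaller.\<close>

lemma (in pair_graph) no_long_cycle:
  fixes f :: "'a \<Rightarrow> nat"
  assumes inj: "inj_on f (pverts G)"
    and unique: "\<And>u v w. (u, w) \<in> parcs G \<Longrightarrow> (v, w) \<in> parcs G \<Longrightarrow> f u < f w \<Longrightarrow> f v < f w \<Longrightarrow> u = v"
  shows "\<not> (\<exists>p. pre_digraph.cycle (with_proj G) p \<and> length p \<ge> 3)"
proof clarify
  fix p assume cyc: "pre_digraph.cycle (with_proj G) p" and len: "length p \<ge> 3"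
  then obtain u where u: "set p \<subseteq> parcs G" "pcas u p u" "distinct (tl (pawalk_verts u p))"
    by (auto simp: pre_digraph.cycle_def pre_digraph.awalk_def cas_with_proj_eq awalk_verts_with_proj_eq)
  define m where "m = length p"
  define c where "c k = snd (p ! k)" for k
  have m: "m \<ge> 3" using len by (simp add: m_def)
  have "distinct (map snd p)" using u(3) pawalk_verts_conv[OF u(2)] by simp
  then have c_eq: "c i = c j \<longleftrightarrow> i = j" if "i < m" "j < m" for i j
    using that nth_eq_iff_index_eq[of "map snd p" i j] by (simp add: c_def m_def)
  have arc: "(c k, c (if Suc k = m then 0 else Suc k)) \<in> parcs G" if "k < m" for k
  proof -
    let ?k = "if Suc k = m then 0 else Suc k"
    have k: "?k < length p" using that m by (auto simp: m_def)
    have "fst (p ! ?k) = c k"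
    proof (cases "Suc k = m")
      case True
      have "p \<noteq> []" using len by auto
      moreover have "length p - 1 = k" using True by (simp add: m_def)
      ultimately have "snd (last p) = c k" by (simp add: last_conv_nth c_def)
      then show ?thesis using True pcas_ends[OF u(2) \<open>p \<noteq> []\<close>] by simp
    next
      case False
      then show ?thesis using pcas_consecutive[OF u(2), of k] that by (simp add: c_def m_def)
    qed
    then have "p ! ?k = (c k, c ?k)" by (simp add: c_def prod_eq_iff)
    then show ?thesis using nth_mem[OF k] u(1) by auto
  qed
  have inV: "c k \<in> pverts G" if "k < m" for k
    using arc[OF that] in_arcsD1 by blast
  have "Max ((\<lambda>k. f (c k)) ` {..<m}) \<in> (\<lambda>k. f (c k)) ` {..<m}"
  proof (rule Max_in)
    have "f (c 0) \<in> (\<lambda>k. f (c k)) ` {..<m}" using m by simp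
    then show "(\<lambda>k. f (c k)) ` {..<m} \<noteq> {}" by blast
  qed simp
  then obtain k where k: "k < m" "f (c k) = Max ((\<lambda>k. f (c k)) ` {..<m})" by auto
  have smaller: "f (c j) < f (c k)" if "j < m" "j \<noteq> k" for j
  proof -
    have "f (c j) \<le> f (c k)" using that k by simp
    moreover have "f (c j) \<noteq> f (c k)"
      using inj_onD[OF inj _ inV[OF that(1)] inV[OF k(1)]] c_eq[OF that(1) k(1)] that(2) by blast
    ultimately show ?thesis by simp
  qed
  \<comment> \<open>The cyclic predecessor and successor of the vertex with the largest label; they
    differ because the length is at least 3.\<close>
  define k0 where "k0 = (if k = 0 then m - 1 else k - 1)"
  define k1 where "k1 = (if Suc k = m then 0 else Suc k)"
  have kk: "k0 < m" "k1 < m" "k0 \<noteq> k" "k1 \<noteq> k" "k0 \<noteq> k1" "(if Suc k0 = m then 0 else Suc k0) = k"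
    using k(1) m by (auto simp: k0_def k1_def)
  have "(c k0, c k) \<in> parcs G" using arc[OF kk(1)] kk(6) by simp
  moreover have "(c k1, c k) \<in> parcs G" using arc[OF k(1)] arc_sym by (simp add: k1_def)
  ultimately have "c k0 = c k1" using unique smaller kk by blast
  then show False using c_eq kk by blast
qed

lemma iso_T_fork:
  assumes vs: "distinct vs" "length vs = 10"
  shows "iso_T 1 1 7 (list_graph vs fork_rel)"
proof -
  let ?G = "list_graph vs fork_rel" and ?w = "vs ! 0"
  define f where "f = inv_into {..<10} ((!) vs)"
  have inj: "inj_on ((!) vs) {..<10}" using vs by (auto simp: inj_on_def nth_eq_iff_index_eq)
  have f: "f (vs ! i) = i" if "i < 10" for i
    using inv_into_f_f[OF inj, of i] that by (simp add: f_def)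
  have img: "set vs = (!) vs ` {..<10}" using vs by (auto simp: set_conv_nth)
  have "vs \<noteq> []" using vs(2) by auto
  interpret G: conn_graph ?G
    by (rule conn_graph_list_graph[OF vs(1) \<open>vs \<noteq> []\<close> graph_rel_fork])
  have arcs: "\<exists>i<10. \<exists>j<10. e = (vs ! i, vs ! j) \<and> fork_rel i j" if "e \<in> parcs ?G" for e
    using that vs(2) by (auto simp: arcs_list_graph)
  have "\<not> (\<exists>p. pre_digraph.cycle (with_proj ?G) p \<and> length p \<ge> 3)"
  proof (rule G.no_long_cycle[of f])
    show "inj_on f (pverts ?G)" using img f by (auto simp: inj_on_def)
    fix u v w assume uvw: "(u, w) \<in> parcs ?G" "(v, w) \<in> parcs ?G" "f u < f w" "f v < f w"
    obtain i k where i: "i < 10" "k < 10" "u = vs ! i" "w = vs ! k" "fork_rel i k"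
      using arcs[OF uvw(1)] by auto
    obtain j k' where j: "j < 10" "k' < 10" "v = vs ! j" "w = vs ! k'" "fork_rel j k'"
      using arcs[OF uvw(2)] by auto
    have "k' = k" using i j f by metis
    then have "i < k" "j < k" "fork_rel j k" using uvw(3,4) i j f by auto
    \<comment> \<open>In this labelling every vertex has at most one neighbour of smaller
      index.\<close>
    then have "i = j" using i(5) by (auto simp: fork_rel_def)
    then show "u = v" using i j by simp
  qed
  then have tree: "undirected_tree ?G"
    using G.conn G.pair_graph_axioms by (simp add: undirected_tree_def)
  have upt: "[0..<10] = [0, 1, 2, 3, 4, 5, 6, 7, 8, 9 :: nat]" by (simp add: upt_rec)
  have deg: "degree_of ?G (vs ! i) = length (filter (fork_rel i) [0..<10])" if "i < 10" for i
    using card_nbrs_list_graph[OF vs(1), of i fork_rel] vs(2) that by (simp add: G.degree_of_eq)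
  have deg3: "3 \<le> length (filter (fork_rel i) [0..<10]) \<longleftrightarrow> i = 0" if "i < 10" for i
  proof -
    have "i = 0 \<or> i = 1 \<or> i = 2 \<or> i = 3 \<or> i = 4 \<or> i = 5 \<or> i = 6 \<or> i = 7 \<or> i = 8 \<or> i = 9"
      using that by auto
    then show ?thesis
      unfolding upt by (elim disjE) (simp_all add: fork_rel_def)
  qed
  have major: "major_vertex ?G v \<longleftrightarrow> v = ?w" for v
  proof -
    have "major_vertex ?G (vs ! i) \<longleftrightarrow> vs ! i = ?w" if "i < 10" for i
    proof -
      have "vs ! i = vs ! 0 \<longleftrightarrow> i = 0" using that vs by (simp add: nth_eq_iff_index_eq)
      then show ?thesis using that vs deg[OF that] deg3[OF that] by (simp add: major_vertex_def)
    qed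
    moreover have "\<exists>i<10. v = vs ! i" if "v \<in> set vs" using that img by auto
    moreover have "?w \<in> set vs" using vs(2) by simp
    ultimately show ?thesis by (metis major_vertex_def verts_list_graph)
  qed
  let ?H = "\<lparr>pverts = set vs - {?w}, parcs = {e \<in> parcs ?G. fst e \<noteq> ?w \<and> snd e \<noteq> ?w}\<rparr>"
  let ?D = "disjoint_union (path_graph 1) (disjoint_union (path_graph 1) (path_graph 7))"
  have del: "pre_digraph.del_vert (with_proj ?G) ?w = with_proj ?H"
    by (simp add: pre_digraph.del_vert_def with_proj_def)
  \<comment> \<open>Deleting the centre leaves the two leaves as one-vertex paths, and the long arm,
    whose indices are shifted down by 3.\<close>
  define g :: "nat \<Rightarrow> nat + nat + nat" where
    "g i = (if i = 1 then Inl 0 else if i = 2 then Inr (Inl 0) else Inr (Inr (i - 3)))" for i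
  have w: "vs ! i = ?w \<longleftrightarrow> i = 0" if "i < 10" for i
    using that vs by (simp add: nth_eq_iff_index_eq)
  have HV: "set vs - {?w} = (!) vs ` {1..<10}"
    using img w by (auto simp: image_iff)
  have HA: "{e \<in> parcs ?G. fst e \<noteq> ?w \<and> snd e \<noteq> ?w}
      = (\<lambda>(i, j). (vs ! i, vs ! j)) ` {(i, j). 3 \<le> i \<and> 3 \<le> j \<and> i < 10 \<and> j < 10 \<and> path_rel i j}"
    (is "_ = ?f ` ?I")
  proof (intro equalityI subsetI)
    fix e assume e: "e \<in> {e \<in> parcs ?G. fst e \<noteq> ?w \<and> snd e \<noteq> ?w}"
    then have "e \<in> parcs ?G" by simp
    then obtain i j where ij: "i < 10" "j < 10" "e = (vs ! i, vs ! j)" "fork_rel i j"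
      using arcs[of e] by blast
    then have "vs ! i \<noteq> ?w" "vs ! j \<noteq> ?w" using e by simp_all
    then have "i \<noteq> 0" "j \<noteq> 0" by metis+
    then have "(i, j) \<in> ?I" using ij by (auto simp: fork_rel_def)
    then show "e \<in> ?f ` ?I" using ij(3) by force
  next
    fix e assume "e \<in> ?f ` ?I"
    then obtain i j where ij: "(i, j) \<in> ?I" "e = (vs ! i, vs ! j)" by auto
    then have "fork_rel i j" by (auto simp: fork_rel_def)
    then have "e \<in> parcs ?G" using ij vs(2) list_graph_arc_iff[OF vs(1), of i j] by auto
    then show "e \<in> {e \<in> parcs ?G. fst e \<noteq> ?w \<and> snd e \<noteq> ?w}" using ij w by auto
  qed
  have "(\<lambda>k. k + 3) ` {..<7} = {3..<10::nat}"
    using image_add_atLeastLessThan'[of 3 0 7] by (simp add: lessThan_atLeast0)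
  then have range: "{1..<10::nat} = {1, 2} \<union> (\<lambda>k. k + 3) ` {..<7}" by auto
  have inj_g: "inj_on g {1..<10}"
    unfolding range by (auto simp: inj_on_def g_def)
  have "graph_iso ?H ?D"
  proof (rule graph_isoI[of _ "g \<circ> f"])
    show "pair_wf_digraph ?H"
      by unfold_locales (auto dest: G.in_arcsD1 G.in_arcsD2)
    show "inj_on (g \<circ> f) (pverts ?H)"
    proof (rule inj_onI)
      fix u v assume uv: "u \<in> pverts ?H" "v \<in> pverts ?H" "(g \<circ> f) u = (g \<circ> f) v"
      then obtain i j where ij: "i \<in> {1..<10}" "u = vs ! i" "j \<in> {1..<10}" "v = vs ! j"
        using HV by auto
      then have "g i = g j" using uv(3) f by simp
      then have "i = j" using inj_onD[OF inj_g] ij by blast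
      then show "u = v" using ij by simp
    qed
    have gf: "(g \<circ> f) ` (!) vs ` {1..<10} = g ` {1..<10}"
      unfolding image_image by (rule image_cong[OF refl]) (simp add: f)
    have "g ` {1..<10} = {Inl 0, Inr (Inl 0)} \<union> (\<lambda>k. Inr (Inr k)) ` {..<7}"
    proof -
      have "g ` (\<lambda>k. k + 3) ` {..<7} = (\<lambda>k. Inr (Inr k)) ` {..<7}"
        unfolding image_image by (rule image_cong[OF refl]) (simp add: g_def)
      moreover have "g ` {1, 2} = {Inl 0, Inr (Inl 0)}" by (auto simp: g_def)
      ultimately show ?thesis unfolding range image_Un by (simp only:)
    qed
    moreover have "pverts ?D = {Inl 0, Inr (Inl 0)} \<union> (\<lambda>k. Inr (Inr k)) ` {..<7}"
      by (auto simp: disjoint_union_def path_graph_def Plus_def)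
    ultimately show "pverts ?D = (g \<circ> f) ` pverts ?H"
      by (simp only: pair_pre_digraph.select_convs HV gf)
    have I: "?I = map_prod (\<lambda>k. k + 3) (\<lambda>k. k + 3) ` parcs (path_graph 7)"
    proof (intro equalityI subsetI)
      fix e assume "e \<in> ?I"
      then obtain i j where ij: "e = (i, j)" "3 \<le> i" "3 \<le> j" "i < 10" "j < 10" "path_rel i j" by auto
      then have "(i - 3, j - 3) \<in> parcs (path_graph 7)" by (auto simp: path_graph_def)
      moreover have "e = map_prod (\<lambda>k. k + 3) (\<lambda>k. k + 3) (i - 3, j - 3)" using ij by simp
      ultimately show "e \<in> map_prod (\<lambda>k. k + 3) (\<lambda>k. k + 3) ` parcs (path_graph 7)" by blast
    qed (auto simp: path_graph_def)
    have "map_prod (g \<circ> f) (g \<circ> f) ` parcs ?H = map_prod (\<lambda>k. Inr (Inr k)) (\<lambda>k. Inr (Inr k)) ` parcs (path_graph 7)"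
    proof -
      have "map_prod (g \<circ> f) (g \<circ> f) (?f (map_prod (\<lambda>k. k + 3) (\<lambda>k. k + 3) e))
          = map_prod (\<lambda>k. Inr (Inr k)) (\<lambda>k. Inr (Inr k)) e" if e_in: "e \<in> parcs (path_graph 7)" for e
      proof -
        obtain i j where e: "e = (i, j)" "i < 7" "j < 7" using e_in by (auto simp: path_graph_def)
        then show ?thesis using f[of "i + 3"] f[of "j + 3"] by (simp add: g_def)
      qed
      then have "map_prod (g \<circ> f) (g \<circ> f) ` ?f ` map_prod (\<lambda>k. k + 3) (\<lambda>k. k + 3) ` parcs (path_graph 7)
          = map_prod (\<lambda>k. Inr (Inr k)) (\<lambda>k. Inr (Inr k)) ` parcs (path_graph 7)"
        unfolding image_image by (rule image_cong[OF refl])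
      then show ?thesis by (simp only: pair_pre_digraph.select_convs HA I)
    qed
    moreover have "parcs ?D = map_prod (\<lambda>k. Inr (Inr k)) (\<lambda>k. Inr (Inr k)) ` parcs (path_graph 7)"
    proof -
      have "parcs (path_graph 1) = {}" by (auto simp: path_graph_def)
      then show ?thesis
        unfolding disjoint_union_def by (simp add: image_image) (rule image_cong[OF refl], auto)
    qed
    ultimately show "parcs ?D = map_prod (g \<circ> f) (g \<circ> f) ` parcs ?H" by simp
  qed
  then show ?thesis
    unfolding iso_T_def using tree major del by auto
qed

lemma iso_F_bitriangle:
  assumes vs: "distinct vs" "length vs = 6"
  shows "iso_F 3 3 (list_graph vs bitriangle_rel)"
proof -
  define K :: "nat pair_pre_digraph" where
    "K = \<lparr>pverts = {..<6}, parcs = {0, 1, 2} \<times> {3, 4, 5} \<union> {3, 4, 5} \<times> {0, 1, 2}\<rparr>"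
  have "complete_bipartite_digraph 3 3 (with_proj K)"
  proof -
    have "\<exists>U V. pverts K = U \<union> V \<and> U \<inter> V = {} \<and> card U = 3 \<and> card V = 3 \<and> parcs K = U \<times> V \<union> V \<times> U"
      by (rule exI[of _ "{0, 1, 2}"], rule exI[of _ "{3, 4, 5}"]) (auto simp: K_def)
    then show ?thesis by (simp add: complete_bipartite_digraph_pair_def) (simp add: K_def)
  qed
  moreover have "(2, 3) \<in> parcs K" by (simp add: K_def)
  moreover have "graph_iso (list_graph vs bitriangle_rel) (complement_graph (delete_edge K 2 3))"
  proof (rule list_graph_iso[OF vs])
    show "pverts (complement_graph (delete_edge K 2 3)) = {..<6}"
      by (simp add: complement_graph_def delete_edge_def K_def)
    have rel: "i \<noteq> j \<and> (i, j) \<notin> parcs (delete_edge K 2 3) \<longleftrightarrow> bitriangle_rel i j" if "i < 6" "j < 6" for i j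
      using less_6_cases[OF that(1)] less_6_cases[OF that(2)]
      by (elim disjE) (simp_all add: delete_edge_def K_def bitriangle_rel_def)
    have "pverts (delete_edge K 2 3) = {..<6}" by (simp add: delete_edge_def K_def)
    then have "parcs (complement_graph (delete_edge K 2 3))
        = {(i, j). i < 6 \<and> j < 6 \<and> i \<noteq> j \<and> (i, j) \<notin> parcs (delete_edge K 2 3)}"
      by (simp add: complement_graph_def)
    also have "\<dots> = {(i, j). i < 6 \<and> j < 6 \<and> bitriangle_rel i j}"
      using rel by blast
    finally show "parcs (complement_graph (delete_edge K 2 3)) = {(i, j). i < 6 \<and> j < 6 \<and> bitriangle_rel i j}" .
  qed
  ultimately show ?thesis unfolding iso_F_def by blast
qed

section \<open>The candidate graphs have the required independence number\<close>

lemma path_in_conn_graphs: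
  assumes "distinct vs" "length vs = n" "n \<in> {8, 9}"
  shows "list_graph vs path_rel \<in> conn_graphs n (n - 4)"
proof -
  consider "n = 8" | "n = 9" using assms(3) by auto
  then show ?thesis
  proof cases
    case 1
    show ?thesis
    proof (rule list_graph_in_conn_graphs[OF assms(1,2) _ graph_rel_path, where I = "{0, 2, 4, 6}"])
      fix b :: "nat \<Rightarrow> nat"
      assume "\<And>i j. i < n \<Longrightarrow> j < n \<Longrightarrow> path_rel i j \<Longrightarrow> b i + b j \<le> 1"
      from this[of 0 1] this[of 2 3] this[of 4 5] this[of 6 7] show "sum b {..<n} \<le> n - 4"
        using 1 by (simp add: lessThan_nat_numeral)
    qed (use 1 in auto)
  next
    case 2
    show ?thesis
    proof (rule list_graph_in_conn_graphs[OF assms(1,2) _ graph_rel_path, where I = "{0, 2, 4, 6, 8}"])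
      fix b :: "nat \<Rightarrow> nat"
      assume "\<And>i j. i < n \<Longrightarrow> j < n \<Longrightarrow> path_rel i j \<Longrightarrow> b i + b j \<le> 1"
      \<comment> \<open>Four matching edges and one more at the last vertex cover all nine vertices,
        so five constraints suffice.\<close>
      from this[of 0 1] this[of 2 3] this[of 4 5] this[of 6 7] this[of 8 7] show "sum b {..<n} \<le> n - 4"
        using 2 by (simp add: lessThan_nat_numeral)
    qed (use 2 in auto)
  qed
qed

lemma cycle_in_conn_graphs:
  assumes "distinct vs" "length vs = 7"
  shows "list_graph vs (cycle_rel 7) \<in> conn_graphs 7 3"
proof (rule list_graph_in_conn_graphs[OF assms _ graph_rel_cycle, where I = "{0, 2, 4}"])
  fix b :: "nat \<Rightarrow> nat"
  assume "\<And>i j. i < 7 \<Longrightarrow> j < 7 \<Longrightarrow> cycle_rel 7 i j \<Longrightarrow> b i + b j \<le> 1"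
  \<comment> \<open>All seven edges together count every vertex twice, so the sum is at most
    7/2.\<close>
  from this[of 0 1] this[of 1 2] this[of 2 3] this[of 3 4] this[of 4 5] this[of 5 6] this[of 6 0]
  show "sum b {..<7} \<le> 3" by (simp add: lessThan_nat_numeral)
next
  fix i j :: nat assume "i \<in> {0, 2, 4}" "j \<in> {0, 2, 4}"
  then show "\<not> cycle_rel 7 i j"
    by (elim insertE emptyE; simp)
qed simp_all

lemma fork_in_conn_graphs:
  assumes "distinct vs" "length vs = 10"
  shows "list_graph vs fork_rel \<in> conn_graphs 10 6"
proof (rule list_graph_in_conn_graphs[OF assms _ graph_rel_fork, where I = "{1, 2, 3, 5, 7, 9}"])
  fix b :: "nat \<Rightarrow> nat"
  assume "\<And>i j. i < 10 \<Longrightarrow> j < 10 \<Longrightarrow> fork_rel i j \<Longrightarrow> b i + b j \<le> 1"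
  \<comment> \<open>Six edges that cover all ten vertices.\<close>
  from this[of 0 1] this[of 0 2] this[of 3 4] this[of 5 6] this[of 7 8] this[of 9 8]
  show "sum b {..<10} \<le> 6" by (simp add: lessThan_nat_numeral fork_rel_def)
next
  fix i j :: nat assume "i \<in> {1, 2, 3, 5, 7, 9}" "j \<in> {1, 2, 3, 5, 7, 9}"
  then show "\<not> fork_rel i j"
    by (elim insertE emptyE; simp add: fork_rel_def)
qed simp_all

lemma bitriangle_in_conn_graphs:
  assumes "distinct vs" "length vs = 6"
  shows "list_graph vs bitriangle_rel \<in> conn_graphs 6 2"
proof (rule list_graph_in_conn_graphs[OF assms _ graph_rel_bitriangle, where I = "{0, 4}"])
  fix b :: "nat \<Rightarrow> nat"
  assume "\<And>i j. i < 6 \<Longrightarrow> j < 6 \<Longrightarrow> bitriangle_rel i j \<Longrightarrow> b i + b j \<le> 1"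
  from this[of 0 1] this[of 1 2] this[of 2 0] this[of 3 4] this[of 4 5] this[of 5 3]
  have "b 0 + b 1 \<le> 1 \<and> b 1 + b 2 \<le> 1 \<and> b 2 + b 0 \<le> 1" "b 3 + b 4 \<le> 1 \<and> b 4 + b 5 \<le> 1 \<and> b 5 + b 3 \<le> 1"
    by (simp_all add: bitriangle_rel_def)
  \<comment> \<open>Each triangle sums to at most 3/2, hence to at most 1 by integrality.\<close>
  then have "b 0 + b 1 + b 2 \<le> 1" "b 3 + b 4 + b 5 \<le> 1" by linarith+
  then show "sum b {..<6} \<le> 2" by (simp add: lessThan_nat_numeral)
next
  fix i j :: nat assume "i \<in> {0, 4}" "j \<in> {0, 4}"
  then show "\<not> bitriangle_rel i j"
    by (elim insertE emptyE; simp add: bitriangle_rel_def)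
qed simp_all

lemma cycle_spectral_radius_le:
  assumes vs: "distinct vs" "length vs = 7" and a: "a < 1"
  shows "A_spectral_radius a (list_graph vs (cycle_rel 7)) \<le> 2"
proof (rule list_graph_spectral_radius_le[OF vs _ graph_rel_cycle a, of "\<lambda>_. 1"])
  fix i :: nat assume "i < 7"
  then have "i = 0 \<or> i = 1 \<or> i = 2 \<or> i = 3 \<or> i = 4 \<or> i = 5 \<or> i = 6" by auto
  moreover have "[0..<7] = [0, 1, 2, 3, 4, 5, 6 :: nat]" by (simp add: upt_rec)
  ultimately show "a * real (length (filter (cycle_rel 7 i) [0..<7])) * 1
      + (1 - a) * sum_list (map (\<lambda>_. 1) (filter (cycle_rel 7 i) [0..<7])) \<le> 2 * 1"
    by (elim disjE) simp_all
qed simp_all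

theorem theorem3p4:
  fixes n :: nat and \<alpha> :: real and G :: "'a pair_pre_digraph"
  assumes "5 \<le> n" and "n \<le> 10"
    and "0 \<le> \<alpha>" and "\<alpha> \<le> 1"
    and "is_arg_min (A_spectral_radius \<alpha>) (\<lambda>H. H \<in> conn_graphs n (n - 4)) G"
  shows "(n = 5 \<longrightarrow> \<alpha> \<in> {0..<1} \<longrightarrow> complete_digraph 5 (with_proj G))
    \<and> (n = 6 \<longrightarrow> \<alpha> \<in> {0..7 / 9} \<longrightarrow> iso_F 3 3 G)
    \<and> (n = 7 \<longrightarrow> \<alpha> \<in> {0..<1} \<longrightarrow> graph_iso G (cycle_graph 7))
    \<and> (n \<in> {8, 9} \<longrightarrow> \<alpha> \<in> {0..<1} \<longrightarrow> graph_iso G (path_graph n))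
    \<and> (n = 10 \<longrightarrow> \<alpha> \<in> {0..<1} \<longrightarrow> iso_T 1 1 7 G)"
proof -
  have G: "G \<in> conn_graphs n (n - 4)"
    and min: "\<And>H :: 'a pair_pre_digraph. H \<in> conn_graphs n (n - 4) \<Longrightarrow> A_spectral_radius \<alpha> G \<le> A_spectral_radius \<alpha> H"
    using assms(5) by (auto simp: is_arg_min_def not_less)
  interpret conn_graph G
    using G by (auto simp: conn_graphs_def conn_graph_def conn_graph_axioms_def)
  have n: "card (pverts G) = n" and ind: "independence_number G = n - 4"
    using G by (auto simp: conn_graphs_def)
  have len: "length vs = n" if "distinct vs" "set vs = pverts G" for vs
    using that n distinct_card by metis
  obtain us where us: "distinct us" "set us = pverts G"
    using finite_distinct_list[OF pair_finite_verts] by blast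
  have "complete_digraph 5 (with_proj G)" if "n = 5"
  proof -
    have "(u, v) \<in> parcs G" if uv: "u \<in> pverts G" "v \<in> pverts G" "u \<noteq> v" for u v
    proof (rule ccontr)
      assume "(u, v) \<notin> parcs G"
      then have "independent_set G {u, v}"
        using uv not_self_nbr arc_sym[of v u] by (auto simp: independent_set_def)
      then show False using card_le_independence_number[of "{u, v}"] ind uv(3) \<open>n = 5\<close> by simp
    qed
    then have "parcs G = {(u, v). (u, v) \<in> pverts G \<times> pverts G \<and> u \<noteq> v}"
      using not_self_nbr by (auto dest: in_arcsD1 in_arcsD2)
    then show ?thesis
      using n that pair_finite_verts by (simp add: complete_digraph_pair_def)
  qed
  moreover have "iso_F 3 3 G" if "n = 6" "\<alpha> \<in> {0..7 / 9}"
  proof -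
    have "A_spectral_radius \<alpha> G \<le> 8 / 3"
      using min[of "list_graph us bitriangle_rel"] bitriangle_in_conn_graphs[OF us(1)] len[OF us] that
        bitriangle_spectral_radius_le[OF us(1), of \<alpha>] by simp
    moreover have "card (pverts G) = 6" "independence_number G = 2" using n ind that(1) by simp_all
    ultimately obtain vs where vs: "distinct vs" "set vs = pverts G" "G = list_graph vs bitriangle_rel"
      using extremal_bitriangle[OF _ _ assms(4)] by blast
    show ?thesis
      unfolding vs(3) using iso_F_bitriangle[OF vs(1)] len[OF vs(1,2)] that(1) by simp
  qed
  moreover have "graph_iso G (cycle_graph 7)" if "n = 7" "\<alpha> \<in> {0..<1}"
  proof -
    have "A_spectral_radius \<alpha> G \<le> 2"
      using min[of "list_graph us (cycle_rel 7)"] cycle_in_conn_graphs[OF us(1)] len[OF us] that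
        cycle_spectral_radius_le[OF us(1), of \<alpha>] by simp
    moreover have "card (pverts G) = 7" "independence_number G = 3" using n ind that(1) by simp_all
    ultimately obtain vs where vs: "distinct vs" "set vs = pverts G" "G = list_graph vs (cycle_rel 7)"
      using extremal_cycle[OF _ _ assms(4)] by blast
    have "graph_iso (list_graph vs (cycle_rel 7)) (cycle_graph 7)"
      using len[OF vs(1,2)] that(1) by (intro list_graph_iso[OF vs(1)]) (auto simp: cycle_graph_def)
    then show ?thesis unfolding vs(3) .
  qed
  moreover have "graph_iso G (path_graph n)" if n89: "n \<in> {8, 9}" and "\<alpha> \<in> {0..<1}"
  proof -
    have a: "\<alpha> < 1" using that(2) by simp
    have "A_spectral_radius \<alpha> G \<le> A_spectral_radius \<alpha> (list_graph vs path_rel)"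
      if "distinct vs" "set vs = pverts G" for vs
      using min path_in_conn_graphs[OF that(1) len[OF that] \<open>n \<in> {8, 9}\<close>] by blast
    then obtain vs where vs: "distinct vs" "set vs = pverts G" "G = list_graph vs path_rel"
      using extremal_path[OF n n89 assms(3) a] by blast
    have "graph_iso (list_graph vs path_rel) (path_graph n)"
      using len[OF vs(1,2)] by (intro list_graph_iso[OF vs(1)]) (auto simp: path_graph_def)
    then show ?thesis unfolding vs(3) .
  qed
  moreover have "iso_T 1 1 7 G" if "n = 10" "\<alpha> \<in> {0..<1}"
  proof -
    \<comment> \<open>With all degrees at most two there is a Hamiltonian path, so independent sets
      have at most five vertices, against the required six.\<close>
    have "\<exists>v. card (nbrs G v) \<ge> 3"
    proof (rule ccontr)
      assume "\<not> ?thesis"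
      then have none: "\<not> 3 \<le> card (nbrs G v)" for v by blast
      have deg: "card (nbrs G v) \<le> 2" for v using none[of v] by linarith
      obtain vs where vs: "distinct vs" "set vs = pverts G" "chain G vs"
        using hamiltonian_path[OF deg] .
      obtain S where S: "independent_set G S" "card S = independence_number G"
        using independence_number_attained .
      have "2 * card S \<le> Suc (length vs)" by (rule independent_set_chain[OF vs(3,1,2) S(1)])
      then show False using S(2) len[OF vs(1,2)] ind that(1) by simp
    qed
    then obtain v where v: "card (nbrs G v) \<ge> 3" by blast
    have a: "\<alpha> < 1" and n10: "card (pverts G) = 10" using that n by simp_all
    have "A_spectral_radius \<alpha> G \<le> A_spectral_radius \<alpha> (list_graph vs fork_rel)"
      if "distinct vs" "set vs = pverts G" for vs
      using min[of "list_graph vs fork_rel"] fork_in_conn_graphs[OF that(1)] len[OF that] \<open>n = 10\<close> by simp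
    then obtain vs where vs: "distinct vs" "set vs = pverts G" "G = list_graph vs fork_rel"
      using extremal_fork[OF n10 assms(3) a v] by blast
    show ?thesis
      unfolding vs(3) using iso_T_fork[OF vs(1)] len[OF vs(1,2)] that(1) by simp
  qed
  ultimately show ?thesis by blast
qed

end
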